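(* Let $\mathcal{T}$ and $\mathcal{S}$ be triangulated categories equipped with metrics, and let $F:\mathcal{T}\to\mathcal{S}$ and $G:\mathcal{S}\to\mathcal{T}$ be triangulated functors with $F$ left adjoint to $G$. If $F$ and $G$ are compressions, then the precomposition functor $-\circ F:\mathrm{Mod}\text{-}\mathcal{S}\to\mathrm{Mod}\text{-}\mathcal{T}$ induces a triangulated functor $-\circ F:\mathfrak{S}(\mathcal{S})\to\mathfrak{S}(\mathcal{T})$ between the completion of $\mathcal{S}$ and the completion of $\mathcal{T}$; that is, $-\circ F$ sends objects of $\mathfrak{S}(\mathcal{S})\subseteq\mathrm{Mod}\text{-}\mathcal{S}$ to objects of $\mathfrak{S}(\mathcal{T})\subseteq\mathrm{Mod}\text{-}\mathcal{T}$ (so its restriction commutes with the inclusions into $\mathrm{Mod}\text{-}\mathcal{S}$ and $\mathrm{Mod}\text{-}\mathcal{T}$), and the restricted functor $\mathfrak{S}(\mathcal{S})\to\mathfrak{S}(\mathcal{T})$ is triangulated.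
   Context: $\mathbb{N}=\{1,2,\dots\}$. All subcategories are full. Let $\mathcal{T}$ be a triangulated category with shift $\Sigma$. For subcategories $\mathcal{X},\mathcal{Z}\subseteq\mathcal{T}$, $\mathcal{X}*\mathcal{Z}$ is the subcategory of all objects $T$ admitting a distinguished triangle $X\to T\to Z\to\Sigma X$ with $X\in\mathcal{X}$, $Z\in\mathcal{Z}$. A metric on $\mathcal{T}$ is a non-increasing chain $B_1\supseteq B_2\supseteq\cdots$ of subcategories of $\mathcal{T}$ with $B_n*B_n=B_n$ and $0\in B_n$ for all $n$. A sequence $E_*=(E_1\to E_2\to\cdots)$ in $\mathcal{T}$ is a good Cauchy sequence if for all $i\in\mathbb{N}$, $j\in\mathbb{Z}$ there is $M\in\mathbb{N}$ such that for all $m'\ge m\ge M$ the cone $D_{m,m'}$ of the composite map $E_m\to E_{m'}$ satisfies $\Sigma^jD_{m,m'}\in B_i$. $\mathrm{Mod}\text{-}\mathcal{T}$ is the category of additive contravariant functors $\mathcal{T}\to\mathrm{Ab}$ and $Y:\mathcal{T}\to\mathrm{Mod}\text{-}\mathcal{T}$ is the Yoneda embedding. With respect to a given metric $\{B_n\}$: $\mathfrak{C}(\mathcal{T})=\bigcap_{j\in\mathbb{Z}}\bigcup_{i\in\mathbb{N}}Y(\Sigma^jB_i)^\perp$, where $\mathcal{C}^\perp$ is the subcategory of objects $X$ with $\mathrm{Hom}(C,X)=0$ for all $C\in\mathcal{C}$; $\mathfrak{L}(\mathcal{T})$ is the subcategory of $\mathrm{Mod}\text{-}\mathcal{T}$ of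 functors isomorphic to $\varinjlim Y(E_* )$ for some good Cauchy sequence $E_*$ in $\mathcal{T}$; and the completion is $\mathfrak{S}(\mathcal{T})=\mathfrak{C}(\mathcal{T})\cap\mathfrak{L}(\mathcal{T})$. By a theorem of Neeman, $\mathfrak{S}(\mathcal{T})$ is triangulated with shift $\Sigma E:=E\circ\Sigma^{-1}$ and with distinguished triangles those sequences $A\to B\to C\to\Sigma A$ in $\mathfrak{S}(\mathcal{T})$ isomorphic to the directed colimit in $\mathrm{Mod}\text{-}\mathcal{T}$ of the Yoneda image of a directed ($\mathbb{N}$-indexed) diagram of distinguished triangles $a_*\to b_*\to c_*\to\Sigma a_*$ in $\mathcal{T}$ in which $a_*,b_*,c_*,\Sigma a_*$ are good Cauchy sequences. If $\mathcal{T},\mathcal{S}$ have metrics $\{B_n\},\{C_n\}$, a triangulated functor $F:\mathcal{T}\to\mathcal{S}$ is a compression if for every $n\in\mathbb{N}$ there is $m\in\mathbb{N}$ with $F(B_m)\subseteq C_n$. *)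

theory Defs
  imports "HOL-Algebra.Group" "HOL-Library.FuncSet"
begin

section \<open>Categories enriched in abelian groups\<close>

text \<open>
  The hom-sets are abelian groups in the sense of HOL-Algebra, hence written multiplicatively: the
  sum of two parallel morphisms is their product in \<open>Hom C X Y\<close>, the zero morphism is
  \<open>\<one>\<^bsub>Hom C X Y\<^esub>\<close> and \<open>- f\<close> is \<open>inv\<^bsub>Hom C X Y\<^esub> f\<close>.
  Hom-sets need not be disjoint; therefore \<open>Comp C X Y Z g f\<close>, the composite of \<open>f : X \<rightarrow> Y\<close> and
  \<open>g : Y \<rightarrow> Z\<close>, takes the objects as arguments, and so does the action of a functor on morphisms.
\<close>

record ('o, 'm) precat =
  Obj :: "'o set"
  Hom :: "'o \<Rightarrow> 'o \<Rightarrow> 'm monoid"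
  Ident :: "'o \<Rightarrow> 'm"
  Comp :: "'o \<Rightarrow> 'o \<Rightarrow> 'o \<Rightarrow> 'm \<Rightarrow> 'm \<Rightarrow> 'm"

abbreviation homs :: "('o, 'm, 'z) precat_scheme \<Rightarrow> 'o \<Rightarrow> 'o \<Rightarrow> 'm set" where
  "homs C X Y \<equiv> carrier (Hom C X Y)"

locale preadditive_category =
  fixes C :: "('o, 'm, 'z) precat_scheme"
  assumes hom_comm_group: "\<lbrakk>X \<in> Obj C; Y \<in> Obj C\<rbrakk> \<Longrightarrow> comm_group (Hom C X Y)"
    and ident_in: "X \<in> Obj C \<Longrightarrow> Ident C X \<in> homs C X X"
    and comp_additive_right:
      "\<lbrakk>X \<in> Obj C; Y \<in> Obj C; Z \<in> Obj C; g \<in> homs C Y Z\<rbrakk>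
        \<Longrightarrow> (\<lambda>f. Comp C X Y Z g f) \<in> hom (Hom C X Y) (Hom C X Z)"
    and comp_additive_left:
      "\<lbrakk>X \<in> Obj C; Y \<in> Obj C; Z \<in> Obj C; f \<in> homs C X Y\<rbrakk>
        \<Longrightarrow> (\<lambda>g. Comp C X Y Z g f) \<in> hom (Hom C Y Z) (Hom C X Z)"
    and comp_ident_left:
      "\<lbrakk>X \<in> Obj C; Y \<in> Obj C; f \<in> homs C X Y\<rbrakk> \<Longrightarrow> Comp C X Y Y (Ident C Y) f = f"
    and comp_ident_right:
      "\<lbrakk>X \<in> Obj C; Y \<in> Obj C; f \<in> homs C X Y\<rbrakk> \<Longrightarrow> Comp C X X Y f (Ident C X) = f"
    and comp_assoc:
      "\<lbrakk>W \<in> Obj C; X \<in> Obj C; Y \<in> Obj C; Z \<in> Obj C;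
        f \<in> homs C W X; g \<in> homs C X Y; h \<in> homs C Y Z\<rbrakk>
        \<Longrightarrow> Comp C W Y Z h (Comp C W X Y g f) = Comp C W X Z (Comp C X Y Z h g) f"

definition is_zero :: "('o, 'm, 'z) precat_scheme \<Rightarrow> 'o \<Rightarrow> bool" where
  "is_zero C Z \<longleftrightarrow> Z \<in> Obj C \<and>
     (\<forall>X\<in>Obj C. (\<exists>!f. f \<in> homs C X Z) \<and> (\<exists>!f. f \<in> homs C Z X))"

definition is_iso :: "('o, 'm, 'z) precat_scheme \<Rightarrow> 'o \<Rightarrow> 'o \<Rightarrow> 'm \<Rightarrow> bool" where
  "is_iso C X Y f \<longleftrightarrow> f \<in> homs C X Y \<and>
     (\<exists>g\<in>homs C Y X. Comp C X Y X g f = Ident C X \<and> Comp C Y X Y f g = Ident C Y)"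

definition is_biproduct ::
  "('o, 'm, 'z) precat_scheme \<Rightarrow> 'o \<Rightarrow> 'o \<Rightarrow> 'o \<Rightarrow> 'm \<Rightarrow> 'm \<Rightarrow> 'm \<Rightarrow> 'm \<Rightarrow> bool" where
  "is_biproduct C X Y P i1 i2 p1 p2 \<longleftrightarrow>
     P \<in> Obj C \<and> i1 \<in> homs C X P \<and> i2 \<in> homs C Y P \<and> p1 \<in> homs C P X \<and> p2 \<in> homs C P Y \<and>
     Comp C X P X p1 i1 = Ident C X \<and> Comp C Y P Y p2 i2 = Ident C Y \<and>
     Comp C Y P X p1 i2 = \<one>\<^bsub>Hom C Y X\<^esub> \<and> Comp C X P Y p2 i1 = \<one>\<^bsub>Hom C X Y\<^esub> \<and>
     Comp C P X P i1 p1 \<otimes>\<^bsub>Hom C P P\<^esub> Comp C P Y P i2 p2 = Ident C P"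

locale additive_category = preadditive_category +
  assumes zero_ex: "\<exists>Z. is_zero C Z"
    and biproduct_ex:
      "\<lbrakk>X \<in> Obj C; Y \<in> Obj C\<rbrakk> \<Longrightarrow> \<exists>P i1 i2 p1 p2. is_biproduct C X Y P i1 i2 p1 p2"

definition op_cat :: "('o, 'm, 'z) precat_scheme \<Rightarrow> ('o, 'm) precat" where
  "op_cat C = \<lparr>Obj = Obj C, Hom = (\<lambda>X Y. Hom C Y X), Ident = Ident C,
     Comp = (\<lambda>X Y Z g f. Comp C Z Y X f g)\<rparr>"


section \<open>Functors\<close>

record ('o, 'm, 'p, 'n) functor_data =
  FO :: "'o \<Rightarrow> 'p"
  FM :: "'o \<Rightarrow> 'o \<Rightarrow> 'm \<Rightarrow> 'n"

definition additive_functor ::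
  "('o, 'm, 'y) precat_scheme \<Rightarrow> ('p, 'n, 'z) precat_scheme \<Rightarrow>
    ('o, 'm, 'p, 'n) functor_data \<Rightarrow> bool" where
  "additive_functor C D F \<longleftrightarrow>
     (\<forall>X\<in>Obj C. FO F X \<in> Obj D) \<and>
     (\<forall>X\<in>Obj C. \<forall>Y\<in>Obj C. FM F X Y \<in> hom (Hom C X Y) (Hom D (FO F X) (FO F Y))) \<and>
     (\<forall>X\<in>Obj C. FM F X X (Ident C X) = Ident D (FO F X)) \<and>
     (\<forall>X\<in>Obj C. \<forall>Y\<in>Obj C. \<forall>Z\<in>Obj C. \<forall>f\<in>homs C X Y. \<forall>g\<in>homs C Y Z.
        FM F X Z (Comp C X Y Z g f) =
        Comp D (FO F X) (FO F Y) (FO F Z) (FM F Y Z g) (FM F X Y f))"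

definition comp_functor ::
  "('p, 'n, 'q, 'k) functor_data \<Rightarrow> ('o, 'm, 'p, 'n) functor_data \<Rightarrow>
    ('o, 'm, 'q, 'k) functor_data" where
  "comp_functor G F = \<lparr>FO = (\<lambda>X. FO G (FO F X)),
     FM = (\<lambda>X Y f. FM G (FO F X) (FO F Y) (FM F X Y f))\<rparr>"

definition op_functor :: "('o, 'm, 'p, 'n) functor_data \<Rightarrow> ('o, 'm, 'p, 'n) functor_data" where
  "op_functor F = \<lparr>FO = FO F, FM = (\<lambda>X Y. FM F Y X)\<rparr>"

text \<open>The normal form of functor data: undefined outside the objects and morphisms of \<open>C\<close>.\<close>

definition restrict_functor ::
  "('o, 'm, 'z) precat_scheme \<Rightarrow> ('o, 'm, 'p, 'n) functor_data \<Rightarrow>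
    ('o, 'm, 'p, 'n) functor_data" where
  "restrict_functor C F = \<lparr>FO = restrict (FO F) (Obj C),
     FM = (\<lambda>X Y f. if X \<in> Obj C \<and> Y \<in> Obj C \<and> f \<in> homs C X Y then FM F X Y f else undefined)\<rparr>"

definition nat_iso ::
  "('o, 'm, 'y) precat_scheme \<Rightarrow> ('p, 'n, 'z) precat_scheme \<Rightarrow>
    ('o, 'm, 'p, 'n) functor_data \<Rightarrow> ('o, 'm, 'p, 'n) functor_data \<Rightarrow> ('o \<Rightarrow> 'n) \<Rightarrow> bool" where
  "nat_iso C D F G \<phi> \<longleftrightarrow>
     (\<forall>X\<in>Obj C. is_iso D (FO F X) (FO G X) (\<phi> X)) \<and>
     (\<forall>X\<in>Obj C. \<forall>Y\<in>Obj C. \<forall>f\<in>homs C X Y.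
        Comp D (FO F X) (FO F Y) (FO G Y) (\<phi> Y) (FM F X Y f) =
        Comp D (FO F X) (FO G X) (FO G Y) (FM G X Y f) (\<phi> X))"

definition left_adjoint ::
  "('o, 'm, 'y) precat_scheme \<Rightarrow> ('p, 'n, 'z) precat_scheme \<Rightarrow>
    ('o, 'm, 'p, 'n) functor_data \<Rightarrow> ('p, 'n, 'o, 'm) functor_data \<Rightarrow> bool" where
  "left_adjoint C D F G \<longleftrightarrow>
     (\<exists>\<Phi>.
       (\<forall>X\<in>Obj C. \<forall>Y\<in>Obj D. bij_betw (\<Phi> X Y) (homs D (FO F X) Y) (homs C X (FO G Y))) \<and>
       (\<forall>X\<in>Obj C. \<forall>X'\<in>Obj C. \<forall>Y\<in>Obj D. \<forall>f\<in>homs C X' X. \<forall>k\<in>homs D (FO F X) Y.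
          \<Phi> X' Y (Comp D (FO F X') (FO F X) Y k (FM F X' X f)) =
          Comp C X' X (FO G Y) (\<Phi> X Y k) f) \<and>
       (\<forall>X\<in>Obj C. \<forall>Y\<in>Obj D. \<forall>Y'\<in>Obj D. \<forall>g\<in>homs D Y Y'. \<forall>k\<in>homs D (FO F X) Y.
          \<Phi> X Y' (Comp D (FO F X) Y Y' g k) =
          Comp C X (FO G Y) (FO G Y') (FM G Y Y' g) (\<Phi> X Y k)))"


section \<open>Triangulated categories\<close>

text \<open>
  The shift is an automorphism, \<open>Unshift\<close> being its inverse. \<open>Tri T X Y Z f g h\<close> says that
  \<open>X \<rightarrow> Y \<rightarrow> Z \<rightarrow> \<Sigma> X\<close>, with maps \<open>f\<close>, \<open>g\<close>, \<open>h\<close>, is a distinguished triangle.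
\<close>

record ('o, 'm) tricat = "('o, 'm) precat" +
  Shift :: "('o, 'm, 'o, 'm) functor_data"
  Unshift :: "('o, 'm, 'o, 'm) functor_data"
  Tri :: "'o \<Rightarrow> 'o \<Rightarrow> 'o \<Rightarrow> 'm \<Rightarrow> 'm \<Rightarrow> 'm \<Rightarrow> bool"

definition triangle_mor ::
  "('o, 'm, 'z) tricat_scheme \<Rightarrow>
    'o \<Rightarrow> 'o \<Rightarrow> 'o \<Rightarrow> 'm \<Rightarrow> 'm \<Rightarrow> 'm \<Rightarrow> 'o \<Rightarrow> 'o \<Rightarrow> 'o \<Rightarrow> 'm \<Rightarrow> 'm \<Rightarrow> 'm \<Rightarrow>
    'm \<Rightarrow> 'm \<Rightarrow> 'm \<Rightarrow> bool" where
  "triangle_mor T X Y Z f g h X' Y' Z' f' g' h' a b c \<longleftrightarrow>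
     a \<in> homs T X X' \<and> b \<in> homs T Y Y' \<and> c \<in> homs T Z Z' \<and>
     Comp T X Y Y' b f = Comp T X X' Y' f' a \<and>
     Comp T Y Z Z' c g = Comp T Y Y' Z' g' b \<and>
     Comp T Z (FO (Shift T) X) (FO (Shift T) X') (FM (Shift T) X X' a) h =
     Comp T Z Z' (FO (Shift T) X') h' c"

locale triangulated_category = additive_category T
  for T :: "('o, 'm, 'z) tricat_scheme" +
  assumes shift_functor: "additive_functor T T (Shift T)"
    and unshift_functor: "additive_functor T T (Unshift T)"
    and unshift_shift_obj: "X \<in> Obj T \<Longrightarrow> FO (Unshift T) (FO (Shift T) X) = X"
    and shift_unshift_obj: "X \<in> Obj T \<Longrightarrow> FO (Shift T) (FO (Unshift T) X) = X"
    and unshift_shift_mor: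
      "\<lbrakk>X \<in> Obj T; Y \<in> Obj T; f \<in> homs T X Y\<rbrakk>
        \<Longrightarrow> FM (Unshift T) (FO (Shift T) X) (FO (Shift T) Y) (FM (Shift T) X Y f) = f"
    and shift_unshift_mor:
      "\<lbrakk>X \<in> Obj T; Y \<in> Obj T; f \<in> homs T X Y\<rbrakk>
        \<Longrightarrow> FM (Shift T) (FO (Unshift T) X) (FO (Unshift T) Y) (FM (Unshift T) X Y f) = f"
    and tri_typed:
      "Tri T X Y Z f g h \<Longrightarrow>
        X \<in> Obj T \<and> Y \<in> Obj T \<and> Z \<in> Obj T \<and>
        f \<in> homs T X Y \<and> g \<in> homs T Y Z \<and> h \<in> homs T Z (FO (Shift T) X)"
    and tri_iso:
      "\<lbrakk>Tri T X Y Z f g h; X' \<in> Obj T; Y' \<in> Obj T; Z' \<in> Obj T;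
        f' \<in> homs T X' Y'; g' \<in> homs T Y' Z'; h' \<in> homs T Z' (FO (Shift T) X');
        triangle_mor T X Y Z f g h X' Y' Z' f' g' h' a b c;
        is_iso T X X' a; is_iso T Y Y' b; is_iso T Z Z' c\<rbrakk>
        \<Longrightarrow> Tri T X' Y' Z' f' g' h'"
    and tri_ident:
      "\<lbrakk>X \<in> Obj T; is_zero T Z\<rbrakk>
        \<Longrightarrow> Tri T X X Z (Ident T X) \<one>\<^bsub>Hom T X Z\<^esub> \<one>\<^bsub>Hom T Z (FO (Shift T) X)\<^esub>"
    and tri_complete:
      "\<lbrakk>X \<in> Obj T; Y \<in> Obj T; f \<in> homs T X Y\<rbrakk> \<Longrightarrow> \<exists>Z g h. Tri T X Y Z f g h"
    and tri_rotate:
      "\<lbrakk>X \<in> Obj T; Y \<in> Obj T; Z \<in> Obj T;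
        f \<in> homs T X Y; g \<in> homs T Y Z; h \<in> homs T Z (FO (Shift T) X)\<rbrakk>
        \<Longrightarrow> Tri T X Y Z f g h \<longleftrightarrow>
            Tri T Y Z (FO (Shift T) X) g h
              (inv\<^bsub>Hom T (FO (Shift T) X) (FO (Shift T) Y)\<^esub> FM (Shift T) X Y f)"
    and tri_fill:
      "\<lbrakk>Tri T X Y Z f g h; Tri T X' Y' Z' f' g' h'; a \<in> homs T X X'; b \<in> homs T Y Y';
        Comp T X Y Y' b f = Comp T X X' Y' f' a\<rbrakk>
        \<Longrightarrow> \<exists>c. triangle_mor T X Y Z f g h X' Y' Z' f' g' h' a b c"
    and octahedral:
      "\<lbrakk>Tri T X Y Z' f u u'; Tri T Y Z X' g v v'; Tri T X Z Y' (Comp T X Y Z g f) w w'\<rbrakk>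
        \<Longrightarrow> \<exists>a b. Tri T Z' Y' X' a b
                    (Comp T X' (FO (Shift T) Y) (FO (Shift T) Z') (FM (Shift T) Y Z' u) v') \<and>
              Comp T Y Z' Y' a u = Comp T Y Z Y' w g \<and>
              Comp T Z' Y' (FO (Shift T) X) w' a = u' \<and>
              Comp T Z Y' X' b w = v \<and>
              Comp T Y' X' (FO (Shift T) Y) v' b =
              Comp T Y' (FO (Shift T) X) (FO (Shift T) Y) (FM (Shift T) X Y f) w'"

definition triangulated_functor ::
  "('o, 'm, 'y) tricat_scheme \<Rightarrow> ('p, 'n, 'z) tricat_scheme \<Rightarrow>
    ('o, 'm, 'p, 'n) functor_data \<Rightarrow> bool" where
  "triangulated_functor T S F \<longleftrightarrow>
     additive_functor T S F \<and>
     (\<exists>\<phi>. nat_iso T S (comp_functor F (Shift T)) (comp_functor (Shift S) F) \<phi> \<and>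
       (\<forall>X Y Z f g h. Tri T X Y Z f g h \<longrightarrow>
          Tri S (FO F X) (FO F Y) (FO F Z) (FM F X Y f) (FM F Y Z g)
            (Comp S (FO F Z) (FO F (FO (Shift T) X)) (FO (Shift S) (FO F X))
              (\<phi> X) (FM F Z (FO (Shift T) X) h))))"

definition shift_pow :: "('o, 'm, 'z) tricat_scheme \<Rightarrow> int \<Rightarrow> 'o \<Rightarrow> 'o" where
  "shift_pow T j X =
     (if 0 \<le> j then (FO (Shift T) ^^ nat j) X else (FO (Unshift T) ^^ nat (- j)) X)"


section \<open>Metrics and good Cauchy sequences\<close>

text \<open>
  Full subcategories are given by their sets of objects. Metrics and sequences are indexed by
  \<open>nat\<close>, starting at \<open>0\<close>.
\<close>

definition star :: "('o, 'm, 'z) tricat_scheme \<Rightarrow> 'o set \<Rightarrow> 'o set \<Rightarrow> 'o set" where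
  "star T \<X> \<Z> = {Y \<in> Obj T. \<exists>X\<in>\<X>. \<exists>Z\<in>\<Z>. \<exists>f g h. Tri T X Y Z f g h}"

definition metric :: "('o, 'm, 'z) tricat_scheme \<Rightarrow> (nat \<Rightarrow> 'o set) \<Rightarrow> bool" where
  "metric T B \<longleftrightarrow>
     (\<forall>n. B n \<subseteq> Obj T \<and> B (Suc n) \<subseteq> B n \<and> star T (B n) (B n) = B n \<and>
          (\<forall>Z. is_zero T Z \<longrightarrow> Z \<in> B n))"

definition compression ::
  "('o, 'm, 'y) tricat_scheme \<Rightarrow> (nat \<Rightarrow> 'o set) \<Rightarrow>
    ('p, 'n, 'z) tricat_scheme \<Rightarrow> (nat \<Rightarrow> 'p set) \<Rightarrow> ('o, 'm, 'p, 'n) functor_data \<Rightarrow> bool" where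
  "compression T B S C F \<longleftrightarrow>
     triangulated_functor T S F \<and> (\<forall>n. \<exists>m. FO F ` B m \<subseteq> C n)"

text \<open>\<open>e n\<close> is the map \<open>E n \<rightarrow> E (Suc n)\<close>.\<close>

definition is_seq ::
  "('o, 'm, 'z) precat_scheme \<Rightarrow> (nat \<Rightarrow> 'o) \<Rightarrow> (nat \<Rightarrow> 'm) \<Rightarrow> bool" where
  "is_seq C E e \<longleftrightarrow> (\<forall>n. E n \<in> Obj C \<and> e n \<in> homs C (E n) (E (Suc n)))"

text \<open>\<open>seq_map C E e m k\<close> is the composite map \<open>E m \<rightarrow> E (m + k)\<close>.\<close>

primrec seq_map ::
  "('o, 'm, 'z) precat_scheme \<Rightarrow> (nat \<Rightarrow> 'o) \<Rightarrow> (nat \<Rightarrow> 'm) \<Rightarrow> nat \<Rightarrow> nat \<Rightarrow> 'm" where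
  "seq_map C E e m 0 = Ident C (E m)"
| "seq_map C E e m (Suc k) =
     Comp C (E m) (E (m + k)) (E (Suc (m + k))) (e (m + k)) (seq_map C E e m k)"

definition is_cone :: "('o, 'm, 'z) tricat_scheme \<Rightarrow> 'o \<Rightarrow> 'o \<Rightarrow> 'm \<Rightarrow> 'o \<Rightarrow> bool" where
  "is_cone T X Y f D \<longleftrightarrow> (\<exists>g h. Tri T X Y D f g h)"

text \<open>
  Cones exist and are unique up to isomorphism, and each \<open>B i\<close> is closed under isomorphism,
  so it does not matter which cone is taken.
\<close>

definition good_cauchy ::
  "('o, 'm, 'z) tricat_scheme \<Rightarrow> (nat \<Rightarrow> 'o set) \<Rightarrow> (nat \<Rightarrow> 'o) \<Rightarrow> (nat \<Rightarrow> 'm) \<Rightarrow> bool" where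
  "good_cauchy T B E e \<longleftrightarrow> is_seq T E e \<and>
     (\<forall>i. \<forall>j::int. \<exists>M. \<forall>m\<ge>M. \<forall>m'\<ge>m. \<forall>D.
        is_cone T (E m) (E m') (seq_map T E e m (m' - m)) D \<longrightarrow> shift_pow T j D \<in> B i)"


section \<open>Modules\<close>

text \<open>
  Abelian groups with underlying set in a type \<open>'a\<close>. The functors from \<open>op_cat C\<close> to the category of
  these groups play the role of \<open>Mod-C\<close>, for each choice of \<open>'a\<close>. Since the values of the Yoneda
  embedding and of colimits live over other types (\<open>'m\<close> and \<open>(nat \<times> 'm) set\<close>), homomorphisms and
  natural transformations are allowed to relate groups over two different types.
\<close>

definition ab_hom :: "'a monoid \<Rightarrow> 'b monoid \<Rightarrow> ('a \<Rightarrow> 'b) monoid" where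
  "ab_hom G H = \<lparr>carrier = hom G H \<inter> extensional (carrier G),
     monoid.mult = (\<lambda>f g. \<lambda>x\<in>carrier G. f x \<otimes>\<^bsub>H\<^esub> g x),
     one = (\<lambda>x\<in>carrier G. \<one>\<^bsub>H\<^esub>)\<rparr>"

definition Ab :: "('a monoid, 'a \<Rightarrow> 'a) precat" where
  "Ab = \<lparr>Obj = {G. comm_group G}, Hom = ab_hom, Ident = (\<lambda>G. \<lambda>x\<in>carrier G. x),
     Comp = (\<lambda>G H K g f. compose (carrier G) g f)\<rparr>"

type_synonym ('o, 'm, 'a) module_data = "('o, 'm, 'a monoid, 'a \<Rightarrow> 'a) functor_data"

definition is_module :: "('o, 'm, 'z) precat_scheme \<Rightarrow> ('o, 'm, 'a) module_data \<Rightarrow> bool" where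
  "is_module C M \<longleftrightarrow> additive_functor (op_cat C) Ab M \<and> restrict_functor (op_cat C) M = M"

text \<open>
  The group of natural transformations. Recall that \<open>FM M X Y f : M X \<rightarrow> M Y\<close> for \<open>f : Y \<rightarrow> X\<close> in \<open>C\<close>.
\<close>

definition mod_hom ::
  "('o, 'm, 'z) precat_scheme \<Rightarrow> ('o, 'm, 'a) module_data \<Rightarrow> ('o, 'm, 'b) module_data \<Rightarrow>
    ('o \<Rightarrow> 'a \<Rightarrow> 'b) monoid" where
  "mod_hom C M N =
     \<lparr>carrier = {\<eta> \<in> (\<Pi>\<^sub>E X\<in>Obj C. carrier (ab_hom (FO M X) (FO N X))).
        \<forall>X\<in>Obj C. \<forall>Y\<in>Obj C. \<forall>f\<in>homs C Y X. \<forall>x\<in>carrier (FO M X).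
          \<eta> Y (FM M X Y f x) = FM N X Y f (\<eta> X x)},
      monoid.mult = (\<lambda>\<eta> \<theta>. \<lambda>X\<in>Obj C. \<eta> X \<otimes>\<^bsub>ab_hom (FO M X) (FO N X)\<^esub> \<theta> X),
      one = (\<lambda>X\<in>Obj C. \<one>\<^bsub>ab_hom (FO M X) (FO N X)\<^esub>)\<rparr>"

definition mod_ident ::
  "('o, 'm, 'z) precat_scheme \<Rightarrow> ('o, 'm, 'a) module_data \<Rightarrow> 'o \<Rightarrow> 'a \<Rightarrow> 'a" where
  "mod_ident C M = (\<lambda>X\<in>Obj C. \<lambda>x\<in>carrier (FO M X). x)"

text \<open>The composite of \<open>\<eta> : L \<rightarrow> M\<close> and \<open>\<theta> : M \<rightarrow> N\<close>.\<close>

definition mod_comp ::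
  "('o, 'm, 'z) precat_scheme \<Rightarrow> ('o, 'm, 'a) module_data \<Rightarrow>
    ('o \<Rightarrow> 'b \<Rightarrow> 'c) \<Rightarrow> ('o \<Rightarrow> 'a \<Rightarrow> 'b) \<Rightarrow> 'o \<Rightarrow> 'a \<Rightarrow> 'c" where
  "mod_comp C L \<theta> \<eta> = (\<lambda>X\<in>Obj C. compose (carrier (FO L X)) (\<theta> X) (\<eta> X))"

definition Mod ::
  "('o, 'm, 'z) precat_scheme \<Rightarrow> (('o, 'm, 'a) module_data, 'o \<Rightarrow> 'a \<Rightarrow> 'a) precat" where
  "Mod C = \<lparr>Obj = {M. is_module C M}, Hom = mod_hom C, Ident = mod_ident C,
     Comp = (\<lambda>L M N. mod_comp C L)\<rparr>"

definition mod_iso ::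
  "('o, 'm, 'z) precat_scheme \<Rightarrow> ('o, 'm, 'a) module_data \<Rightarrow> ('o, 'm, 'b) module_data \<Rightarrow>
    ('o \<Rightarrow> 'a \<Rightarrow> 'b) \<Rightarrow> bool" where
  "mod_iso C M N \<eta> \<longleftrightarrow> \<eta> \<in> carrier (mod_hom C M N) \<and>
     (\<exists>\<theta>\<in>carrier (mod_hom C N M).
        mod_comp C M \<theta> \<eta> = mod_ident C M \<and> mod_comp C N \<eta> \<theta> = mod_ident C N)"

definition yoneda ::
  "('o, 'm, 'z) precat_scheme \<Rightarrow> ('o, 'm, ('o, 'm, 'm) module_data, 'o \<Rightarrow> 'm \<Rightarrow> 'm) functor_data"
  where
  "yoneda C =
     \<lparr>FO = (\<lambda>A. restrict_functor (op_cat C)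
        \<lparr>FO = (\<lambda>X. Hom C X A), FM = (\<lambda>X Y f. \<lambda>g\<in>homs C X A. Comp C Y X A g f)\<rparr>),
      FM = (\<lambda>A A' a. \<lambda>X\<in>Obj C. \<lambda>g\<in>homs C X A. Comp C X A A' a g)\<rparr>"

text \<open>
  For a functor \<open>F\<close> out of \<open>C\<close>, the functor \<open>- \<circ> F\<close> from modules over the target of \<open>F\<close> to modules
  over \<open>C\<close>.
\<close>

definition precomp ::
  "('o, 'm, 'z) precat_scheme \<Rightarrow> ('o, 'm, 'p, 'n) functor_data \<Rightarrow>
    (('p, 'n, 'a) module_data, 'p \<Rightarrow> 'a \<Rightarrow> 'a, ('o, 'm, 'a) module_data, 'o \<Rightarrow> 'a \<Rightarrow> 'a) functor_data"
  where
  "precomp C F =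
     \<lparr>FO = (\<lambda>M. restrict_functor (op_cat C) (comp_functor M (op_functor F))),
      FM = (\<lambda>M N \<eta>. \<lambda>X\<in>Obj C. \<eta> (FO F X))\<rparr>"


section \<open>Sequential colimits of modules\<close>

text \<open>
  The colimit of a sequence of modules \<open>M 0 \<rightarrow> M 1 \<rightarrow> \<dots>\<close>, with transition maps \<open>\<mu> n\<close>, is computed
  objectwise: its elements at \<open>X\<close> are the classes of pairs \<open>(n, x)\<close> with \<open>x \<in> M n X\<close>, two pairs
  being identified when they become equal at some later stage.
\<close>

definition colim_rel ::
  "('o, 'm, 'z) precat_scheme \<Rightarrow> (nat \<Rightarrow> ('o, 'm, 'a) module_data) \<Rightarrow> (nat \<Rightarrow> 'o \<Rightarrow> 'a \<Rightarrow> 'a) \<Rightarrow>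
    'o \<Rightarrow> (nat \<times> 'a) rel" where
  "colim_rel C M \<mu> X =
     {((n, x), (n', x')). x \<in> carrier (FO (M n) X) \<and> x' \<in> carrier (FO (M n') X) \<and>
        (\<exists>k\<ge>max n n'. seq_map (Mod C) M \<mu> n (k - n) X x = seq_map (Mod C) M \<mu> n' (k - n') X x')}"

definition colim_group ::
  "('o, 'm, 'z) precat_scheme \<Rightarrow> (nat \<Rightarrow> ('o, 'm, 'a) module_data) \<Rightarrow> (nat \<Rightarrow> 'o \<Rightarrow> 'a \<Rightarrow> 'a) \<Rightarrow>
    'o \<Rightarrow> (nat \<times> 'a) set monoid" where
  "colim_group C M \<mu> X =
     \<lparr>carrier = (SIGMA n:UNIV. carrier (FO (M n) X)) // colim_rel C M \<mu> X,
      monoid.mult = (\<lambda>p q. colim_rel C M \<mu> X ``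
        {(n, x \<otimes>\<^bsub>FO (M n) X\<^esub> y) | n x y. (n, x) \<in> p \<and> (n, y) \<in> q}),
      one = colim_rel C M \<mu> X `` {(0, \<one>\<^bsub>FO (M 0) X\<^esub>)}\<rparr>"

definition colim ::
  "('o, 'm, 'z) precat_scheme \<Rightarrow> (nat \<Rightarrow> ('o, 'm, 'a) module_data) \<Rightarrow> (nat \<Rightarrow> 'o \<Rightarrow> 'a \<Rightarrow> 'a) \<Rightarrow>
    ('o, 'm, (nat \<times> 'a) set) module_data" where
  "colim C M \<mu> = restrict_functor (op_cat C)
     \<lparr>FO = colim_group C M \<mu>,
      FM = (\<lambda>X Y f. \<lambda>p\<in>carrier (colim_group C M \<mu> X).
        colim_rel C M \<mu> Y `` {(n, FM (M n) X Y f x) | n x. (n, x) \<in> p})\<rparr>"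

text \<open>The map of colimits induced by a map \<open>\<tau>\<close> of sequences from \<open>(M, \<mu>)\<close> to \<open>(N, \<nu>)\<close>.\<close>

definition colim_map ::
  "('o, 'm, 'z) precat_scheme \<Rightarrow> (nat \<Rightarrow> ('o, 'm, 'a) module_data) \<Rightarrow> (nat \<Rightarrow> 'o \<Rightarrow> 'a \<Rightarrow> 'a) \<Rightarrow>
    (nat \<Rightarrow> ('o, 'm, 'a) module_data) \<Rightarrow> (nat \<Rightarrow> 'o \<Rightarrow> 'a \<Rightarrow> 'a) \<Rightarrow> (nat \<Rightarrow> 'o \<Rightarrow> 'a \<Rightarrow> 'a) \<Rightarrow>
    'o \<Rightarrow> (nat \<times> 'a) set \<Rightarrow> (nat \<times> 'a) set" where
  "colim_map C M \<mu> N \<nu> \<tau> = (\<lambda>X\<in>Obj C. \<lambda>p\<in>carrier (colim_group C M \<mu> X).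
     colim_rel C N \<nu> X `` {(n, \<tau> n X x) | n x. (n, x) \<in> p})"

abbreviation yoneda_obj_seq ::
  "('o, 'm, 'z) precat_scheme \<Rightarrow> (nat \<Rightarrow> 'o) \<Rightarrow> nat \<Rightarrow> ('o, 'm, 'm) module_data" where
  "yoneda_obj_seq C E \<equiv> (\<lambda>n. FO (yoneda C) (E n))"

abbreviation yoneda_map_seq ::
  "('o, 'm, 'z) precat_scheme \<Rightarrow> (nat \<Rightarrow> 'o) \<Rightarrow> (nat \<Rightarrow> 'm) \<Rightarrow> nat \<Rightarrow> 'o \<Rightarrow> 'm \<Rightarrow> 'm" where
  "yoneda_map_seq C E e \<equiv> (\<lambda>n. FM (yoneda C) (E n) (E (Suc n)) (e n))"

definition yoneda_colim ::
  "('o, 'm, 'z) precat_scheme \<Rightarrow> (nat \<Rightarrow> 'o) \<Rightarrow> (nat \<Rightarrow> 'm) \<Rightarrow>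
    ('o, 'm, (nat \<times> 'm) set) module_data" where
  "yoneda_colim C E e = colim C (yoneda_obj_seq C E) (yoneda_map_seq C E e)"

definition yoneda_colim_map ::
  "('o, 'm, 'z) precat_scheme \<Rightarrow> (nat \<Rightarrow> 'o) \<Rightarrow> (nat \<Rightarrow> 'm) \<Rightarrow>
    (nat \<Rightarrow> 'o) \<Rightarrow> (nat \<Rightarrow> 'm) \<Rightarrow> (nat \<Rightarrow> 'm) \<Rightarrow>
    'o \<Rightarrow> (nat \<times> 'm) set \<Rightarrow> (nat \<times> 'm) set" where
  "yoneda_colim_map C E e E' e' u =
     colim_map C (yoneda_obj_seq C E) (yoneda_map_seq C E e)
       (yoneda_obj_seq C E') (yoneda_map_seq C E' e') (\<lambda>n. FM (yoneda C) (E n) (E' n) (u n))"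


section \<open>The completion\<close>

definition mod_perp ::
  "('o, 'm, 'z) precat_scheme \<Rightarrow> ('o, 'm, 'b) module_data set \<Rightarrow> ('o, 'm, 'a) module_data set" where
  "mod_perp C \<A> =
     {M \<in> Obj (Mod C). \<forall>A\<in>\<A>. carrier (mod_hom C A M) = {\<one>\<^bsub>mod_hom C A M\<^esub>}}"

definition compact_support ::
  "('o, 'm, 'z) tricat_scheme \<Rightarrow> (nat \<Rightarrow> 'o set) \<Rightarrow> ('o, 'm, 'a) module_data set" where
  "compact_support T B =
     (\<Inter>j::int. \<Union>i. mod_perp T ((\<lambda>X. FO (yoneda T) (shift_pow T j X)) ` B i))"

definition pre_completion ::
  "('o, 'm, 'z) tricat_scheme \<Rightarrow> (nat \<Rightarrow> 'o set) \<Rightarrow> ('o, 'm, 'a) module_data set" where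
  "pre_completion T B =
     {M \<in> Obj (Mod T). \<exists>E e \<eta>. good_cauchy T B E e \<and> mod_iso T M (yoneda_colim T E e) \<eta>}"

abbreviation shift_seq_obj ::
  "('o, 'm, 'z) tricat_scheme \<Rightarrow> (nat \<Rightarrow> 'o) \<Rightarrow> nat \<Rightarrow> 'o" where
  "shift_seq_obj T E \<equiv> (\<lambda>n. FO (Shift T) (E n))"

abbreviation shift_seq_map ::
  "('o, 'm, 'z) tricat_scheme \<Rightarrow> (nat \<Rightarrow> 'o) \<Rightarrow> (nat \<Rightarrow> 'm) \<Rightarrow> nat \<Rightarrow> 'm" where
  "shift_seq_map T E e \<equiv> (\<lambda>n. FM (Shift T) (E n) (E (Suc n)) (e n))"

text \<open>
  The shift \<open>M \<mapsto> M \<circ> \<Sigma>\<^sup>-\<^sup>1\<close> of modules, and the canonical isomorphism from the shift of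
  \<open>colim Y(E)\<close> to \<open>colim Y(\<Sigma> E)\<close>, given on representatives \<open>x : \<Sigma>\<^sup>-\<^sup>1 X \<rightarrow> E n\<close> by
  \<open>x \<mapsto> \<Sigma> x : X \<rightarrow> \<Sigma> (E n)\<close>.
\<close>

abbreviation mod_shift ::
  "('o, 'm, 'z) tricat_scheme \<Rightarrow>
    (('o, 'm, 'a) module_data, 'o \<Rightarrow> 'a \<Rightarrow> 'a, ('o, 'm, 'a) module_data, 'o \<Rightarrow> 'a \<Rightarrow> 'a) functor_data"
  where
  "mod_shift T \<equiv> precomp T (Unshift T)"

definition shift_colim ::
  "('o, 'm, 'z) tricat_scheme \<Rightarrow> (nat \<Rightarrow> 'o) \<Rightarrow> (nat \<Rightarrow> 'm) \<Rightarrow>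
    'o \<Rightarrow> (nat \<times> 'm) set \<Rightarrow> (nat \<times> 'm) set" where
  "shift_colim T E e =
     (\<lambda>X\<in>Obj T. \<lambda>p\<in>carrier (FO (yoneda_colim T E e) (FO (Unshift T) X)).
        colim_rel T (yoneda_obj_seq T (shift_seq_obj T E))
            (yoneda_map_seq T (shift_seq_obj T E) (shift_seq_map T E e)) X ``
          {(n, FM (Shift T) (FO (Unshift T) X) (E n) x) | n x. (n, x) \<in> p})"

text \<open>
  A sequence \<open>L \<rightarrow> M \<rightarrow> N \<rightarrow> \<Sigma> L\<close>, with maps \<open>f\<close>, \<open>g\<close>, \<open>h\<close>, isomorphic to the colimit of the Yoneda
  image of a sequence of triangles \<open>a n \<rightarrow> b n \<rightarrow> c n \<rightarrow> \<Sigma> (a n)\<close>, with maps \<open>u n\<close>, \<open>v n\<close>, \<open>w n\<close> and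
  transition maps \<open>\<alpha> n\<close>, \<open>\<beta> n\<close>, \<open>\<gamma> n\<close>. As for any isomorphism of triangles, the component at the
  fourth term is the shift of the component \<open>p\<close> at the first term, up to the identification of
  \<open>\<Sigma> (colim Y(a))\<close> with \<open>colim Y(\<Sigma> a)\<close>. The shift of \<open>p : L \<rightarrow> colim Y(a)\<close> is written out because
  \<open>p\<close> relates modules over different types.
\<close>

definition colim_triangle ::
  "('o, 'm, 'z) tricat_scheme \<Rightarrow> (nat \<Rightarrow> 'o set) \<Rightarrow>
    ('o, 'm, 'a) module_data \<Rightarrow> ('o, 'm, 'a) module_data \<Rightarrow> ('o, 'm, 'a) module_data \<Rightarrow>
    ('o \<Rightarrow> 'a \<Rightarrow> 'a) \<Rightarrow> ('o \<Rightarrow> 'a \<Rightarrow> 'a) \<Rightarrow> ('o \<Rightarrow> 'a \<Rightarrow> 'a) \<Rightarrow> bool" where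
  "colim_triangle T B L M N f g h \<longleftrightarrow>
     (\<exists>a \<alpha> b \<beta> c \<gamma> u v w p q r.
        good_cauchy T B a \<alpha> \<and> good_cauchy T B b \<beta> \<and> good_cauchy T B c \<gamma> \<and>
        good_cauchy T B (shift_seq_obj T a) (shift_seq_map T a \<alpha>) \<and>
        (\<forall>n. Tri T (a n) (b n) (c n) (u n) (v n) (w n)) \<and>
        (\<forall>n. triangle_mor T (a n) (b n) (c n) (u n) (v n) (w n)
                (a (Suc n)) (b (Suc n)) (c (Suc n)) (u (Suc n)) (v (Suc n)) (w (Suc n))
                (\<alpha> n) (\<beta> n) (\<gamma> n)) \<and>
        mod_iso T L (yoneda_colim T a \<alpha>) p \<and>
        mod_iso T M (yoneda_colim T b \<beta>) q \<and>
        mod_iso T N (yoneda_colim T c \<gamma>) r \<and>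
        mod_comp T L q f = mod_comp T L (yoneda_colim_map T a \<alpha> b \<beta> u) p \<and>
        mod_comp T M r g = mod_comp T M (yoneda_colim_map T b \<beta> c \<gamma> v) q \<and>
        mod_comp T N
          (mod_comp T (FO (mod_shift T) L) (shift_colim T a \<alpha>)
            (\<lambda>X\<in>Obj T. p (FO (Unshift T) X))) h =
        mod_comp T N
          (yoneda_colim_map T c \<gamma> (shift_seq_obj T a) (shift_seq_map T a \<alpha>) w) r)"

definition completion ::
  "('o, 'm, 'z) tricat_scheme \<Rightarrow> (nat \<Rightarrow> 'o set) \<Rightarrow>
    (('o, 'm, 'a) module_data, 'o \<Rightarrow> 'a \<Rightarrow> 'a) tricat" where
  "completion T B =
     \<lparr>Obj = compact_support T B \<inter> pre_completion T B,
      Hom = Hom (Mod T), Ident = Ident (Mod T), Comp = Comp (Mod T),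
      Shift = mod_shift T, Unshift = precomp T (Shift T),
      Tri = (\<lambda>L M N f g h.
        {L, M, N, FO (mod_shift T) L} \<subseteq> compact_support T B \<inter> pre_completion T B \<and>
        f \<in> homs (Mod T) L M \<and> g \<in> homs (Mod T) M N \<and> h \<in> homs (Mod T) N (FO (mod_shift T) L) \<and>
        colim_triangle T B L M N f g h)\<rparr>"

end

theory Submission
  imports Defs
begin

text \<open>
  Write \<open>\<Phi>\<close> for the adjunction bijection \<open>S(F X, Y) \<cong> T(X, G Y)\<close>.

  Objects. If \<open>M\<close> is the colimit of the representables \<open>S(-, E n)\<close>, then \<open>M \<circ> F\<close> is the colimit of
  the modules \<open>S(F -, E n) \<cong> T(-, G (E n))\<close>, that is, of the Yoneda image of the sequence \<open>G E\<close>
  (\<open>adj_transpose_iso\<close>). This sequence is good Cauchy because \<open>G\<close> preserves cones, commutes with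
  the shift and is a compression (\<open>good_cauchy_image\<close>). On the other hand \<open>(M \<circ> F)(\<Sigma>\<^sup>j X) \<cong> M(\<Sigma>\<^sup>j
  (F X))\<close>, and \<open>F X\<close> is in a given \<open>C i\<close> for all \<open>X\<close> in a suitable \<open>B m\<close> because \<open>F\<close> is a
  compression; therefore \<open>M \<circ> F\<close> is compactly supported if \<open>M\<close> is (\<open>compact_support_precomp\<close>).

  Triangles. If \<open>L \<rightarrow> M \<rightarrow> N \<rightarrow> \<Sigma> L\<close> is the colimit of triangles \<open>a n \<rightarrow> b n \<rightarrow> c n \<rightarrow> \<Sigma> (a n)\<close>, then
  its image is the colimit of the triangles which \<open>G\<close> makes out of them. The delicate point is the
  shift. An exact functor comes with a natural isomorphism with the shift; let \<open>\<psi> : G \<Sigma> \<rightarrow> \<Sigma> G\<close> be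
  the one of \<open>G\<close>. The isomorphism \<open>(\<Sigma> M) \<circ> F \<cong> \<Sigma> (M \<circ> F)\<close> that makes \<open>- \<circ> F\<close> exact must match \<open>\<psi>\<close>,
  and an isomorphism \<open>F \<Sigma> \<cong> \<Sigma> F\<close> that makes \<open>F\<close> exact need not correspond to \<open>\<psi>\<close> under the
  adjunction. So the isomorphism is built from the mate \<open>F \<Sigma>\<^sup>-\<^sup>1 \<rightarrow> \<Sigma>\<^sup>-\<^sup>1 F\<close> of \<open>\<psi>\<close>
  (\<open>mate_nat_iso\<close>). With this choice the square that involves the shift is the image of the given
  one under the map \<open>colim S(F X, \<Sigma> (a n)) \<rightarrow> colim T(X, \<Sigma> (G (a n)))\<close>, \<open>y \<mapsto> \<psi> \<circ> \<Phi> y\<close>, and so it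
  commutes (\<open>adj_transpose_shift_square\<close>).
\<close>

section \<open>Colimits of sequences of representable modules\<close>

context preadditive_category
begin

lemma comp_in [simp]:
  "\<lbrakk>X \<in> Obj C; Y \<in> Obj C; Z \<in> Obj C; f \<in> homs C X Y; g \<in> homs C Y Z\<rbrakk>
    \<Longrightarrow> Comp C X Y Z g f \<in> homs C X Z"
  by (rule hom_in_carrier[OF comp_additive_right])

lemma comp_mult_right:
  "\<lbrakk>X \<in> Obj C; Y \<in> Obj C; Z \<in> Obj C; f \<in> homs C X Y; f' \<in> homs C X Y; g \<in> homs C Y Z\<rbrakk>
    \<Longrightarrow> Comp C X Y Z g (f \<otimes>\<^bsub>Hom C X Y\<^esub> f') = Comp C X Y Z g f \<otimes>\<^bsub>Hom C X Z\<^esub> Comp C X Y Z g f'"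
  using hom_mult[OF comp_additive_right] by blast

lemma comp_mult_left:
  "\<lbrakk>X \<in> Obj C; Y \<in> Obj C; Z \<in> Obj C; f \<in> homs C X Y; g \<in> homs C Y Z; g' \<in> homs C Y Z\<rbrakk>
    \<Longrightarrow> Comp C X Y Z (g \<otimes>\<^bsub>Hom C Y Z\<^esub> g') f = Comp C X Y Z g f \<otimes>\<^bsub>Hom C X Z\<^esub> Comp C X Y Z g' f"
  using hom_mult[OF comp_additive_left] by blast

lemma mult_in [simp]:
  "\<lbrakk>X \<in> Obj C; Y \<in> Obj C; f \<in> homs C X Y; f' \<in> homs C X Y\<rbrakk>
    \<Longrightarrow> f \<otimes>\<^bsub>Hom C X Y\<^esub> f' \<in> homs C X Y"
  by (meson comm_group.axioms(2) group.is_monoid hom_comm_group monoid.m_closed)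

lemma seq_map_in:
  "is_seq C E e \<Longrightarrow> seq_map C E e n k \<in> homs C (E n) (E (n + k))"
  by (induction k) (auto simp: is_seq_def ident_in)

end

text \<open>The map \<open>C(X, E n) \<rightarrow> C(X, E k)\<close> of a sequence, for \<open>n \<le> k\<close>. For \<open>k < n\<close> the truncated
  subtraction yields a value without meaning.\<close>

definition push ::
  "('o, 'm, 'z) precat_scheme \<Rightarrow> (nat \<Rightarrow> 'o) \<Rightarrow> (nat \<Rightarrow> 'm) \<Rightarrow> 'o \<Rightarrow> nat \<Rightarrow> nat \<Rightarrow> 'm \<Rightarrow> 'm" where
  "push C E e X n k x = Comp C X (E n) (E k) (seq_map C E e n (k - n)) x"

abbreviation yoneda_colim_rel ::
  "('o, 'm, 'z) precat_scheme \<Rightarrow> (nat \<Rightarrow> 'o) \<Rightarrow> (nat \<Rightarrow> 'm) \<Rightarrow> 'o \<Rightarrow> (nat \<times> 'm) rel" where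
  "yoneda_colim_rel C E e X \<equiv> colim_rel C (yoneda_obj_seq C E) (yoneda_map_seq C E e) X"

definition colim_class ::
  "('o, 'm, 'z) precat_scheme \<Rightarrow> (nat \<Rightarrow> 'o) \<Rightarrow> (nat \<Rightarrow> 'm) \<Rightarrow> 'o \<Rightarrow> nat \<Rightarrow> 'm \<Rightarrow> (nat \<times> 'm) set"
  where
  "colim_class C E e X n x = yoneda_colim_rel C E e X `` {(n, x)}"

lemma yoneda_obj_simps [simp]:
  "X \<in> Obj C \<Longrightarrow> FO (FO (yoneda C) A) X = Hom C X A"
  "\<lbrakk>X \<in> Obj C; Y \<in> Obj C; f \<in> homs C Y X; g \<in> homs C X A\<rbrakk>
    \<Longrightarrow> FM (FO (yoneda C) A) X Y f g = Comp C Y X A g f"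
  by (simp_all add: yoneda_def restrict_functor_def op_cat_def)

lemma colim_simps [simp]:
  "X \<in> Obj C \<Longrightarrow> FO (colim C M \<mu>) X = colim_group C M \<mu> X"
  "\<lbrakk>X \<in> Obj C; Y \<in> Obj C; f \<in> homs C Y X; p \<in> carrier (colim_group C M \<mu> X)\<rbrakk>
    \<Longrightarrow> FM (colim C M \<mu>) X Y f p =
      colim_rel C M \<mu> Y `` {(n, FM (M n) X Y f x) | n x. (n, x) \<in> p}"
  by (simp_all add: colim_def restrict_functor_def op_cat_def)

context preadditive_category
begin

lemma push_in [simp]:
  assumes "is_seq C E e" "X \<in> Obj C" "x \<in> homs C X (E n)" "n \<le> k"
  shows "push C E e X n k x \<in> homs C X (E k)"
  using assms seq_map_in[OF assms(1), of n "k - n"]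
  by (auto simp: push_def is_seq_def intro!: comp_in)

lemma push_self [simp]:
  "\<lbrakk>is_seq C E e; X \<in> Obj C; x \<in> homs C X (E n)\<rbrakk> \<Longrightarrow> push C E e X n n x = x"
  by (simp add: push_def is_seq_def comp_ident_left)

lemma push_Suc:
  assumes "is_seq C E e" "X \<in> Obj C" "x \<in> homs C X (E n)" "n \<le> k"
  shows "push C E e X n (Suc k) x = Comp C X (E k) (E (Suc k)) (e k) (push C E e X n k x)"
  using assms seq_map_in[OF assms(1), of n "k - n"]
  by (auto simp: push_def is_seq_def Suc_diff_le intro!: comp_assoc[symmetric])

lemma push_push:
  assumes "is_seq C E e" "X \<in> Obj C" "x \<in> homs C X (E n)" "n \<le> k" "k \<le> l"
  shows "push C E e X k l (push C E e X n k x) = push C E e X n l x"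
  using \<open>k \<le> l\<close>
proof (induction l rule: dec_induct)
  case base
  then show ?case using assms by simp
next
  case (step l)
  then show ?case using assms by (simp add: push_Suc)
qed

lemma push_mult:
  assumes "is_seq C E e" "X \<in> Obj C" "x \<in> homs C X (E n)" "y \<in> homs C X (E n)" "n \<le> k"
  shows "push C E e X n k (x \<otimes>\<^bsub>Hom C X (E n)\<^esub> y) =
    push C E e X n k x \<otimes>\<^bsub>Hom C X (E k)\<^esub> push C E e X n k y"
  using assms seq_map_in[OF assms(1), of n "k - n"]
  by (auto simp: push_def is_seq_def intro!: comp_mult_right)

lemma seq_map_yoneda:
  assumes "is_seq C E e" "X \<in> Obj C" "x \<in> homs C X (E n)"
  shows "seq_map (Mod C) (yoneda_obj_seq C E) (yoneda_map_seq C E e) n k X x = push C E e X n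
      (n + k) x"
proof (induction k)
  case 0
  then show ?case using assms by (simp add: Mod_def mod_ident_def)
next
  case (Suc k)
  then show ?case using assms
    by (simp add: Mod_def mod_comp_def compose_def push_Suc) (simp add: yoneda_def)
qed

lemma yoneda_colim_rel_iff:
  assumes "is_seq C E e" "X \<in> Obj C"
  shows "((n, x), (n', x')) \<in> yoneda_colim_rel C E e X \<longleftrightarrow>
    x \<in> homs C X (E n) \<and> x' \<in> homs C X (E n') \<and>
    (\<exists>k\<ge>max n n'. push C E e X n k x = push C E e X n' k x')"
proof -
  have "push C E e X n (n + (k - n)) x = push C E e X n k x" if "k \<ge> max n n'" for n n' k x
    using that by simp
  then show ?thesis using assms
    by (auto simp: colim_rel_def seq_map_yoneda)
qed

lemma push_eq_later:
  assumes "is_seq C E e" "X \<in> Obj C" "x \<in> homs C X (E n)" "x' \<in> homs C X (E n')"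
    and "max n n' \<le> k" "k \<le> l" "push C E e X n k x = push C E e X n' k x'"
  shows "push C E e X n l x = push C E e X n' l x'"
  using push_push[OF assms(1,2,3), of k l] push_push[OF assms(1,2,4), of k l] assms(5-7) by simp

lemma equiv_yoneda_colim_rel:
  assumes E: "is_seq C E e" and X: "X \<in> Obj C"
  shows "equiv (SIGMA n:UNIV. homs C X (E n)) (yoneda_colim_rel C E e X)"
proof (rule equivI)
  show "yoneda_colim_rel C E e X \<subseteq> (SIGMA n:UNIV. homs C X (E n)) \<times> (SIGMA n:UNIV. homs C X (E n))"
    by (auto simp: yoneda_colim_rel_iff[OF E X])
  show "refl_on (SIGMA n:UNIV. homs C X (E n)) (yoneda_colim_rel C E e X)"
    unfolding refl_on_def by (auto simp: yoneda_colim_rel_iff[OF E X])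
  show "sym (yoneda_colim_rel C E e X)"
    unfolding sym_def by (auto simp: yoneda_colim_rel_iff[OF E X])
  show "trans (yoneda_colim_rel C E e X)"
  proof (rule transI, clarify)
    fix n x n' x' n'' x''
    assume "((n, x), (n', x')) \<in> yoneda_colim_rel C E e X"
      and "((n', x'), (n'', x'')) \<in> yoneda_colim_rel C E e X"
    then obtain k l where
      h: "x \<in> homs C X (E n)" "x' \<in> homs C X (E n')" "x'' \<in> homs C X (E n'')"
      and k: "k \<ge> max n n'" "push C E e X n k x = push C E e X n' k x'"
      and l: "l \<ge> max n' n''" "push C E e X n' l x' = push C E e X n'' l x''"
      by (auto simp only: yoneda_colim_rel_iff[OF E X])
    have "push C E e X n (max k l) x = push C E e X n' (max k l) x'"
      by (rule push_eq_later[OF E X h(1,2) k(1) _ k(2)]) simp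
    moreover have "push C E e X n' (max k l) x' = push C E e X n'' (max k l) x''"
      by (rule push_eq_later[OF E X h(2,3) l(1) _ l(2)]) simp
    ultimately show "((n, x), (n'', x'')) \<in> yoneda_colim_rel C E e X"
      using h k l by (auto simp: yoneda_colim_rel_iff[OF E X] intro!: exI[of _ "max k l"])
  qed
qed

lemma yoneda_colim_carrier:
  "X \<in> Obj C \<Longrightarrow> carrier (FO (yoneda_colim C E e) X) =
    (SIGMA n:UNIV. homs C X (E n)) // yoneda_colim_rel C E e X"
  by (simp add: yoneda_colim_def colim_group_def)

lemma colim_class_in [simp]:
  "\<lbrakk>X \<in> Obj C; x \<in> homs C X (E n)\<rbrakk>
    \<Longrightarrow> colim_class C E e X n x \<in> carrier (FO (yoneda_colim C E e) X)"
  by (auto simp: yoneda_colim_carrier colim_class_def intro!: quotientI)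

lemma colim_class_cases:
  assumes "X \<in> Obj C" "p \<in> carrier (FO (yoneda_colim C E e) X)"
  obtains n x where "x \<in> homs C X (E n)" "p = colim_class C E e X n x"
  using assms by (auto simp: yoneda_colim_carrier colim_class_def elim!: quotientE)

lemma colim_class_eq_iff:
  assumes "is_seq C E e" "X \<in> Obj C" "x \<in> homs C X (E n)" "x' \<in> homs C X (E n')"
  shows "colim_class C E e X n x = colim_class C E e X n' x' \<longleftrightarrow>
    (\<exists>k\<ge>max n n'. push C E e X n k x = push C E e X n' k x')"
  using eq_equiv_class_iff[OF equiv_yoneda_colim_rel[OF assms(1,2)], of "(n, x)" "(n', x')"] assms
  by (simp add: colim_class_def yoneda_colim_rel_iff)

lemma mem_colim_class_iff:
  assumes "is_seq C E e" "X \<in> Obj C" "x \<in> homs C X (E n)"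
  shows "(m, y) \<in> colim_class C E e X n x \<longleftrightarrow>
    y \<in> homs C X (E m) \<and> colim_class C E e X m y = colim_class C E e X n x"
  using assms by (auto simp: colim_class_def yoneda_colim_rel_iff
      equiv_class_eq_iff[OF equiv_yoneda_colim_rel[OF assms(1,2)], of "(n, x)"])

lemma colim_class_push:
  assumes "is_seq C E e" "X \<in> Obj C" "x \<in> homs C X (E n)" "n \<le> k"
  shows "colim_class C E e X k (push C E e X n k x) = colim_class C E e X n x"
  using assms by (auto simp: colim_class_eq_iff intro!: exI[of _ k])

text \<open>Products in the colimit, the structure maps of the colimit and the maps between colimits are
  all defined as the image under \<open>colim_rel\<close> of a set \<open>A\<close> of pairs. To compute one of them it is
  enough to see that \<open>A\<close> lies in a single class.\<close>

lemma colim_rel_Image_eq_class: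
  assumes E: "is_seq C E e" and X: "X \<in> Obj C" and x: "x \<in> homs C X (E n)"
    and A: "A \<noteq> {}" "\<And>m y. (m, y) \<in> A \<Longrightarrow> y \<in> homs C X (E m) \<and> colim_class C E e X m y = colim_class
        C E e X n x"
  shows "yoneda_colim_rel C E e X `` A = colim_class C E e X n x"
proof -
  have "yoneda_colim_rel C E e X `` A = (\<Union>(m, y)\<in>A. colim_class C E e X m y)"
    by (auto simp: colim_class_def)
  also have "\<dots> = (\<Union>(m, y)\<in>A. colim_class C E e X n x)"
    using A(2) by fastforce
  finally show ?thesis using A(1) by auto
qed

text \<open>The product of two classes is formed from all their representatives with a common stage. Any
  two choices agree from some later stage on, because the transition maps are additive.\<close>

lemma colim_class_mult:
  assumes E: "is_seq C E e" and X: "X \<in> Obj C"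
    and x: "x \<in> homs C X (E n)" and y: "y \<in> homs C X (E n)"
  shows "colim_class C E e X n x \<otimes>\<^bsub>FO (yoneda_colim C E e) X\<^esub> colim_class C E e X n y =
    colim_class C E e X n (x \<otimes>\<^bsub>Hom C X (E n)\<^esub> y)"
proof -
  let ?A = "{(m, x' \<otimes>\<^bsub>Hom C X (E m)\<^esub> y') | m x' y'.
    (m, x') \<in> colim_class C E e X n x \<and> (m, y') \<in> colim_class C E e X n y}"
  have En: "E m \<in> Obj C" for m using E by (simp add: is_seq_def)
  have "yoneda_colim_rel C E e X `` ?A = colim_class C E e X n (x \<otimes>\<^bsub>Hom C X (E n)\<^esub> y)"
  proof (rule colim_rel_Image_eq_class[OF E X])
    show "x \<otimes>\<^bsub>Hom C X (E n)\<^esub> y \<in> homs C X (E n)" using x y X En by simp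
    show "?A \<noteq> {}" using mem_colim_class_iff[OF E X] x y by blast
  next
    fix m z assume "(m, z) \<in> ?A"
    then obtain x' y' where z: "z = x' \<otimes>\<^bsub>Hom C X (E m)\<^esub> y'"
      and x': "x' \<in> homs C X (E m)" "colim_class C E e X m x' = colim_class C E e X n x"
      and y': "y' \<in> homs C X (E m)" "colim_class C E e X m y' = colim_class C E e X n y"
      using mem_colim_class_iff[OF E X] x y by auto
    obtain k where k: "k \<ge> max m n" "push C E e X m k x' = push C E e X n k x"
      using x' colim_class_eq_iff[OF E X x'(1) x] by auto
    obtain l where l: "l \<ge> max m n" "push C E e X m l y' = push C E e X n l y"
      using y' colim_class_eq_iff[OF E X y'(1) y] by auto
    have "push C E e X m (max k l) x' = push C E e X n (max k l) x"
      by (rule push_eq_later[OF E X x'(1) x k(1) _ k(2)]) simp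
    moreover have "push C E e X m (max k l) y' = push C E e X n (max k l) y"
      by (rule push_eq_later[OF E X y'(1) y l(1) _ l(2)]) simp
    ultimately have "push C E e X m (max k l) z = push C E e X n (max k l) (x \<otimes>\<^bsub>Hom C X (E n)\<^esub> y)"
      using k(1) l(1) x'(1) y'(1) x y by (simp add: z push_mult[OF E X] le_max_iff_disj)
    then show "z \<in> homs C X (E m) \<and>
        colim_class C E e X m z = colim_class C E e X n (x \<otimes>\<^bsub>Hom C X (E n)\<^esub> y)"
      using k(1) l(1) x'(1) y'(1) x y X En
      by (auto simp: z colim_class_eq_iff[OF E X] le_max_iff_disj intro!: exI[of _ "max k l"])
  qed
  moreover have "{(m, x' \<otimes>\<^bsub>FO (FO (yoneda C) (E m)) X\<^esub> y') | m x' y'.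
    (m, x') \<in> colim_class C E e X n x \<and> (m, y') \<in> colim_class C E e X n y} = ?A"
    using X by simp
  ultimately show ?thesis
    using X by (simp add: yoneda_colim_def colim_group_def)
qed

end

text \<open>A map of sequences of sets, from the sets \<open>C(X, E n)\<close> to the sets \<open>D(X', E' n)\<close>. The
  categories and the objects at which the representables are evaluated may differ: besides
  composition with a morphism, the examples of \<open>t\<close> are the shift and the adjunction bijection.\<close>

definition stage_maps ::
  "('o, 'm, 'y) precat_scheme \<Rightarrow> (nat \<Rightarrow> 'o) \<Rightarrow> (nat \<Rightarrow> 'm) \<Rightarrow> 'o \<Rightarrow>
   ('p, 'n, 'z) precat_scheme \<Rightarrow> (nat \<Rightarrow> 'p) \<Rightarrow> (nat \<Rightarrow> 'n) \<Rightarrow> 'p \<Rightarrow> (nat \<Rightarrow> 'm \<Rightarrow> 'n) \<Rightarrow> bool" where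
  "stage_maps C E e X D E' e' X' t \<longleftrightarrow>
    (\<forall>n. \<forall>x\<in>homs C X (E n). t n x \<in> homs D X' (E' n) \<and>
      t (Suc n) (Comp C X (E n) (E (Suc n)) (e n) x) = Comp D X' (E' n) (E' (Suc n)) (e' n)
          (t n x))"

lemma stage_maps_push:
  assumes "preadditive_category C" "is_seq C E e" "X \<in> Obj C"
    and "preadditive_category D" "is_seq D E' e'" "X' \<in> Obj D"
    and t: "stage_maps C E e X D E' e' X' t" and x: "x \<in> homs C X (E n)" and "n \<le> k"
  shows "t k (push C E e X n k x) = push D E' e' X' n k (t n x)"
  using \<open>n \<le> k\<close>
proof (induction k rule: dec_induct)
  interpret C: preadditive_category C by fact
  interpret D: preadditive_category D by fact
  have tx: "t n x \<in> homs D X' (E' n)" using t x by (auto simp: stage_maps_def)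
  {
    case base
    show ?case using assms tx by simp
  next
    case (step k)
    then show ?case using t assms(2,3,5,6) x tx
      by (simp add: C.push_Suc D.push_Suc) (auto simp: stage_maps_def)
  }
qed

lemma stage_maps_class_cong:
  assumes "preadditive_category C" "is_seq C E e" "X \<in> Obj C"
    and "preadditive_category D" "is_seq D E' e'" "X' \<in> Obj D"
    and t: "stage_maps C E e X D E' e' X' t"
    and x: "x \<in> homs C X (E n)" and y: "y \<in> homs C X (E m)"
    and eq: "colim_class C E e X n x = colim_class C E e X m y"
  shows "colim_class D E' e' X' n (t n x) = colim_class D E' e' X' m (t m y)"
proof -
  interpret C: preadditive_category C by fact
  interpret D: preadditive_category D by fact
  have tx: "t n x \<in> homs D X' (E' n)" "t m y \<in> homs D X' (E' m)"
    using t x y by (auto simp: stage_maps_def)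
  obtain k where k: "k \<ge> max n m" "push C E e X n k x = push C E e X m k y"
    using eq C.colim_class_eq_iff[OF assms(2,3) x y] by auto
  then have "push D E' e' X' n k (t n x) = push D E' e' X' m k (t m y)"
    using stage_maps_push[OF assms(1-7), of x n k] stage_maps_push[OF assms(1-7), of y m k] x y
    by simp
  then show ?thesis using D.colim_class_eq_iff[OF assms(5,6) tx] k(1) by auto
qed

text \<open>The formula by which \<open>colim\<close>, \<open>colim_map\<close> and \<open>shift_colim\<close> define maps of colimits.\<close>

definition stage_colim ::
  "('p, 'n, 'z) precat_scheme \<Rightarrow> (nat \<Rightarrow> 'p) \<Rightarrow> (nat \<Rightarrow> 'n) \<Rightarrow> 'p \<Rightarrow> (nat \<Rightarrow> 'm \<Rightarrow> 'n) \<Rightarrow>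
    (nat \<times> 'm) set \<Rightarrow> (nat \<times> 'n) set" where
  "stage_colim D E' e' X' t p = yoneda_colim_rel D E' e' X' `` {(n, t n x) | n x. (n, x) \<in> p}"

lemma stage_colim_class:
  assumes "preadditive_category C" "is_seq C E e" "X \<in> Obj C"
    and "preadditive_category D" "is_seq D E' e'" "X' \<in> Obj D"
    and t: "stage_maps C E e X D E' e' X' t"
    and x: "x \<in> homs C X (E n)"
  shows "stage_colim D E' e' X' t (colim_class C E e X n x) = colim_class D E' e' X' n (t n x)"
  unfolding stage_colim_def
proof (rule preadditive_category.colim_rel_Image_eq_class[OF assms(4,5,6)])
  interpret C: preadditive_category C by fact
  show "t n x \<in> homs D X' (E' n)" using t x by (auto simp: stage_maps_def)
  show "{(m, t m y) | m y. (m, y) \<in> colim_class C E e X n x} \<noteq> {}"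
    using C.mem_colim_class_iff[OF assms(2,3) x] x by blast
  fix m z assume "(m, z) \<in> {(m, t m y) | m y. (m, y) \<in> colim_class C E e X n x}"
  then obtain y where "z = t m y" "y \<in> homs C X (E m)"
    "colim_class C E e X m y = colim_class C E e X n x"
    using C.mem_colim_class_iff[OF assms(2,3) x] by auto
  then show "z \<in> homs D X' (E' m) \<and> colim_class D E' e' X' m z = colim_class D E' e' X' n (t n x)"
    using t stage_maps_class_cong[OF assms(1-7) _ x, of y m] by (auto simp: stage_maps_def)
qed

text \<open>Injectivity passes to the colimit because an equality of classes already holds at some
  finite stage.\<close>

lemma stage_colim_bij:
  assumes "preadditive_category C" "is_seq C E e" "X \<in> Obj C"
    and "preadditive_category D" "is_seq D E' e'" "X' \<in> Obj D"
    and t: "stage_maps C E e X D E' e' X' t"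
    and bij: "\<And>n. bij_betw (t n) (homs C X (E n)) (homs D X' (E' n))"
  shows "bij_betw (stage_colim D E' e' X' t)
    (carrier (FO (yoneda_colim C E e) X)) (carrier (FO (yoneda_colim D E' e') X'))"
proof -
  interpret C: preadditive_category C by fact
  interpret D: preadditive_category D by fact
  note cls = stage_colim_class[OF assms(1-7)]
  have t_in: "t n x \<in> homs D X' (E' n)" if "x \<in> homs C X (E n)" for n x
    using t that by (auto simp: stage_maps_def)
  show ?thesis unfolding bij_betw_def
  proof
    show "inj_on (stage_colim D E' e' X' t) (carrier (FO (yoneda_colim C E e) X))"
    proof (rule inj_onI)
      fix p q assume pq: "p \<in> carrier (FO (yoneda_colim C E e) X)"
          "q \<in> carrier (FO (yoneda_colim C E e) X)"
        and eq: "stage_colim D E' e' X' t p = stage_colim D E' e' X' t q"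
      obtain n x where x: "x \<in> homs C X (E n)" "p = colim_class C E e X n x"
        using C.colim_class_cases[OF assms(3) pq(1)] .
      obtain m y where y: "y \<in> homs C X (E m)" "q = colim_class C E e X m y"
        using C.colim_class_cases[OF assms(3) pq(2)] .
      obtain k where k: "k \<ge> max n m" "push D E' e' X' n k (t n x) = push D E' e' X' m k (t m y)"
        using eq x y cls D.colim_class_eq_iff[OF assms(5,6) t_in[OF x(1)] t_in[OF y(1)]] by auto
      then have "t k (push C E e X n k x) = t k (push C E e X m k y)"
        using stage_maps_push[OF assms(1-7)] x(1) y(1) by simp
      moreover have "push C E e X n k x \<in> homs C X (E k)" "push C E e X m k y \<in> homs C X (E k)"
        using k(1) x(1) y(1) assms(2,3) by simp_all
      ultimately have "push C E e X n k x = push C E e X m k y"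
        using bij[of k] by (auto simp: bij_betw_def dest: inj_onD)
      then show "p = q" using C.colim_class_eq_iff[OF assms(2,3) x(1) y(1)] k(1) x(2) y(2) by auto
    qed
    show "stage_colim D E' e' X' t ` carrier (FO (yoneda_colim C E e) X) =
      carrier (FO (yoneda_colim D E' e') X')"
    proof (intro equalityI subsetI)
      fix q assume "q \<in> stage_colim D E' e' X' t ` carrier (FO (yoneda_colim C E e) X)"
      then obtain p where p: "p \<in> carrier (FO (yoneda_colim C E e) X)" "q = stage_colim D E' e' X'
          t p"
        by auto
      obtain n x where "x \<in> homs C X (E n)" "p = colim_class C E e X n x"
        using C.colim_class_cases[OF assms(3) p(1)] .
      then show "q \<in> carrier (FO (yoneda_colim D E' e') X')"
        using p(2) cls t_in assms(6) by simp
    next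
      fix q assume q: "q \<in> carrier (FO (yoneda_colim D E' e') X')"
      obtain n y where y: "y \<in> homs D X' (E' n)" "q = colim_class D E' e' X' n y"
        using D.colim_class_cases[OF assms(6) q] .
      then obtain x where "x \<in> homs C X (E n)" "y = t n x"
        using bij[of n] by (auto simp: bij_betw_def)
      then show "q \<in> stage_colim D E' e' X' t ` carrier (FO (yoneda_colim C E e) X)"
        using y cls assms(3) by (auto intro!: image_eqI[where x = "colim_class C E e X n x"])
    qed
  qed
qed

lemma stage_colim_hom:
  assumes "preadditive_category C" "is_seq C E e" "X \<in> Obj C"
    and "preadditive_category D" "is_seq D E' e'" "X' \<in> Obj D"
    and t: "stage_maps C E e X D E' e' X' t"
    and hom: "\<And>n. t n \<in> hom (Hom C X (E n)) (Hom D X' (E' n))"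
  shows "stage_colim D E' e' X' t \<in> hom (FO (yoneda_colim C E e) X) (FO (yoneda_colim D E' e') X')"
proof -
  interpret C: preadditive_category C by fact
  interpret D: preadditive_category D by fact
  note cls = stage_colim_class[OF assms(1-7)]
  have t_in: "t n x \<in> homs D X' (E' n)" if "x \<in> homs C X (E n)" for n x
    using t that by (auto simp: stage_maps_def)
  have En: "E n \<in> Obj C" for n using assms(2) by (simp add: is_seq_def)
  show ?thesis
  proof (rule homI)
    fix p assume p: "p \<in> carrier (FO (yoneda_colim C E e) X)"
    obtain n x where x: "x \<in> homs C X (E n)" "p = colim_class C E e X n x"
      using C.colim_class_cases[OF assms(3) p] .
    then show "stage_colim D E' e' X' t p \<in> carrier (FO (yoneda_colim D E' e') X')"
      using cls t_in assms(6) by simp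
    fix q assume q: "q \<in> carrier (FO (yoneda_colim C E e) X)"
    obtain m y where y: "y \<in> homs C X (E m)" "q = colim_class C E e X m y"
      using C.colim_class_cases[OF assms(3) q] .
    \<comment> \<open>Both elements are represented at the stage \<open>k\<close>.\<close>
    define k where "k = max n m"
    define x' where "x' = push C E e X n k x"
    define y' where "y' = push C E e X m k y"
    have xy: "x' \<in> homs C X (E k)" "y' \<in> homs C X (E k)" "p = colim_class C E e X k x'" "q =
        colim_class C E e X k y'"
      using x y assms(2,3) by (simp_all add: x'_def y'_def k_def C.colim_class_push)
    show "stage_colim D E' e' X' t (p \<otimes>\<^bsub>FO (yoneda_colim C E e) X\<^esub> q) =
      stage_colim D E' e' X' t p \<otimes>\<^bsub>FO (yoneda_colim D E' e') X'\<^esub> stage_colim D E' e' X' t q"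
      using xy hom_mult[OF hom xy(1,2)] t_in[OF xy(1)] t_in[OF xy(2)] assms(2,3,5,6) En
      by (simp add: C.colim_class_mult D.colim_class_mult cls)
  qed
qed

context preadditive_category
begin

lemma yoneda_colim_FM_class:
  assumes E: "is_seq C E e" and X: "X \<in> Obj C" "Y \<in> Obj C" and f: "f \<in> homs C Y X"
    and x: "x \<in> homs C X (E n)"
  shows "FM (yoneda_colim C E e) X Y f (colim_class C E e X n x) =
    colim_class C E e Y n (Comp C Y X (E n) x f)"
proof -
  have "stage_maps C E e X C E e Y (\<lambda>n. FM (FO (yoneda C) (E n)) X Y f)"
    using E X f by (auto simp: stage_maps_def is_seq_def comp_assoc)
  then have "stage_colim C E e Y (\<lambda>n. FM (FO (yoneda C) (E n)) X Y f) (colim_class C E e X n x) =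
    colim_class C E e Y n (FM (FO (yoneda C) (E n)) X Y f x)"
    by (rule stage_colim_class[OF preadditive_category_axioms E X(1) preadditive_category_axioms E
        X(2) _ x])
  then show ?thesis
    using X f x colim_class_in[where E = E and e = e and n = n, OF X(1) x]
    by (simp add: yoneda_colim_def stage_colim_def)
qed

lemma yoneda_colim_map_class:
  assumes E: "is_seq C E e" and E': "is_seq C E' e'" and X: "X \<in> Obj C"
    and u: "\<And>n. u n \<in> homs C (E n) (E' n)"
    and nat: "\<And>n. Comp C (E n) (E (Suc n)) (E' (Suc n)) (u (Suc n)) (e n) =
      Comp C (E n) (E' n) (E' (Suc n)) (e' n) (u n)"
    and x: "x \<in> homs C X (E n)"
  shows "yoneda_colim_map C E e E' e' u X (colim_class C E e X n x) =
    colim_class C E' e' X n (Comp C X (E n) (E' n) (u n) x)"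
proof -
  have "stage_maps C E e X C E' e' X (\<lambda>n. FM (yoneda C) (E n) (E' n) (u n) X)"
    using E E' X u nat by (auto simp: stage_maps_def is_seq_def yoneda_def comp_assoc)
  then have "stage_colim C E' e' X (\<lambda>n. FM (yoneda C) (E n) (E' n) (u n) X) (colim_class C E e X n
      x) =
    colim_class C E' e' X n (FM (yoneda C) (E n) (E' n) (u n) X x)"
    by (rule stage_colim_class[OF preadditive_category_axioms E X preadditive_category_axioms E' X
        _ x])
  moreover have "colim_class C E e X n x \<in> carrier (colim_group C (yoneda_obj_seq C E)
      (yoneda_map_seq C E e) X)"
    using colim_class_in[where E = E and e = e and n = n, OF X x] X
    by (simp add: yoneda_colim_def)
  ultimately show ?thesis
    using X x by (simp add: yoneda_colim_map_def colim_map_def stage_colim_def)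
      (simp add: yoneda_def)
qed

end

section \<open>Modules and precomposition\<close>

lemma additive_functorD:
  assumes "additive_functor C D F"
  shows "X \<in> Obj C \<Longrightarrow> FO F X \<in> Obj D"
    and "\<lbrakk>X \<in> Obj C; Y \<in> Obj C\<rbrakk> \<Longrightarrow> FM F X Y \<in> hom (Hom C X Y) (Hom D (FO F X) (FO F Y))"
    and "\<lbrakk>X \<in> Obj C; Y \<in> Obj C; f \<in> homs C X Y\<rbrakk> \<Longrightarrow> FM F X Y f \<in> homs D (FO F X) (FO F Y)"
    and "\<lbrakk>X \<in> Obj C; Y \<in> Obj C; f \<in> homs C X Y; f' \<in> homs C X Y\<rbrakk> \<Longrightarrow>
      FM F X Y (f \<otimes>\<^bsub>Hom C X Y\<^esub> f') = FM F X Y f \<otimes>\<^bsub>Hom D (FO F X) (FO F Y)\<^esub> FM F X Y f'"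
    and "X \<in> Obj C \<Longrightarrow> FM F X X (Ident C X) = Ident D (FO F X)"
    and "\<lbrakk>X \<in> Obj C; Y \<in> Obj C; Z \<in> Obj C; f \<in> homs C X Y; g \<in> homs C Y Z\<rbrakk> \<Longrightarrow>
      FM F X Z (Comp C X Y Z g f) =
      Comp D (FO F X) (FO F Y) (FO F Z) (FM F Y Z g) (FM F X Y f)"
  using assms by (auto simp: additive_functor_def hom_def Pi_iff)

lemma Mod_simps [simp]:
  "Hom (Mod C) = mod_hom C" "Ident (Mod C) = mod_ident C" "Comp (Mod C) L M N = mod_comp C L"
  by (simp_all add: Mod_def)

lemma ab_hom_carrier: "carrier (ab_hom G H) = hom G H \<inter> extensional (carrier G)"
  by (simp add: ab_hom_def)

lemma moduleD:
  assumes M: "M \<in> Obj (Mod C)"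
  shows module_comm_group: "X \<in> Obj C \<Longrightarrow> comm_group (FO M X)"
    and module_hom: "\<lbrakk>X \<in> Obj C; Y \<in> Obj C; f \<in> homs C Y X\<rbrakk> \<Longrightarrow> FM M X Y f \<in> hom (FO M X) (FO M Y)"
    and module_ext: "\<lbrakk>X \<in> Obj C; Y \<in> Obj C; f \<in> homs C Y X\<rbrakk> \<Longrightarrow>
      FM M X Y f \<in> extensional (carrier (FO M X))"
    and module_in: "\<lbrakk>X \<in> Obj C; Y \<in> Obj C; f \<in> homs C Y X; x \<in> carrier (FO M X)\<rbrakk>
      \<Longrightarrow> FM M X Y f x \<in> carrier (FO M Y)"
    and module_id: "\<lbrakk>X \<in> Obj C; x \<in> carrier (FO M X)\<rbrakk> \<Longrightarrow> FM M X X (Ident C X) x = x"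
    and module_comp: "\<lbrakk>X \<in> Obj C; Y \<in> Obj C; Z \<in> Obj C; f \<in> homs C Y X; g \<in> homs C Z Y;
      x \<in> carrier (FO M X)\<rbrakk> \<Longrightarrow> FM M X Z (Comp C Z Y X f g) x = FM M Y Z g (FM M X Y f x)"
    and module_add: "\<lbrakk>X \<in> Obj C; Y \<in> Obj C; f \<in> homs C Y X; f' \<in> homs C Y X;
      x \<in> carrier (FO M X)\<rbrakk> \<Longrightarrow>
      FM M X Y (f \<otimes>\<^bsub>Hom C Y X\<^esub> f') x = FM M X Y f x \<otimes>\<^bsub>FO M Y\<^esub> FM M X Y f' x"
proof -
  have add: "additive_functor (op_cat C) Ab M" using M by (simp add: Mod_def is_module_def)
  note F = additive_functorD[OF add, simplified op_cat_def Ab_def, simplified]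
  show "X \<in> Obj C \<Longrightarrow> comm_group (FO M X)" using F(1) by simp
  show h: "FM M X Y f \<in> hom (FO M X) (FO M Y)"
    "FM M X Y f \<in> extensional (carrier (FO M X))"
    if "X \<in> Obj C" "Y \<in> Obj C" "f \<in> homs C Y X" for X Y f
    using F(3)[OF that] by (simp_all add: ab_hom_carrier)
  show "\<lbrakk>X \<in> Obj C; Y \<in> Obj C; f \<in> homs C Y X; x \<in> carrier (FO M X)\<rbrakk>
      \<Longrightarrow> FM M X Y f x \<in> carrier (FO M Y)"
    using h(1) hom_in_carrier by metis
  show "\<lbrakk>X \<in> Obj C; x \<in> carrier (FO M X)\<rbrakk> \<Longrightarrow> FM M X X (Ident C X) x = x"
    using F(5) by simp
  show "FM M X Z (Comp C Z Y X f g) x = FM M Y Z g (FM M X Y f x)"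
    if "X \<in> Obj C" "Y \<in> Obj C" "Z \<in> Obj C" "f \<in> homs C Y X" "g \<in> homs C Z Y"
      "x \<in> carrier (FO M X)" using F(6)[OF that(1-5)] that(6) by (simp add: compose_def)
  show "FM M X Y (f \<otimes>\<^bsub>Hom C Y X\<^esub> f') x = FM M X Y f x \<otimes>\<^bsub>FO M Y\<^esub> FM M X Y f' x"
    if "X \<in> Obj C" "Y \<in> Obj C" "f \<in> homs C Y X" "f' \<in> homs C Y X"
      "x \<in> carrier (FO M X)" using F(4)[OF that(1-4)] that(5) by (simp add: ab_hom_def)
qed

lemma module_mult_in:
  assumes "M \<in> Obj (Mod C)" "X \<in> Obj C" "a \<in> carrier (FO M X)" "b \<in> carrier (FO M X)"
  shows "a \<otimes>\<^bsub>FO M X\<^esub> b \<in> carrier (FO M X)"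
  using module_comm_group[OF assms(1,2)] assms(3,4)
  by (meson comm_group.axioms(2) group.is_monoid monoid.m_closed)

lemma mod_hom_iff:
  "\<eta> \<in> carrier (mod_hom C M N) \<longleftrightarrow> \<eta> \<in> extensional (Obj C) \<and>
    (\<forall>X\<in>Obj C. \<eta> X \<in> hom (FO M X) (FO N X) \<and> \<eta> X \<in> extensional (carrier (FO M X))) \<and>
    (\<forall>X\<in>Obj C. \<forall>Y\<in>Obj C. \<forall>f\<in>homs C Y X. \<forall>x\<in>carrier (FO M X).
      \<eta> Y (FM M X Y f x) = FM N X Y f (\<eta> X x))"
  by (auto simp: mod_hom_def ab_hom_carrier PiE_iff)

lemma mod_homD:
  assumes "\<eta> \<in> carrier (mod_hom C M N)"
  shows mod_hom_hom: "X \<in> Obj C \<Longrightarrow> \<eta> X \<in> hom (FO M X) (FO N X)"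
    and mod_hom_in: "\<lbrakk>X \<in> Obj C; x \<in> carrier (FO M X)\<rbrakk> \<Longrightarrow> \<eta> X x \<in> carrier (FO N X)"
    and mod_hom_nat: "\<lbrakk>X \<in> Obj C; Y \<in> Obj C; f \<in> homs C Y X; x \<in> carrier (FO M X)\<rbrakk>
      \<Longrightarrow> \<eta> Y (FM M X Y f x) = FM N X Y f (\<eta> X x)"
  using assms by (auto simp: mod_hom_iff hom_in_carrier)

lemma mod_hom_eqI:
  assumes "\<eta> \<in> carrier (mod_hom C M N)" "\<theta> \<in> carrier (mod_hom C M N)"
    and "\<And>X x. \<lbrakk>X \<in> Obj C; x \<in> carrier (FO M X)\<rbrakk> \<Longrightarrow> \<eta> X x = \<theta> X x"
  shows "\<eta> = \<theta>"
proof (rule extensionalityI)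
  show "\<eta> \<in> extensional (Obj C)" "\<theta> \<in> extensional (Obj C)" using assms by (auto simp: mod_hom_iff)
  show "\<eta> X = \<theta> X" if "X \<in> Obj C" for X
    using that assms by (intro extensionalityI[of _ "carrier (FO M X)"]) (auto simp: mod_hom_iff)
qed

lemma mod_comp_apply [simp]:
  "\<lbrakk>X \<in> Obj C; x \<in> carrier (FO L X)\<rbrakk> \<Longrightarrow> mod_comp C L \<theta> \<eta> X x = \<theta> X (\<eta> X x)"
  by (simp add: mod_comp_def compose_def)

lemma mod_comp_eq_iff:
  "mod_comp C L \<theta> \<eta> = mod_comp C L \<theta>' \<eta>' \<longleftrightarrow>
    (\<forall>X\<in>Obj C. \<forall>x\<in>carrier (FO L X). \<theta> X (\<eta> X x) = \<theta>' X (\<eta>' X x))"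
proof
  assume "mod_comp C L \<theta> \<eta> = mod_comp C L \<theta>' \<eta>'"
  then show "\<forall>X\<in>Obj C. \<forall>x\<in>carrier (FO L X). \<theta> X (\<eta> X x) = \<theta>' X (\<eta>' X x)"
    by (metis mod_comp_apply)
next
  assume "\<forall>X\<in>Obj C. \<forall>x\<in>carrier (FO L X). \<theta> X (\<eta> X x) = \<theta>' X (\<eta>' X x)"
  then show "mod_comp C L \<theta> \<eta> = mod_comp C L \<theta>' \<eta>'"
    unfolding mod_comp_def compose_def by (intro restrict_ext) auto
qed

lemma mod_comp_in:
  assumes "\<eta> \<in> carrier (mod_hom C L M)" "\<theta> \<in> carrier (mod_hom C M N)" and L: "L \<in> Obj (Mod C)"
  shows "mod_comp C L \<theta> \<eta> \<in> carrier (mod_hom C L N)"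
  unfolding mod_hom_iff
proof (intro conjI ballI)
  fix X assume X: "X \<in> Obj C"
  show "mod_comp C L \<theta> \<eta> X \<in> hom (FO L X) (FO N X)"
    using X mod_hom_hom[OF assms(1) X] mod_hom_hom[OF assms(2) X]
      module_mult_in[OF L X]
    by (auto simp: mod_comp_def compose_def hom_def Pi_iff restrict_def)
  show "mod_comp C L \<theta> \<eta> X \<in> extensional (carrier (FO L X))"
    using X by (simp add: mod_comp_def)
qed (use assms(1,2) in \<open>auto simp: mod_comp_def compose_def mod_homD module_in[OF L]\<close>)

text \<open>Isomorphisms are recognized objectwise: the inverses of bijective components are again
  additive and natural.\<close>

lemma mod_iso_iff_bij:
  assumes M: "M \<in> Obj (Mod C)"
  shows "mod_iso C M N \<eta> \<longleftrightarrow> \<eta> \<in> carrier (mod_hom C M N) \<and>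
    (\<forall>X\<in>Obj C. bij_betw (\<eta> X) (carrier (FO M X)) (carrier (FO N X)))"
proof (intro iffI conjI)
  assume iso: "mod_iso C M N \<eta>"
  then show \<eta>: "\<eta> \<in> carrier (mod_hom C M N)" by (simp add: mod_iso_def)
  obtain \<theta> where \<theta>: "\<theta> \<in> carrier (mod_hom C N M)"
    and inv: "mod_comp C M \<theta> \<eta> = mod_ident C M" "mod_comp C N \<eta> \<theta> = mod_ident C N"
    using iso by (auto simp: mod_iso_def)
  show "\<forall>X\<in>Obj C. bij_betw (\<eta> X) (carrier (FO M X)) (carrier (FO N X))"
  proof
    fix X assume X: "X \<in> Obj C"
    have "\<theta> X (\<eta> X x) = x" if "x \<in> carrier (FO M X)" for x
      using fun_cong[OF fun_cong[OF inv(1), of X], of x] X that by (simp add: mod_ident_def)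
    moreover have "\<eta> X (\<theta> X x) = x" if "x \<in> carrier (FO N X)" for x
      using fun_cong[OF fun_cong[OF inv(2), of X], of x] X that by (simp add: mod_ident_def)
    ultimately show "bij_betw (\<eta> X) (carrier (FO M X)) (carrier (FO N X))"
      using X by (intro bij_betwI[of _ _ _ "\<theta> X"]) (auto simp: mod_hom_in[OF \<eta>] mod_hom_in[OF \<theta>])
  qed
next
  assume "\<eta> \<in> carrier (mod_hom C M N) \<and>
    (\<forall>X\<in>Obj C. bij_betw (\<eta> X) (carrier (FO M X)) (carrier (FO N X)))"
  then have \<eta>: "\<eta> \<in> carrier (mod_hom C M N)"
    and bij: "\<And>X. X \<in> Obj C \<Longrightarrow> bij_betw (\<eta> X) (carrier (FO M X)) (carrier (FO N X))" by auto
  define \<theta> where "\<theta> = (\<lambda>X\<in>Obj C. \<lambda>y\<in>carrier (FO N X). inv_into (carrier (FO M X)) (\<eta> X) y)"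
  have \<theta>\<eta>: "\<theta> X (\<eta> X x) = x" if "X \<in> Obj C" "x \<in> carrier (FO M X)" for X x
    using that bij[of X] mod_hom_in[OF \<eta>, of X x] by (auto simp: \<theta>_def bij_betw_def)
  have \<eta>\<theta>: "\<theta> X y \<in> carrier (FO M X) \<and> \<eta> X (\<theta> X y) = y" if "X \<in> Obj C" "y \<in> carrier (FO N X)" for
      X y
    using that bij[of X] by (auto simp: \<theta>_def bij_betw_def f_inv_into_f inv_into_into)
  have "\<theta> \<in> carrier (mod_hom C N M)" unfolding mod_hom_iff
  proof (intro conjI ballI)
    fix X assume X: "X \<in> Obj C"
    show "\<theta> X \<in> hom (FO N X) (FO M X)"
    proof (rule homI)
      fix y z assume yz: "y \<in> carrier (FO N X)" "z \<in> carrier (FO N X)"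
      have "\<eta> X (\<theta> X y \<otimes>\<^bsub>FO M X\<^esub> \<theta> X z) = y \<otimes>\<^bsub>FO N X\<^esub> z"
        using yz X \<eta>\<theta> hom_mult[OF mod_hom_hom[OF \<eta> X]] by simp
      then show "\<theta> X (y \<otimes>\<^bsub>FO N X\<^esub> z) = \<theta> X y \<otimes>\<^bsub>FO M X\<^esub> \<theta> X z"
        using \<theta>\<eta>[OF X module_mult_in[OF M X]] yz X \<eta>\<theta> by metis
    qed (use X \<eta>\<theta> in auto)
    show "\<theta> X \<in> extensional (carrier (FO N X))" using X by (simp add: \<theta>_def)
  next
    fix X Y f y assume h: "X \<in> Obj C" "Y \<in> Obj C" "f \<in> homs C Y X" "y \<in> carrier (FO N X)"
    then have "FM N X Y f y = \<eta> Y (FM M X Y f (\<theta> X y))"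
      using \<eta>\<theta> mod_hom_nat[OF \<eta> h(1-3)] by metis
    then show "\<theta> Y (FM N X Y f y) = FM M X Y f (\<theta> X y)"
      using \<theta>\<eta> h \<eta>\<theta> module_in[OF M h(1-3)] by metis
  qed (simp add: \<theta>_def)
  moreover have "mod_comp C M \<theta> \<eta> = mod_ident C M"
    unfolding mod_comp_def mod_ident_def compose_def using \<theta>\<eta> by (intro restrict_ext) auto
  moreover have "mod_comp C N \<eta> \<theta> = mod_ident C N"
    unfolding mod_comp_def mod_ident_def compose_def using \<eta>\<theta> by (intro restrict_ext) auto
  ultimately show "mod_iso C M N \<eta>" using \<eta> by (auto simp: mod_iso_def)
qed

lemma mod_iso_sym:
  "mod_iso C M N \<eta> \<Longrightarrow> \<exists>\<theta>. mod_iso C N M \<theta>"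
  by (auto simp: mod_iso_def)

lemma mod_iso_trans:
  assumes "mod_iso C L M \<eta>" "mod_iso C M N \<theta>"
    and L: "L \<in> Obj (Mod C)" and M: "M \<in> Obj (Mod C)"
  shows "mod_iso C L N (mod_comp C L \<theta> \<eta>)"
proof -
  have \<eta>: "\<eta> \<in> carrier (mod_hom C L M)" and \<theta>: "\<theta> \<in> carrier (mod_hom C M N)"
    using assms by (auto simp: mod_iso_def)
  have "bij_betw (mod_comp C L \<theta> \<eta> X) (carrier (FO L X)) (carrier (FO N X))" if X: "X \<in> Obj C" for X
  proof -
    have "bij_betw (\<theta> X \<circ> \<eta> X) (carrier (FO L X)) (carrier (FO N X))"
      using assms X by (auto simp: mod_iso_iff_bij intro: bij_betw_trans)
    then show ?thesis using X by (subst bij_betw_cong[of _ _ "\<theta> X \<circ> \<eta> X"]) auto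
  qed
  then show ?thesis using mod_comp_in[OF \<eta> \<theta> L] by (simp add: mod_iso_iff_bij[OF L])
qed

lemma precomp_simps [simp]:
  "X \<in> Obj C \<Longrightarrow> FO (FO (precomp C F) M) X = FO M (FO F X)"
  "\<lbrakk>X \<in> Obj C; Y \<in> Obj C; f \<in> homs C Y X\<rbrakk> \<Longrightarrow>
    FM (FO (precomp C F) M) X Y f = FM M (FO F X) (FO F Y) (FM F Y X f)"
  "X \<in> Obj C \<Longrightarrow> FM (precomp C F) M N \<eta> X = \<eta> (FO F X)"
  by (simp_all add: precomp_def restrict_functor_def op_cat_def comp_functor_def op_functor_def)

lemma precomp_module:
  assumes C: "preadditive_category C" and F: "additive_functor C D F" and M: "M \<in> Obj (Mod D)"
  shows "FO (precomp C F) M \<in> Obj (Mod C)"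
proof -
  interpret C: preadditive_category C by fact
  note F = additive_functorD[OF F]
  let ?N = "FO (precomp C F) M"
  have "restrict_functor (op_cat C) ?N = ?N"
    by (auto simp: precomp_def restrict_functor_def fun_eq_iff)
  moreover have "additive_functor (op_cat C) Ab ?N"
    unfolding additive_functor_def
  proof (intro conjI ballI)
    fix X assume X: "X \<in> Obj (op_cat C)"
    then show "FO ?N X \<in> Obj Ab"
      using module_comm_group[OF M] F(1) by (simp add: op_cat_def Ab_def)
    show "FM ?N X X (Ident (op_cat C) X) = Ident Ab (FO ?N X)"
      using X F(1,5) C.ident_in module_ext[OF M, of "FO F X" "FO F X" "FM F X X (Ident C X)"]
        module_id[OF M, of "FO F X"] F(3)[of X X "Ident C X"]
      by (auto simp: op_cat_def Ab_def intro!: extensionalityI[of _ "carrier (FO M (FO F X))"])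
  next
    fix X Y assume X: "X \<in> Obj (op_cat C)" and Y: "Y \<in> Obj (op_cat C)"
    show "FM ?N X Y \<in> hom (Hom (op_cat C) X Y) (Hom Ab (FO ?N X) (FO ?N Y))"
    proof (rule homI)
      fix f assume f: "f \<in> homs (op_cat C) X Y"
      show "FM ?N X Y f \<in> carrier (Hom Ab (FO ?N X) (FO ?N Y))"
        using X Y f F(1) F(3)[of Y X f] module_hom[OF M] module_ext[OF M]
        by (simp add: op_cat_def Ab_def ab_hom_carrier)
      fix g assume g: "g \<in> homs (op_cat C) X Y"
      show "FM ?N X Y (f \<otimes>\<^bsub>Hom (op_cat C) X Y\<^esub> g) =
          FM ?N X Y f \<otimes>\<^bsub>Hom Ab (FO ?N X) (FO ?N Y)\<^esub> FM ?N X Y g"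
      proof (rule extensionalityI[of _ "carrier (FO M (FO F X))"])
        show "FM ?N X Y (f \<otimes>\<^bsub>Hom (op_cat C) X Y\<^esub> g) \<in> extensional (carrier (FO M (FO F X)))"
          using X Y f g F(1) F(3)[of Y X "f \<otimes>\<^bsub>Hom C Y X\<^esub> g"] module_ext[OF M]
              by (simp add: op_cat_def)
      qed (use X Y f g F(1) F(3)[of Y X f] F(3)[of Y X g] F(4)[of Y X f g] module_add[OF M]
            in \<open>auto simp: op_cat_def Ab_def ab_hom_def\<close>)
    qed
  next
    fix X Y Z f g
    assume h: "X \<in> Obj (op_cat C)" "Y \<in> Obj (op_cat C)" "Z \<in> Obj (op_cat C)"
      "f \<in> homs (op_cat C) X Y" "g \<in> homs (op_cat C) Y Z"
    show "FM ?N X Z (Comp (op_cat C) X Y Z g f) =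
      Comp Ab (FO ?N X) (FO ?N Y) (FO ?N Z) (FM ?N Y Z g) (FM ?N X Y f)"
    proof (rule extensionalityI[of _ "carrier (FO M (FO F X))"])
      show "FM ?N X Z (Comp (op_cat C) X Y Z g f) \<in> extensional (carrier (FO M (FO F X)))"
        using h F(1) F(3)[of Z X "Comp C Z Y X f g"] module_ext[OF M] by (simp add: op_cat_def)
    qed (use h F(1) F(3)[of Y X f] F(3)[of Z Y g] F(6)[of Z Y X g f] module_comp[OF M]
          in \<open>auto simp: op_cat_def Ab_def compose_def\<close>)
  qed
  ultimately show ?thesis by (simp add: Mod_def is_module_def)
qed

lemma precomp_mod_hom:
  assumes F: "additive_functor C D F" and \<eta>: "\<eta> \<in> carrier (mod_hom D M N)"
  shows "FM (precomp C F) M' N' \<eta> \<in> carrier (mod_hom C (FO (precomp C F) M) (FO (precomp C F) N))"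
proof -
  note F = additive_functorD[OF F]
  have "FM (precomp C F) M' N' \<eta> \<in> extensional (Obj C)" by (simp add: precomp_def)
  then show ?thesis using \<eta> F(1,3) by (auto simp: mod_hom_iff)
qed

lemma precomp_additive:
  fixes D :: "('p, 'n, 'z) precat_scheme"
  assumes C: "preadditive_category C" and F: "additive_functor C D F"
  shows "additive_functor (Mod D :: (('p, 'n, 'a) module_data, 'p \<Rightarrow> 'a \<Rightarrow> 'a) precat) (Mod C)
      (precomp C F)"
  unfolding additive_functor_def
proof (intro conjI ballI)
  note F' = additive_functorD[OF F]
  fix M assume M: "M \<in> Obj (Mod D)"
  show "FO (precomp C F) M \<in> Obj (Mod C)" by (rule precomp_module[OF C F M])
  show "FM (precomp C F) M M (Ident (Mod D) M) = Ident (Mod C) (FO (precomp C F) M)"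
    using F'(1) by (auto simp: mod_ident_def precomp_def restrict_functor_def op_cat_def
        comp_functor_def op_functor_def fun_eq_iff)
next
  note F' = additive_functorD[OF F]
  fix M N :: "('p, 'n, 'a) module_data" assume M: "M \<in> Obj (Mod D)" and N: "N \<in> Obj (Mod D)"
  show "FM (precomp C F) M N \<in> hom (Hom (Mod D) M N) (Hom (Mod C) (FO (precomp C F) M)
      (FO (precomp C F) N))"
    using precomp_mod_hom[OF F] F'(1)
    by (auto intro!: homI) (auto simp: mod_hom_def ab_hom_def precomp_def restrict_functor_def
        op_cat_def comp_functor_def op_functor_def fun_eq_iff)
next
  note F' = additive_functorD[OF F]
  fix L M N \<eta> \<theta>
  assume "\<eta> \<in> homs (Mod D) L M" "\<theta> \<in> homs (Mod D) M N"
  then show "FM (precomp C F) L N (Comp (Mod D) L M N \<theta> \<eta>) =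
    Comp (Mod C) (FO (precomp C F) L) (FO (precomp C F) M) (FO (precomp C F) N)
      (FM (precomp C F) M N \<theta>) (FM (precomp C F) L M \<eta>)"
    using F'(1) by (auto simp: mod_comp_def compose_def precomp_def restrict_functor_def op_cat_def
        comp_functor_def op_functor_def fun_eq_iff)
qed

text \<open>The map \<open>M \<circ> F' \<rightarrow> M \<circ> F\<close> that \<open>\<kappa> : F \<rightarrow> F'\<close> induces on a contravariant \<open>M\<close>.\<close>

definition whisker ::
  "('o, 'm, 'z) precat_scheme \<Rightarrow> ('o, 'm, 'p, 'n) functor_data \<Rightarrow> ('o, 'm, 'p, 'n) functor_data \<Rightarrow>
    ('o \<Rightarrow> 'n) \<Rightarrow> ('p, 'n, 'a) module_data \<Rightarrow> 'o \<Rightarrow> 'a \<Rightarrow> 'a" where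
  "whisker C F F' \<kappa> M =
    (\<lambda>X\<in>Obj C. \<lambda>x\<in>carrier (FO M (FO F' X)). FM M (FO F' X) (FO F X) (\<kappa> X) x)"

lemma whisker_iso:
  assumes C: "preadditive_category C" and F: "additive_functor C D F" and F': "additive_functor C
      D F'"
    and \<kappa>: "nat_iso C D F F' \<kappa>" and M: "M \<in> Obj (Mod D)"
  shows "mod_iso C (FO (precomp C F') M) (FO (precomp C F) M) (whisker C F F' \<kappa> M)"
proof -
  note F1 = additive_functorD[OF F] and F2 = additive_functorD[OF F']
  have l: "\<kappa> X \<in> homs D (FO F X) (FO F' X)" if "X \<in> Obj C" for X
    using \<kappa> that by (auto simp: nat_iso_def is_iso_def)
  have nat: "Comp D (FO F X) (FO F Y) (FO F' Y) (\<kappa> Y) (FM F X Y f) =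
        Comp D (FO F X) (FO F' X) (FO F' Y) (FM F' X Y f) (\<kappa> X)"
    if "X \<in> Obj C" "Y \<in> Obj C" "f \<in> homs C X Y" for X Y f
    using \<kappa> that by (auto simp: nat_iso_def)
  have "whisker C F F' \<kappa> M \<in> carrier (mod_hom C (FO (precomp C F') M) (FO (precomp C F) M))"
    unfolding mod_hom_iff
  proof (intro conjI ballI)
    fix X assume X: "X \<in> Obj C"
    show "whisker C F F' \<kappa> M X \<in> hom (FO (FO (precomp C F') M) X) (FO (FO (precomp C F) M) X)"
      using X module_hom[OF M F2(1)[OF X] F1(1)[OF X] l[OF X]]
        comm_group.axioms(2)[OF module_comm_group[OF M F2(1)[OF X]]]
      by (auto simp: whisker_def hom_def Pi_iff group.is_monoid monoid.m_closed)
    show "whisker C F F' \<kappa> M X \<in> extensional (carrier (FO (FO (precomp C F') M) X))"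
      using X by (simp add: whisker_def)
  next
    fix X Y f x
    assume h: "X \<in> Obj C" "Y \<in> Obj C" "f \<in> homs C Y X" "x \<in> carrier (FO (FO (precomp C F') M) X)"
    have "FM M (FO F' Y) (FO F Y) (\<kappa> Y) (FM M (FO F' X) (FO F' Y) (FM F' Y X f) x) =
      FM M (FO F X) (FO F Y) (FM F Y X f) (FM M (FO F' X) (FO F X) (\<kappa> X) x)"
      using h F1(1,3) F2(1,3) l nat[of Y X f]
      by (simp add: module_comp[OF M, symmetric])
    then show "whisker C F F' \<kappa> M Y (FM (FO (precomp C F') M) X Y f x) =
      FM (FO (precomp C F) M) X Y f (whisker C F F' \<kappa> M X x)"
      using h F1(1,3) F2(1,3) by (simp add: whisker_def module_in[OF M])
  qed (simp add: whisker_def)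
  moreover have "bij_betw (whisker C F F' \<kappa> M X)
    (carrier (FO (FO (precomp C F') M) X)) (carrier (FO (FO (precomp C F) M) X))" if X: "X \<in> Obj
        C" for X
  proof -
    obtain \<mu> where \<mu>: "\<mu> \<in> homs D (FO F' X) (FO F X)"
      "Comp D (FO F X) (FO F' X) (FO F X) \<mu> (\<kappa> X) = Ident D (FO F X)"
      "Comp D (FO F' X) (FO F X) (FO F' X) (\<kappa> X) \<mu> = Ident D (FO F' X)"
      using \<kappa> X by (auto simp: nat_iso_def is_iso_def)
    have "bij_betw (FM M (FO F' X) (FO F X) (\<kappa> X)) (carrier (FO M (FO F' X)))
        (carrier (FO M (FO F X)))"
      using X \<mu> l F1(1) F2(1)
      by (intro bij_betwI[of _ _ _ "FM M (FO F X) (FO F' X) \<mu>"])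
        (auto simp: module_in[OF M] module_id[OF M] module_comp[OF M, symmetric])
    then show ?thesis
      using X by (subst bij_betw_cong[of _ _ "FM M (FO F' X) (FO F X) (\<kappa> X)"])
          (auto simp: whisker_def)
  qed
  ultimately show ?thesis
    by (simp add: mod_iso_iff_bij[OF precomp_module[OF C F' M]])
qed

text \<open>This is an equality, and not just an isomorphism, because modules are in normal form.\<close>

lemma precomp_comp_functor:
  assumes "additive_functor C D F"
  shows "FO (precomp C F) (FO (precomp D G) M) = FO (precomp C (comp_functor G F)) M"
  using additive_functorD(1,3)[OF assms]
  by (auto simp: precomp_def restrict_functor_def op_cat_def comp_functor_def op_functor_def
      fun_eq_iff)

lemma comp_functor_additive:
  assumes "additive_functor C D F" "additive_functor D E G"
  shows "additive_functor C E (comp_functor G F)"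
  using additive_functorD[OF assms(1)] additive_functorD[OF assms(2)]
  by (auto simp: additive_functor_def comp_functor_def hom_def Pi_iff)

section \<open>Compact support\<close>

text \<open>By the Yoneda lemma, \<open>Hom(Y(A), M)\<close> is the group \<open>M A\<close>.\<close>

lemma (in preadditive_category) yoneda_hom_trivial_iff:
  assumes A: "A \<in> Obj C" and M: "M \<in> Obj (Mod C)"
  shows "carrier (mod_hom C (FO (yoneda C) A) M) = {\<one>\<^bsub>mod_hom C (FO (yoneda C) A) M\<^esub>} \<longleftrightarrow>
    carrier (FO M A) = {\<one>\<^bsub>FO M A\<^esub>}"
proof
  have one: "\<one>\<^bsub>FO M X\<^esub> \<in> carrier (FO M X)" if "X \<in> Obj C" for X
    using module_comm_group[OF M that] by (meson comm_group.axioms(2) group.is_monoid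
        monoid.one_closed)
  have zero: "\<one>\<^bsub>mod_hom C (FO (yoneda C) A) M\<^esub> = (\<lambda>X\<in>Obj C. \<lambda>x\<in>homs C X A. \<one>\<^bsub>FO M X\<^esub>)"
    by (auto simp: mod_hom_def ab_hom_def fun_eq_iff)
  {
    assume triv: "carrier (mod_hom C (FO (yoneda C) A) M) = {\<one>\<^bsub>mod_hom C (FO (yoneda C) A) M\<^esub>}"
    have "m = \<one>\<^bsub>FO M A\<^esub>" if m: "m \<in> carrier (FO M A)" for m
    proof -
      define \<eta> where "\<eta> = (\<lambda>X\<in>Obj C. \<lambda>g\<in>homs C X A. FM M A X g m)"
      have "\<eta> \<in> carrier (mod_hom C (FO (yoneda C) A) M)"
        unfolding mod_hom_iff using A m
        by (auto simp: \<eta>_def intro!: homI) (simp_all add: module_in[OF M] module_add[OF M]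
            module_comp[OF M])
      then have "\<eta> A (Ident C A) = \<one>\<^bsub>FO M A\<^esub>" using triv zero A ident_in by simp
      then show ?thesis using A m ident_in by (simp add: \<eta>_def module_id[OF M])
    qed
    then show "carrier (FO M A) = {\<one>\<^bsub>FO M A\<^esub>}" using one[OF A] by blast
  next
    assume triv: "carrier (FO M A) = {\<one>\<^bsub>FO M A\<^esub>}"
    have z_in: "\<one>\<^bsub>mod_hom C (FO (yoneda C) A) M\<^esub> \<in> carrier (mod_hom C (FO (yoneda C) A) M)"
      unfolding mod_hom_iff zero
    proof (intro conjI ballI)
      fix X assume X: "X \<in> Obj C"
      interpret MX: comm_group "FO M X" by (rule module_comm_group[OF M X])
      show "(\<lambda>X\<in>Obj C. \<lambda>x\<in>homs C X A. \<one>\<^bsub>FO M X\<^esub>) X \<in> hom (FO (FO (yoneda C) A) X) (FO M X)"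
        using X A by (auto intro!: homI)
    next
      fix X Y f x assume h: "X \<in> Obj C" "Y \<in> Obj C" "f \<in> homs C Y X"
          "x \<in> carrier (FO (FO (yoneda C) A) X)"
      interpret MX: comm_group "FO M X" by (rule module_comm_group[OF M h(1)])
      interpret MY: comm_group "FO M Y" by (rule module_comm_group[OF M h(2)])
      have "FM M X Y f \<one>\<^bsub>FO M X\<^esub> = \<one>\<^bsub>FO M Y\<^esub>"
        using hom_one[OF module_hom[OF M h(1-3)]] by (simp add: MX.is_group MY.is_group)
      then show "(\<lambda>X\<in>Obj C. \<lambda>x\<in>homs C X A. \<one>\<^bsub>FO M X\<^esub>) Y (FM (FO (yoneda C) A) X Y f x) =
        FM M X Y f ((\<lambda>X\<in>Obj C. \<lambda>x\<in>homs C X A. \<one>\<^bsub>FO M X\<^esub>) X x)"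
        using h A by simp
    qed auto
    have "\<eta> = \<one>\<^bsub>mod_hom C (FO (yoneda C) A) M\<^esub>"
      if \<eta>: "\<eta> \<in> carrier (mod_hom C (FO (yoneda C) A) M)" for \<eta>
    proof (rule mod_hom_eqI[OF \<eta> z_in])
      fix X x assume X: "X \<in> Obj C" and "x \<in> carrier (FO (FO (yoneda C) A) X)"
      then have x: "x \<in> homs C X A" by simp
      interpret MX: comm_group "FO M X" by (rule module_comm_group[OF M X])
      interpret MA: comm_group "FO M A" by (rule module_comm_group[OF M A])
      have "\<eta> A (Ident C A) = \<one>\<^bsub>FO M A\<^esub>" using mod_hom_in[OF \<eta> A, of "Ident C A"] triv A ident_in
          by auto
      moreover have "\<eta> X x = FM M A X x (\<eta> A (Ident C A))"
        using mod_hom_nat[OF \<eta> A X x, of "Ident C A"] A X x ident_in by (simp add: comp_ident_left)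
      moreover have "FM M A X x \<one>\<^bsub>FO M A\<^esub> = \<one>\<^bsub>FO M X\<^esub>"
        using hom_one[OF module_hom[OF M A X x]] by (simp add: MX.is_group MA.is_group)
      ultimately show "\<eta> X x = \<one>\<^bsub>mod_hom C (FO (yoneda C) A) M\<^esub> X x"
        using X x by (simp add: zero)
    qed
    then show "carrier (mod_hom C (FO (yoneda C) A) M) = {\<one>\<^bsub>mod_hom C (FO (yoneda C) A) M\<^esub>}"
      using z_in by blast
  }
qed

text \<open>A group is trivial if its carrier is a singleton, so every bijection of carriers will do.\<close>

lemma module_trivial_bij:
  assumes "M \<in> Obj (Mod C)" "A \<in> Obj C" "N \<in> Obj (Mod D)" "A' \<in> Obj D"
    and "bij_betw f (carrier (FO M A)) (carrier (FO N A'))"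
    and "carrier (FO M A) = {\<one>\<^bsub>FO M A\<^esub>}"
  shows "carrier (FO N A') = {\<one>\<^bsub>FO N A'\<^esub>}"
proof -
  have "\<one>\<^bsub>FO N A'\<^esub> \<in> carrier (FO N A')"
    using module_comm_group[OF assms(3,4)] by (meson comm_group.axioms(2) group.is_monoid
        monoid.one_closed)
  moreover have "carrier (FO N A') = {f \<one>\<^bsub>FO M A\<^esub>}"
    using assms(5,6) by (auto simp: bij_betw_def)
  ultimately show ?thesis by auto
qed

section \<open>Isomorphisms and zero objects\<close>

definition isomorphic :: "('o, 'm, 'z) precat_scheme \<Rightarrow> 'o \<Rightarrow> 'o \<Rightarrow> bool" where
  "isomorphic C X Y \<longleftrightarrow> (\<exists>f. is_iso C X Y f)"

lemma functor_iso:
  assumes F: "additive_functor C D F" and X: "X \<in> Obj C" and Y: "Y \<in> Obj C" and f: "is_iso C X Y f"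
  shows "is_iso D (FO F X) (FO F Y) (FM F X Y f)"
proof -
  note F = additive_functorD[OF F]
  obtain g where g: "f \<in> homs C X Y" "g \<in> homs C Y X"
    "Comp C X Y X g f = Ident C X" "Comp C Y X Y f g = Ident C Y"
    using f by (auto simp: is_iso_def)
  then show ?thesis
    using X Y F(3)[OF X Y g(1)] F(3)[OF Y X g(2)] F(6)[OF X Y X g(1,2)] F(6)[OF Y X Y g(2,1)] F(5)
    by (auto simp: is_iso_def)
qed

lemma functor_isomorphic:
  "\<lbrakk>additive_functor C D F; X \<in> Obj C; Y \<in> Obj C; isomorphic C X Y\<rbrakk>
    \<Longrightarrow> isomorphic D (FO F X) (FO F Y)"
  using functor_iso by (fastforce simp: isomorphic_def)

lemma isomorphic_sym: "isomorphic C X Y \<Longrightarrow> isomorphic C Y X"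
  by (auto simp: isomorphic_def is_iso_def)

context preadditive_category
begin

lemma ident_iso: "X \<in> Obj C \<Longrightarrow> is_iso C X X (Ident C X)"
  using ident_in comp_ident_left by (auto simp: is_iso_def)

lemma iso_comp:
  assumes X: "X \<in> Obj C" and Y: "Y \<in> Obj C" and Z: "Z \<in> Obj C"
    and f: "is_iso C X Y f" and g: "is_iso C Y Z g"
  shows "is_iso C X Z (Comp C X Y Z g f)"
proof -
  obtain f' g' where f': "f \<in> homs C X Y" "f' \<in> homs C Y X"
      "Comp C X Y X f' f = Ident C X" "Comp C Y X Y f f' = Ident C Y"
    and g': "g \<in> homs C Y Z" "g' \<in> homs C Z Y"
      "Comp C Y Z Y g' g = Ident C Y" "Comp C Z Y Z g g' = Ident C Z"
    using f g by (auto simp: is_iso_def)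
  have "Comp C X Z X (Comp C Z Y X f' g') (Comp C X Y Z g f) =
      Comp C X Y X (Comp C Y Z X (Comp C Z Y X f' g') g) f"
    using X Y Z f' g' by (intro comp_assoc) simp_all
  also have "Comp C Y Z X (Comp C Z Y X f' g') g = Comp C Y Y X f' (Comp C Y Z Y g' g)"
    using X Y Z f' g' by (intro comp_assoc[symmetric])
  finally have "Comp C X Z X (Comp C Z Y X f' g') (Comp C X Y Z g f) = Ident C X"
    using X Y f' g' by (simp add: comp_ident_right)
  moreover have "Comp C Z X Z (Comp C X Y Z g f) (Comp C Z Y X f' g') =
      Comp C Z Y Z (Comp C Y X Z (Comp C X Y Z g f) f') g'"
    using X Y Z f' g' by (intro comp_assoc) simp_all
  moreover have "Comp C Y X Z (Comp C X Y Z g f) f' = Comp C Y Y Z g (Comp C Y X Y f f')"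
    using X Y Z f' g' by (intro comp_assoc[symmetric])
  ultimately show ?thesis
    using X Y Z f' g' by (auto simp: is_iso_def comp_ident_right intro!: bexI[of _
        "Comp C Z Y X f' g'"])
qed

lemma iso_square_inverse:
  assumes o: "X \<in> Obj C" "X' \<in> Obj C" "Y \<in> Obj C" "Y' \<in> Obj C"
    and a: "a \<in> homs C X X'" "a' \<in> homs C X' X" "Comp C X' X X' a a' = Ident C X'"
    and b: "b \<in> homs C Y Y'" "b' \<in> homs C Y' Y" "Comp C Y Y' Y b' b = Ident C Y"
    and f: "f \<in> homs C X Y" "f' \<in> homs C X' Y'"
    and square: "Comp C X Y Y' b f = Comp C X X' Y' f' a"
  shows "Comp C X' Y' Y b' f' = Comp C X' X Y f a'"
proof -
  have "Comp C X' Y' Y b' f' = Comp C X' Y' Y b' (Comp C X' X' Y' f' (Comp C X' X X' a a'))"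
    using o a f by (simp add: comp_ident_right)
  also have "\<dots> = Comp C X' Y' Y b' (Comp C X' X Y' (Comp C X X' Y' f' a) a')"
    using comp_assoc[OF o(2,1,2,4) a(2,1) f(2)] by simp
  also have "\<dots> = Comp C X' Y' Y b' (Comp C X' Y Y' b (Comp C X' X Y f a'))"
    using comp_assoc[OF o(2,1,3,4) a(2) f(1) b(1)] square by simp
  also have "\<dots> = Comp C X' X Y f a'"
    using comp_assoc[OF o(2,3,4,3) _ b(1,2), of "Comp C X' X Y f a'"] o a f b
        by (simp add: comp_ident_left)
  finally show ?thesis .
qed

lemma isomorphic_trans:
  "\<lbrakk>X \<in> Obj C; Y \<in> Obj C; Z \<in> Obj C; isomorphic C X Y; isomorphic C Y Z\<rbrakk> \<Longrightarrow> isomorphic C X Z"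
  using iso_comp by (fastforce simp: isomorphic_def)

lemma zero_in [simp]: "\<lbrakk>X \<in> Obj C; Y \<in> Obj C\<rbrakk> \<Longrightarrow> \<one>\<^bsub>Hom C X Y\<^esub> \<in> homs C X Y"
  by (meson comm_group.axioms(2) group.is_monoid hom_comm_group monoid.one_closed)

lemma neg_in [simp]:
  "\<lbrakk>X \<in> Obj C; Y \<in> Obj C; f \<in> homs C X Y\<rbrakk> \<Longrightarrow> inv\<^bsub>Hom C X Y\<^esub> f \<in> homs C X Y"
  by (meson comm_group.axioms(2) group.inv_closed hom_comm_group)

lemma neg_neg [simp]:
  "\<lbrakk>X \<in> Obj C; Y \<in> Obj C; f \<in> homs C X Y\<rbrakk> \<Longrightarrow> inv\<^bsub>Hom C X Y\<^esub> (inv\<^bsub>Hom C X Y\<^esub> f) = f"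
  by (meson comm_group.axioms(2) group.inv_inv hom_comm_group)

lemma comp_zero:
  assumes X: "X \<in> Obj C" and Y: "Y \<in> Obj C" and Z: "Z \<in> Obj C"
  shows "f \<in> homs C X Y \<Longrightarrow> Comp C X Y Z \<one>\<^bsub>Hom C Y Z\<^esub> f = \<one>\<^bsub>Hom C X Z\<^esub>"
    and "g \<in> homs C Y Z \<Longrightarrow> Comp C X Y Z g \<one>\<^bsub>Hom C X Y\<^esub> = \<one>\<^bsub>Hom C X Z\<^esub>"
  using hom_one[OF comp_additive_left[OF X Y Z]] hom_one[OF comp_additive_right[OF X Y Z]] X Y Z
  by (auto dest!: hom_comm_group[THEN comm_group.axioms(2)] simp: comm_group.axioms(2)
      hom_comm_group)

text \<open>In this equational form it is clear that additive functors preserve zero objects.\<close>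

lemma is_zero_iff_ident: "is_zero C Z \<longleftrightarrow> Z \<in> Obj C \<and> Ident C Z = \<one>\<^bsub>Hom C Z Z\<^esub>"
proof (intro iffI conjI)
  assume "is_zero C Z"
  then show Z: "Z \<in> Obj C" and "Ident C Z = \<one>\<^bsub>Hom C Z Z\<^esub>"
    using ident_in zero_in unfolding is_zero_def by blast+
next
  assume Z: "Z \<in> Obj C \<and> Ident C Z = \<one>\<^bsub>Hom C Z Z\<^esub>"
  have "f = \<one>\<^bsub>Hom C X Z\<^esub>" if "X \<in> Obj C" "f \<in> homs C X Z" for X f
    using Z that comp_ident_left[of X Z f] comp_zero(1)[of X Z Z f] by simp
  moreover have "f = \<one>\<^bsub>Hom C Z X\<^esub>" if "X \<in> Obj C" "f \<in> homs C Z X" for X f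
    using Z that comp_ident_right[of Z X f] comp_zero(2)[of Z Z X f] by simp
  ultimately show "is_zero C Z"
    using Z zero_in unfolding is_zero_def by blast
qed

lemma zero_unique:
  "\<lbrakk>is_zero C Z; X \<in> Obj C; f \<in> homs C X Z; g \<in> homs C X Z\<rbrakk> \<Longrightarrow> f = g"
  "\<lbrakk>is_zero C Z; X \<in> Obj C; f \<in> homs C Z X; g \<in> homs C Z X\<rbrakk> \<Longrightarrow> f = g"
  unfolding is_zero_def by blast+

end

lemma functor_zero:
  assumes C: "preadditive_category C" and D: "preadditive_category D"
    and F: "additive_functor C D F" and Z: "is_zero C Z"
  shows "is_zero D (FO F Z)"
proof -
  interpret C: preadditive_category C by fact
  interpret D: preadditive_category D by fact
  note F = additive_functorD[OF F]
  have Z': "Z \<in> Obj C" "Ident C Z = \<one>\<^bsub>Hom C Z Z\<^esub>" using Z C.is_zero_iff_ident by auto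
  have "FM F Z Z \<one>\<^bsub>Hom C Z Z\<^esub> = \<one>\<^bsub>Hom D (FO F Z) (FO F Z)\<^esub>"
    using hom_one[OF F(2)[OF Z'(1) Z'(1)]] C.hom_comm_group D.hom_comm_group F(1) Z'(1)
    by (meson comm_group.axioms(2))
  then show ?thesis using F(1,5)[OF Z'(1)] Z'(2) by (simp add: D.is_zero_iff_ident)
qed

section \<open>Shifting triangles and uniqueness of cones\<close>

context triangulated_category
begin

lemmas shift_D = additive_functorD[OF shift_functor]
lemmas unshift_D = additive_functorD[OF unshift_functor]

lemma shift_pow_in [simp]: "X \<in> Obj T \<Longrightarrow> shift_pow T j X \<in> Obj T"
proof -
  assume X: "X \<in> Obj T"
  have "(FO (Shift T) ^^ k) X \<in> Obj T \<and> (FO (Unshift T) ^^ k) X \<in> Obj T" for k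
    using X shift_D(1) unshift_D(1) by (induction k) auto
  then show ?thesis by (simp add: shift_pow_def)
qed

lemma shift_pow_zero [simp]: "shift_pow T 0 X = X"
  by (simp add: shift_pow_def)

lemma shift_pow_add_one:
  assumes X: "X \<in> Obj T"
  shows "shift_pow T (j + 1) X = FO (Shift T) (shift_pow T j X)"
proof (cases "0 \<le> j")
  case True
  then show ?thesis by (simp add: shift_pow_def nat_add_distrib)
next
  case False
  define k where "k = nat (- j) - 1"
  have k: "nat (- j) = Suc k" "nat (- (j + 1)) = k" using False by (simp_all add: k_def)
  have "(FO (Unshift T) ^^ k) X \<in> Obj T"
    using X unshift_D(1) by (induction k) auto
  moreover have "shift_pow T (j + 1) X = (FO (Unshift T) ^^ k) X"
    using k False by (cases "j + 1 = 0") (auto simp: shift_pow_def)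
  moreover have "shift_pow T j X = FO (Unshift T) ((FO (Unshift T) ^^ k) X)"
    using k False by (simp add: shift_pow_def)
  ultimately show ?thesis by (simp add: shift_unshift_obj)
qed

lemma shift_pow_diff_one:
  assumes X: "X \<in> Obj T"
  shows "shift_pow T (j - 1) X = FO (Unshift T) (shift_pow T j X)"
  using shift_pow_add_one[OF X, of "j - 1"] unshift_shift_obj[of "shift_pow T (j - 1) X"] X by simp

lemma shift_pow_is_zero: "is_zero T Z \<Longrightarrow> is_zero T (shift_pow T j Z)"
proof (induction j rule: int_induct[where k = 0])
  case base
  then show ?case by simp
next
  case (step1 i)
  then show ?case
    using functor_zero[OF preadditive_category_axioms preadditive_category_axioms shift_functor]
    by (simp add: shift_pow_add_one is_zero_def)
next
  case (step2 i)
  then show ?case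
    using functor_zero[OF preadditive_category_axioms preadditive_category_axioms unshift_functor]
    by (simp add: shift_pow_diff_one is_zero_def)
qed

text \<open>Three rotations shift a triangle, at the cost of a sign on each map.\<close>

lemma tri_shift_iff:
  assumes X: "X \<in> Obj T" and Y: "Y \<in> Obj T" and Z: "Z \<in> Obj T"
    and f: "f \<in> homs T X Y" and g: "g \<in> homs T Y Z" and h: "h \<in> homs T Z (FO (Shift T) X)"
  shows "Tri T X Y Z f g h \<longleftrightarrow>
    Tri T (FO (Shift T) X) (FO (Shift T) Y) (FO (Shift T) Z)
      (inv\<^bsub>Hom T (FO (Shift T) X) (FO (Shift T) Y)\<^esub> FM (Shift T) X Y f)
      (inv\<^bsub>Hom T (FO (Shift T) Y) (FO (Shift T) Z)\<^esub> FM (Shift T) Y Z g)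
      (inv\<^bsub>Hom T (FO (Shift T) Z) (FO (Shift T) (FO (Shift T) X))\<^esub> FM (Shift T) Z (FO (Shift T) X)
          h)"
  using assms shift_D(1,3) by (simp add: tri_rotate[of X Y Z] tri_rotate[of Y Z] tri_rotate[of Z])

lemma tri_shift:
  "Tri T X Y Z f g h \<Longrightarrow>
    \<exists>f' g' h'. Tri T (FO (Shift T) X) (FO (Shift T) Y) (FO (Shift T) Z) f' g' h'"
  using tri_shift_iff tri_typed by blast

text \<open>The candidate is obtained by applying \<open>\<Sigma>\<^sup>-\<^sup>1\<close> to the negatives of the maps, which makes up
  for the signs in \<open>tri_shift_iff\<close>.\<close>

lemma tri_unshift:
  assumes "Tri T X Y Z f g h"
  shows "\<exists>f' g' h'. Tri T (FO (Unshift T) X) (FO (Unshift T) Y) (FO (Unshift T) Z) f' g' h'"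
proof -
  let ?U = "Unshift T"
  have t: "X \<in> Obj T" "Y \<in> Obj T" "Z \<in> Obj T" "f \<in> homs T X Y" "g \<in> homs T Y Z"
    "h \<in> homs T Z (FO (Shift T) X)"
    using tri_typed[OF assms] by auto
  let ?f = "FM ?U X Y (inv\<^bsub>Hom T X Y\<^esub> f)"
  let ?g = "FM ?U Y Z (inv\<^bsub>Hom T Y Z\<^esub> g)"
  let ?h = "FM ?U Z (FO (Shift T) X) (inv\<^bsub>Hom T Z (FO (Shift T) X)\<^esub> h)"
  have "?h \<in> homs T (FO ?U Z) (FO (Shift T) (FO ?U X))"
    using unshift_D(3)[OF t(3) shift_D(1)[OF t(1)], of "inv\<^bsub>Hom T Z (FO (Shift T) X)\<^esub> h"] t
        shift_D(1)
    by (simp add: unshift_shift_obj shift_unshift_obj)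
  moreover have "FM (Shift T) (FO ?U Z) X ?h = inv\<^bsub>Hom T Z (FO (Shift T) X)\<^esub> h"
    using shift_unshift_mor[of Z "FO (Shift T) X" "inv\<^bsub>Hom T Z (FO (Shift T) X)\<^esub> h"] t shift_D(1)
    by (simp add: unshift_shift_obj)
  ultimately have "Tri T (FO ?U X) (FO ?U Y) (FO ?U Z) ?f ?g ?h"
    using assms t unshift_D(1,3) shift_D(1)
    by (subst tri_shift_iff) (simp_all add: shift_unshift_obj shift_unshift_mor)
  then show ?thesis by blast
qed

lemma tri_shift_pow:
  assumes "Tri T X Y Z f g h"
  shows "\<exists>f' g' h'. Tri T (shift_pow T j X) (shift_pow T j Y) (shift_pow T j Z) f' g' h'"
proof (induction j rule: int_induct[where k = 0])
  case base
  then show ?case using assms by auto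
next
  case (step1 i)
  then show ?case using tri_shift tri_typed[OF assms] by (fastforce simp: shift_pow_add_one)
next
  case (step2 i)
  then show ?case using tri_unshift tri_typed[OF assms] by (fastforce simp: shift_pow_diff_one)
qed

text \<open>The triangle on an isomorphism \<open>X \<rightarrow> Y\<close> is isomorphic to the one on the identity of \<open>X\<close>. It
  shows that \<open>Y\<close> is an extension of \<open>0\<close> by \<open>X\<close>, which is why the members of a metric are closed
  under isomorphism.\<close>

lemma iso_tri:
  assumes X: "X \<in> Obj T" and Y: "Y \<in> Obj T" and f: "is_iso T X Y f" and Z: "is_zero T Z"
  shows "\<exists>g h. Tri T X Y Z f g h"
proof -
  have Z': "Z \<in> Obj T" using Z by (simp add: is_zero_def)
  have f': "f \<in> homs T X Y" using f by (simp add: is_iso_def)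
  have "triangle_mor T X X Z (Ident T X) \<one>\<^bsub>Hom T X Z\<^esub> \<one>\<^bsub>Hom T Z (FO (Shift T) X)\<^esub>
      X Y Z f \<one>\<^bsub>Hom T Y Z\<^esub> \<one>\<^bsub>Hom T Z (FO (Shift T) X)\<^esub> (Ident T X) f (Ident T Z)"
    unfolding triangle_mor_def
    using X Y Z' f' shift_D(1,3,5) ident_in
    by (auto simp: comp_ident_left comp_ident_right intro: zero_unique[OF Z])
  from tri_iso[OF tri_ident[OF X Z] X Y Z' f' _ _ this ident_iso[OF X] f ident_iso[OF Z']]
  show ?thesis using X Y Z' shift_D(1) by auto
qed

lemma metric_extension:
  "\<lbrakk>metric T B; X \<in> B n; Z \<in> B n; Tri T X Y Z f g h\<rbrakk> \<Longrightarrow> Y \<in> B n"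
  unfolding metric_def star_def using tri_typed by blast

lemma metric_iso_closed:
  assumes B: "metric T B" and X: "X \<in> B n" and Y: "Y \<in> Obj T" and iso: "isomorphic T X Y"
  shows "Y \<in> B n"
proof -
  obtain f where f: "is_iso T X Y f" using iso by (auto simp: isomorphic_def)
  obtain Z where Z: "is_zero T Z" using zero_ex by blast
  have "X \<in> Obj T" "Z \<in> B n" using B X Z by (auto simp: metric_def)
  then show ?thesis using iso_tri[OF _ Y f Z] metric_extension[OF B X] by blast
qed

text \<open>Two cones \<open>D\<close>, \<open>D'\<close> of \<open>f\<close> are compared by the octahedral axiom for \<open>f = id \<circ> f\<close>: it gives a
  triangle \<open>D \<rightarrow> D' \<rightarrow> 0\<close>, so \<open>D'\<close> is an extension of \<open>0\<close> by \<open>D\<close>, also after shifting.\<close>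

lemma metric_cone_unique:
  assumes B: "metric T B" and D: "is_cone T X Y f D" and D': "is_cone T X Y f D'"
    and "shift_pow T j D \<in> B n"
  shows "shift_pow T j D' \<in> B n"
proof -
  obtain u u' where u: "Tri T X Y D f u u'" using D by (auto simp: is_cone_def)
  obtain w w' where w: "Tri T X Y D' f w w'" using D' by (auto simp: is_cone_def)
  have t: "X \<in> Obj T" "Y \<in> Obj T" "f \<in> homs T X Y" using tri_typed[OF u] by auto
  obtain Z where Z: "is_zero T Z" using zero_ex by blast
  have "Tri T X Y D' (Comp T X Y Y (Ident T Y) f) w w'"
    using w t by (simp add: comp_ident_left)
  from octahedral[OF u tri_ident[OF t(2) Z] this]
  obtain a b c where "Tri T D D' Z a b c" by blast
  then obtain a b c where "Tri T (shift_pow T j D) (shift_pow T j D') (shift_pow T j Z) a b c"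
    using tri_shift_pow by blast
  moreover have "shift_pow T j Z \<in> B n" using shift_pow_is_zero[OF Z] B by (auto simp: metric_def)
  ultimately show ?thesis using metric_extension[OF B assms(4)] by blast
qed

end

section \<open>Good Cauchy sequences under functors and isomorphisms\<close>

abbreviation image_seq_obj :: "('o, 'm, 'p, 'n) functor_data \<Rightarrow> (nat \<Rightarrow> 'o) \<Rightarrow> nat \<Rightarrow> 'p" where
  "image_seq_obj F E \<equiv> (\<lambda>n. FO F (E n))"

abbreviation image_seq_map ::
  "('o, 'm, 'p, 'n) functor_data \<Rightarrow> (nat \<Rightarrow> 'o) \<Rightarrow> (nat \<Rightarrow> 'm) \<Rightarrow> nat \<Rightarrow> 'n" where
  "image_seq_map F E e \<equiv> (\<lambda>n. FM F (E n) (E (Suc n)) (e n))"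

lemma is_seq_image:
  "\<lbrakk>additive_functor C D F; is_seq C E e\<rbrakk> \<Longrightarrow> is_seq D (image_seq_obj F E) (image_seq_map F E e)"
  using additive_functorD(1,3)[of C D F] by (simp add: is_seq_def)

lemma seq_map_image:
  assumes C: "preadditive_category C" and F: "additive_functor C D F" and E: "is_seq C E e"
  shows "seq_map D (image_seq_obj F E) (image_seq_map F E e) n k = FM F (E n) (E (n + k))
      (seq_map C E e n k)"
proof (induction k)
  case 0
  then show ?case using additive_functorD(5)[OF F] E by (simp add: is_seq_def)
next
  case (Suc k)
  then show ?case
    using additive_functorD(6)[OF F, of "E n" "E (n + k)" "E (Suc (n + k))" "seq_map C E e n k"
        "e (n + k)"]
      E preadditive_category.seq_map_in[OF C E, of n k]
    by (simp add: is_seq_def)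
qed

lemma triangulated_functor_additive: "triangulated_functor T S F \<Longrightarrow> additive_functor T S F"
  by (simp add: triangulated_functor_def)

lemma triangulated_functor_cone:
  assumes "triangulated_functor T S F" "is_cone T X Y f D"
  shows "is_cone S (FO F X) (FO F Y) (FM F X Y f) (FO F D)"
  using assms unfolding triangulated_functor_def is_cone_def by blast

text \<open>For negative powers: the isomorphism \<open>F \<Sigma> (\<Sigma>\<^sup>-\<^sup>1 A) \<cong> \<Sigma> F (\<Sigma>\<^sup>-\<^sup>1 A)\<close>, transported by
  \<open>\<Sigma>\<^sup>-\<^sup>1\<close>, compares \<open>\<Sigma>\<^sup>-\<^sup>1 F A\<close> with \<open>F \<Sigma>\<^sup>-\<^sup>1 A\<close>.\<close>

lemma triangulated_functor_shift_pow:
  assumes T: "triangulated_category T" and S: "triangulated_category S"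
    and F: "triangulated_functor T S F" and X: "X \<in> Obj T"
  shows "isomorphic S (FO F (shift_pow T j X)) (shift_pow S j (FO F X))"
proof -
  interpret T: triangulated_category T by fact
  interpret S: triangulated_category S by fact
  note F' = additive_functorD[OF triangulated_functor_additive[OF F]]
  have shift: "isomorphic S (FO F (FO (Shift T) A)) (FO (Shift S) (FO F A))" if "A \<in> Obj T" for A
    using F that unfolding triangulated_functor_def nat_iso_def isomorphic_def comp_functor_def
        by auto
  have unshift: "isomorphic S (FO F (FO (Unshift T) A)) (FO (Unshift S) (FO F A))" if A: "A \<in> Obj
      T" for A
  proof -
    have U: "FO (Unshift T) A \<in> Obj T" using A T.unshift_D(1) by simp
    have "isomorphic S (FO (Unshift S) (FO F A))
        (FO (Unshift S) (FO (Shift S) (FO F (FO (Unshift T) A))))"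
      using functor_isomorphic[OF S.unshift_functor _ _ shift[OF U]] A U F'(1) S.shift_D(1)
      by (simp add: T.shift_unshift_obj)
    then show ?thesis using U F'(1) by (simp add: S.unshift_shift_obj isomorphic_sym)
  qed
  show ?thesis
  proof (induction j rule: int_induct[where k = 0])
    case base
    then show ?case using S.ident_iso[OF F'(1)[OF X]] by (auto simp: isomorphic_def)
  next
    case (step1 i)
    have "isomorphic S (FO (Shift S) (FO F (shift_pow T i X)))
        (FO (Shift S) (shift_pow S i (FO F X)))"
      by (rule functor_isomorphic[OF S.shift_functor]) (use step1 X F'(1) in auto)
    from S.isomorphic_trans[OF _ _ _ shift[of "shift_pow T i X"] this] show ?case
      using X F'(1) S.shift_D(1) T.shift_D(1)
      by (simp add: T.shift_pow_add_one S.shift_pow_add_one)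
  next
    case (step2 i)
    have "isomorphic S (FO (Unshift S) (FO F (shift_pow T i X)))
        (FO (Unshift S) (shift_pow S i (FO F X)))"
      by (rule functor_isomorphic[OF S.unshift_functor]) (use step2 X F'(1) in auto)
    from S.isomorphic_trans[OF _ _ _ unshift[of "shift_pow T i X"] this] show ?case
      using X F'(1) S.unshift_D(1) T.unshift_D(1)
      by (simp add: T.shift_pow_diff_one S.shift_pow_diff_one)
  qed
qed

text \<open>The image \<open>G D\<close> of a cone \<open>D\<close> of \<open>E m \<rightarrow> E m'\<close> is a cone of \<open>G (E m) \<rightarrow> G (E m')\<close>, and \<open>\<Sigma>\<^sup>j (G
  D) \<cong> G (\<Sigma>\<^sup>j D)\<close> is in \<open>B i\<close> if \<open>\<Sigma>\<^sup>j D\<close> is in \<open>C i'\<close> for the \<open>i'\<close> that the compression provides.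
  The other cones of \<open>G (E m) \<rightarrow> G (E m')\<close> are covered by \<open>metric_cone_unique\<close>.\<close>

lemma good_cauchy_image:
  assumes S: "triangulated_category S" and T: "triangulated_category T"
    and G: "compression S C T B G" and B: "metric T B" and E: "good_cauchy S C E e"
  shows "good_cauchy T B (image_seq_obj G E) (image_seq_map G E e)"
proof -
  interpret S: triangulated_category S by fact
  interpret T: triangulated_category T by fact
  have tri: "triangulated_functor S T G" using G by (simp add: compression_def)
  note add = triangulated_functor_additive[OF tri]
  have seq: "is_seq S E e" using E by (simp add: good_cauchy_def)
  have En: "E n \<in> Obj S" for n using seq by (simp add: is_seq_def)
  show ?thesis unfolding good_cauchy_def
  proof (intro conjI allI)
    show "is_seq T (image_seq_obj G E) (image_seq_map G E e)" by (rule is_seq_image[OF add seq])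
    fix i and j :: int
    obtain i' where i': "FO G ` C i' \<subseteq> B i" using G unfolding compression_def by blast
    obtain M where M: "\<And>m m' D. \<lbrakk>M \<le> m; m \<le> m'; is_cone S (E m) (E m') (seq_map S E e m (m' - m)) D\<rbrakk>
        \<Longrightarrow> shift_pow S j D \<in> C i'"
      using E unfolding good_cauchy_def by meson
    show "\<exists>M. \<forall>m\<ge>M. \<forall>m'\<ge>m. \<forall>D.
        is_cone T (FO G (E m)) (FO G (E m')) (seq_map T (image_seq_obj G E) (image_seq_map G E e)
            m (m' - m)) D
          \<longrightarrow> shift_pow T j D \<in> B i"
    proof (intro exI[of _ M] allI impI)
      fix m m' D assume m: "M \<le> m" "m \<le> m'" and
        D: "is_cone T (FO G (E m)) (FO G (E m')) (seq_map T (image_seq_obj G E) (image_seq_map G E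
            e) m (m' - m)) D"
      let ?f = "seq_map S E e m (m' - m)"
      have f: "?f \<in> homs S (E m) (E m')" using S.seq_map_in[OF seq, of m "m' - m"] m by simp
      obtain D0 where D0: "is_cone S (E m) (E m') ?f D0"
        using S.tri_complete[OF En En f] by (auto simp: is_cone_def)
      then have D0': "D0 \<in> Obj S" using S.tri_typed by (auto simp: is_cone_def)
      have "FO G (shift_pow S j D0) \<in> B i" using M[OF m D0] i' by auto
      then have "shift_pow T j (FO G D0) \<in> B i"
        using T.metric_iso_closed[OF B _ _ triangulated_functor_shift_pow[OF S T tri D0']]
          additive_functorD(1)[OF add D0'] by simp
      moreover have "is_cone T (FO G (E m)) (FO G (E m')) (FM G (E m) (E m') ?f) (FO G D0)"
        by (rule triangulated_functor_cone[OF tri D0])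
      moreover have "FM G (E m) (E m') ?f = seq_map T (image_seq_obj G E) (image_seq_map G E e) m
          (m' - m)"
        using seq_map_image[OF S.preadditive_category_axioms add seq, of m "m' - m"] m by simp
      ultimately show "shift_pow T j D \<in> B i" using T.metric_cone_unique[OF B] D by metis
    qed
  qed
qed

text \<open>Isomorphic arrows have the same cones, hence a sequence isomorphic to a good Cauchy sequence
  is good Cauchy.\<close>

lemma (in triangulated_category) cone_iso:
  assumes X: "X \<in> Obj T" "X' \<in> Obj T" and Y: "Y \<in> Obj T" "Y' \<in> Obj T"
    and a: "is_iso T X X' a" and b: "is_iso T Y Y' b"
    and f': "f' \<in> homs T X' Y'" and comm: "Comp T X Y Y' b f = Comp T X X' Y' f' a"
    and D: "is_cone T X Y f D"
  shows "is_cone T X' Y' f' D"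
proof -
  obtain g h where t: "Tri T X Y D f g h" using D by (auto simp: is_cone_def)
  have td: "D \<in> Obj T" "f \<in> homs T X Y" "g \<in> homs T Y D" "h \<in> homs T D (FO (Shift T) X)"
    using tri_typed[OF t] by auto
  obtain b' where b': "b \<in> homs T Y Y'" "b' \<in> homs T Y' Y" "Comp T Y Y' Y b' b = Ident T Y"
    using b by (auto simp: is_iso_def)
  have a': "a \<in> homs T X X'" using a by (simp add: is_iso_def)
  let ?g = "Comp T Y' Y D g b'" and ?h = "Comp T D (FO (Shift T) X) (FO (Shift T) X')
      (FM (Shift T) X X' a) h"
  have "triangle_mor T X Y D f g h X' Y' D f' ?g ?h a b (Ident T D)"
    unfolding triangle_mor_def
    using X Y td a' b' comm shift_D(1) shift_D(3)[OF X a'] ident_in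
    by (auto simp: comp_ident_left comp_ident_right comp_assoc[of Y Y' Y D, symmetric])
  then have "Tri T X' Y' D f' ?g ?h"
    using tri_iso[OF t X(2) Y(2) td(1) f'] X Y td b' a b shift_D(1) shift_D(3)[OF X a'] ident_iso
        by simp
  then show ?thesis by (auto simp: is_cone_def)
qed

lemma (in triangulated_category) good_cauchy_iso:
  assumes E: "good_cauchy T B E e" and E': "is_seq T E' e'"
    and iso: "\<And>n. is_iso T (E' n) (E n) (\<phi> n)"
    and nat: "\<And>n. Comp T (E' n) (E' (Suc n)) (E (Suc n)) (\<phi> (Suc n)) (e' n) =
      Comp T (E' n) (E n) (E (Suc n)) (e n) (\<phi> n)"
  shows "good_cauchy T B E' e'"
proof -
  have seq: "is_seq T E e" using E by (simp add: good_cauchy_def)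
  have ob: "E n \<in> Obj T" "E' n \<in> Obj T" "e n \<in> homs T (E n) (E (Suc n))"
    "e' n \<in> homs T (E' n) (E' (Suc n))" for n
    using seq E' by (auto simp: is_seq_def)
  have \<phi>: "\<phi> n \<in> homs T (E' n) (E n)" for n using iso[of n] by (simp add: is_iso_def)
  have nat': "Comp T (E' n) (E' (n + k)) (E (n + k)) (\<phi> (n + k)) (seq_map T E' e' n k) =
      Comp T (E' n) (E n) (E (n + k)) (seq_map T E e n k) (\<phi> n)" for n k
  proof (induction k)
    case 0
    then show ?case using ob \<phi>[of n] by (simp add: comp_ident_left comp_ident_right)
  next
    case (Suc k)
    show ?case
      using ob \<phi> seq_map_in[OF seq, of n k] seq_map_in[OF E', of n k] nat[of "n + k"] Suc
      by (simp add: comp_assoc) (simp add: comp_assoc[symmetric])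
  qed
  show ?thesis unfolding good_cauchy_def
  proof (intro conjI allI)
    show "is_seq T E' e'" by (rule E')
    fix i and j :: int
    obtain M where M: "\<And>m m' D. \<lbrakk>M \<le> m; m \<le> m'; is_cone T (E m) (E m') (seq_map T E e m (m' - m)) D\<rbrakk>
        \<Longrightarrow> shift_pow T j D \<in> B i"
      using E unfolding good_cauchy_def by meson
    show "\<exists>M. \<forall>m\<ge>M. \<forall>m'\<ge>m. \<forall>D.
        is_cone T (E' m) (E' m') (seq_map T E' e' m (m' - m)) D \<longrightarrow> shift_pow T j D \<in> B i"
    proof (intro exI[of _ M] allI impI)
      fix m m' D assume m: "M \<le> m" "m \<le> m'"
        and D: "is_cone T (E' m) (E' m') (seq_map T E' e' m (m' - m)) D"
      have "is_cone T (E m) (E m') (seq_map T E e m (m' - m)) D"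
        by (rule cone_iso[OF ob(2) ob(1) ob(2) ob(1) iso iso _ _ D])
          (use seq_map_in[OF seq, of m "m' - m"] nat'[of m "m' - m"] m in simp_all)
      then show "shift_pow T j D \<in> B i" by (rule M[OF m])
    qed
  qed
qed

section \<open>The adjunction and the shift\<close>

context triangulated_category
begin

declare shift_D(1) [simp] unshift_D(1) [simp] unshift_shift_obj [simp] shift_unshift_obj [simp]

lemma shift_inj:
  "\<lbrakk>X \<in> Obj T; Y \<in> Obj T; f \<in> homs T X Y; g \<in> homs T X Y; FM (Shift T) X Y f = FM (Shift T) X Y g\<rbrakk>
    \<Longrightarrow> f = g"
  by (metis unshift_shift_mor)

lemma shift_in_unshift:
  assumes "X \<in> Obj T" "A \<in> Obj T" "x \<in> homs T (FO (Unshift T) X) A"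
  shows "FM (Shift T) (FO (Unshift T) X) A x \<in> homs T X (FO (Shift T) A)"
  using shift_D(3)[OF unshift_D(1)[OF assms(1)] assms(2,3)] assms(1)
      by (simp add: shift_unshift_obj)

lemma unshift_in_shift:
  assumes "X \<in> Obj T" "A \<in> Obj T" "x \<in> homs T X (FO (Shift T) A)"
  shows "FM (Unshift T) X (FO (Shift T) A) x \<in> homs T (FO (Unshift T) X) A"
  using unshift_D(3)[OF assms(1) shift_D(1)[OF assms(2)] assms(3)] assms(2)
      by (simp add: unshift_shift_obj)

lemma shift_unshift_transpose:
  assumes "X \<in> Obj T" "A \<in> Obj T" "x \<in> homs T X (FO (Shift T) A)"
  shows "FM (Shift T) (FO (Unshift T) X) A (FM (Unshift T) X (FO (Shift T) A) x) = x"
  using shift_unshift_mor[OF assms(1) shift_D(1)[OF assms(2)] assms(3)] assms(2)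
      by (simp add: unshift_shift_obj)

lemma is_seq_shift: "is_seq T E e \<Longrightarrow> is_seq T (shift_seq_obj T E) (shift_seq_map T E e)"
  by (rule is_seq_image[OF shift_functor])

lemma shift_colim_class:
  assumes E: "is_seq T E e" and X: "X \<in> Obj T" and x: "x \<in> homs T (FO (Unshift T) X) (E n)"
  shows "shift_colim T E e X (colim_class T E e (FO (Unshift T) X) n x) =
    colim_class T (shift_seq_obj T E) (shift_seq_map T E e) X n (FM (Shift T) (FO (Unshift T) X)
        (E n) x)"
proof -
  let ?U = "FO (Unshift T) X"
  have U: "?U \<in> Obj T" using X by (rule unshift_D(1))
  have En: "E n \<in> Obj T" "e n \<in> homs T (E n) (E (Suc n))" for n using E by (auto simp: is_seq_def)
  have "stage_maps T E e ?U T (shift_seq_obj T E) (shift_seq_map T E e) X (\<lambda>n. FM (Shift T) ?U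
      (E n))"
    unfolding stage_maps_def
    using shift_in_unshift[OF X En(1)] shift_D(6)[OF U En(1) En(1) _ En(2)] X
    by (simp add: shift_unshift_obj)
  from stage_colim_class[OF preadditive_category_axioms E U preadditive_category_axioms
      is_seq_shift[OF E] X this x]
  show ?thesis
    using X U x by (simp add: shift_colim_def stage_colim_def)
qed

end

text \<open>A right adjoint \<open>G\<close> which is exact by means of \<open>\<psi> : G \<Sigma> \<rightarrow> \<Sigma> G\<close>. The compatibility of the
  left adjoint \<open>F\<close> with the shift is derived from \<open>\<psi>\<close>.\<close>

locale exact_right_adjoint =
  T: triangulated_category T + S: triangulated_category S
  for T :: "('o, 'm, 'y) tricat_scheme" and S :: "('p, 'n, 'z) tricat_scheme" +
  fixes F :: "('o, 'm, 'p, 'n) functor_data" and G :: "('p, 'n, 'o, 'm) functor_data"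
    and \<Phi> :: "'o \<Rightarrow> 'p \<Rightarrow> 'n \<Rightarrow> 'm" and \<psi> :: "'p \<Rightarrow> 'm"
  assumes F_functor: "additive_functor T S F" and G_functor: "additive_functor S T G"
    and adj_bij: "\<lbrakk>X \<in> Obj T; Y \<in> Obj S\<rbrakk> \<Longrightarrow> bij_betw (\<Phi> X Y) (homs S (FO F X) Y) (homs T X (FO G Y))"
    and adj_nat_left: "\<lbrakk>X \<in> Obj T; X' \<in> Obj T; Y \<in> Obj S; f \<in> homs T X' X; k \<in> homs S (FO F X) Y\<rbrakk> \<Longrightarrow>
      \<Phi> X' Y (Comp S (FO F X') (FO F X) Y k (FM F X' X f)) = Comp T X' X (FO G Y) (\<Phi> X Y k) f"
    and adj_nat_right: "\<lbrakk>X \<in> Obj T; Y \<in> Obj S; Y' \<in> Obj S; g \<in> homs S Y Y'; k \<in> homs S (FO F X) Y\<rbrakk> \<Longrightarrow>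
      \<Phi> X Y' (Comp S (FO F X) Y Y' g k) = Comp T X (FO G Y) (FO G Y') (FM G Y Y' g) (\<Phi> X Y k)"
    and shift_nat_iso: "nat_iso S T (comp_functor G (Shift S)) (comp_functor (Shift T) G) \<psi>"
    and exact: "Tri S A A' A'' a a' a'' \<Longrightarrow>
      Tri T (FO G A) (FO G A') (FO G A'') (FM G A A' a) (FM G A' A'' a')
        (Comp T (FO G A'') (FO G (FO (Shift S) A)) (FO (Shift T) (FO G A))
          (\<psi> A) (FM G A'' (FO (Shift S) A) a''))"
begin

lemmas F_D = additive_functorD[OF F_functor]
lemmas G_D = additive_functorD[OF G_functor]

declare F_D(1) [simp] G_D(1) [simp]

lemma adj_in [simp]:
  assumes "X \<in> Obj T" "Y \<in> Obj S" "k \<in> homs S (FO F X) Y"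
  shows "\<Phi> X Y k \<in> homs T X (FO G Y)"
  using bij_betwE[OF adj_bij[OF assms(1,2)]] assms(3) by blast

lemma adj_inj:
  assumes "X \<in> Obj T" "Y \<in> Obj S" "k \<in> homs S (FO F X) Y" "k' \<in> homs S (FO F X) Y" "\<Phi> X Y k =
      \<Phi> X Y k'"
  shows "k = k'"
  using inj_onD[OF bij_betw_imp_inj_on[OF adj_bij[OF assms(1,2)]] assms(5,3,4)] .

lemma adj_surj:
  assumes "X \<in> Obj T" "Y \<in> Obj S" "x \<in> homs T X (FO G Y)"
  obtains k where "k \<in> homs S (FO F X) Y" "\<Phi> X Y k = x"
proof -
  have "x \<in> \<Phi> X Y ` homs S (FO F X) Y"
    using assms(3) by (simp only: bij_betw_imp_surj_on[OF adj_bij[OF assms(1,2)]])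
  then show thesis using that by auto
qed

text \<open>The adjunction bijection is additive because it is postcomposition of \<open>G\<close> with the unit.\<close>

lemma adj_unit:
  assumes X: "X \<in> Obj T" and Y: "Y \<in> Obj S" and k: "k \<in> homs S (FO F X) Y"
  shows "\<Phi> X Y k =
    Comp T X (FO G (FO F X)) (FO G Y) (FM G (FO F X) Y k) (\<Phi> X (FO F X) (Ident S (FO F X)))"
  using adj_nat_right[OF X F_D(1)[OF X] Y k S.ident_in[OF F_D(1)[OF X]]]
    S.comp_ident_right[OF F_D(1)[OF X] Y k] by simp

lemma adj_hom:
  assumes X: "X \<in> Obj T" and Y: "Y \<in> Obj S"
  shows "\<Phi> X Y \<in> hom (Hom S (FO F X) Y) (Hom T X (FO G Y))"
proof (rule homI)
  fix k k' assume k: "k \<in> homs S (FO F X) Y" "k' \<in> homs S (FO F X) Y"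
  note o = F_D(1)[OF X] G_D(1)[OF F_D(1)[OF X]] G_D(1)[OF Y]
  show "\<Phi> X Y (k \<otimes>\<^bsub>Hom S (FO F X) Y\<^esub> k') = \<Phi> X Y k \<otimes>\<^bsub>Hom T X (FO G Y)\<^esub> \<Phi> X Y k'"
    using X Y k o adj_unit[OF X Y k(1)] adj_unit[OF X Y k(2)]
      adj_unit[OF X Y S.mult_in[OF o(1) Y k]] G_D(3)[OF o(1) Y] S.ident_in[OF o(1)]
    by (simp add: G_D(4)[OF o(1) Y k] T.comp_mult_left)
qed (use X Y in simp)

lemma shift_iso: "A \<in> Obj S \<Longrightarrow> is_iso T (FO G (FO (Shift S) A)) (FO (Shift T) (FO G A)) (\<psi> A)"
  using shift_nat_iso by (simp add: nat_iso_def comp_functor_def)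

lemma shift_iso_in [simp]: "A \<in> Obj S \<Longrightarrow> \<psi> A \<in> homs T (FO G (FO (Shift S) A))
    (FO (Shift T) (FO G A))"
  using shift_iso by (simp add: is_iso_def)

lemma shift_iso_nat:
  "\<lbrakk>A \<in> Obj S; A' \<in> Obj S; a \<in> homs S A A'\<rbrakk> \<Longrightarrow>
    Comp T (FO G (FO (Shift S) A)) (FO G (FO (Shift S) A')) (FO (Shift T) (FO G A')) (\<psi> A')
      (FM G (FO (Shift S) A) (FO (Shift S) A') (FM (Shift S) A A' a)) =
    Comp T (FO G (FO (Shift S) A)) (FO (Shift T) (FO G A)) (FO (Shift T) (FO G A'))
      (FM (Shift T) (FO G A) (FO G A') (FM G A A' a)) (\<psi> A)"
  using shift_nat_iso by (simp add: nat_iso_def comp_functor_def)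

definition shifted_adj :: "'o \<Rightarrow> 'p \<Rightarrow> 'n \<Rightarrow> 'm" where
  "shifted_adj X A y =
    Comp T X (FO G (FO (Shift S) A)) (FO (Shift T) (FO G A)) (\<psi> A) (\<Phi> X (FO (Shift S) A) y)"

lemma shifted_adj_in [simp]:
  "\<lbrakk>X \<in> Obj T; A \<in> Obj S; y \<in> homs S (FO F X) (FO (Shift S) A)\<rbrakk>
    \<Longrightarrow> shifted_adj X A y \<in> homs T X (FO (Shift T) (FO G A))"
  by (simp add: shifted_adj_def)

lemma shifted_adj_bij:
  assumes X: "X \<in> Obj T" and A: "A \<in> Obj S"
  shows "bij_betw (shifted_adj X A) (homs S (FO F X) (FO (Shift S) A))
      (homs T X (FO (Shift T) (FO G A)))"
proof -
  note o = S.shift_D(1)[OF A] G_D(1)[OF S.shift_D(1)[OF A]] T.shift_D(1)[OF G_D(1)[OF A]]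
  obtain \<psi>' where \<psi>': "\<psi>' \<in> homs T (FO (Shift T) (FO G A)) (FO G (FO (Shift S) A))"
    "Comp T (FO G (FO (Shift S) A)) (FO (Shift T) (FO G A)) (FO G (FO (Shift S) A)) \<psi>' (\<psi> A) =
        Ident T (FO G (FO (Shift S) A))"
    "Comp T (FO (Shift T) (FO G A)) (FO G (FO (Shift S) A)) (FO (Shift T) (FO G A)) (\<psi> A) \<psi>' =
        Ident T (FO (Shift T) (FO G A))"
    using shift_iso[OF A] by (auto simp: is_iso_def)
  have "bij_betw (Comp T X (FO G (FO (Shift S) A)) (FO (Shift T) (FO G A)) (\<psi> A))
      (homs T X (FO G (FO (Shift S) A))) (homs T X (FO (Shift T) (FO G A)))"
    using X A o \<psi>'
    by (intro bij_betwI[of _ _ _ "Comp T X (FO (Shift T) (FO G A)) (FO G (FO (Shift S) A)) \<psi>'"])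
      (auto simp: T.comp_assoc T.comp_ident_left)
  from bij_betw_trans[OF adj_bij[OF X o(1)] this]
  show ?thesis by (rule iffD1[OF bij_betw_cong, rotated]) (simp add: shifted_adj_def)
qed

lemma shifted_adj_nat_right:
  assumes X: "X \<in> Obj T" and A: "A \<in> Obj S" "A' \<in> Obj S" and a: "a \<in> homs S A A'"
    and y: "y \<in> homs S (FO F X) (FO (Shift S) A)"
  shows "shifted_adj X A' (Comp S (FO F X) (FO (Shift S) A) (FO (Shift S) A') (FM (Shift S) A A'
      a) y) =
    Comp T X (FO (Shift T) (FO G A)) (FO (Shift T) (FO G A')) (FM (Shift T) (FO G A) (FO G A')
        (FM G A A' a))
      (shifted_adj X A y)"
proof -
  let ?GS = "\<lambda>A. FO G (FO (Shift S) A)" and ?SG = "\<lambda>A. FO (Shift T) (FO G A)"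
  have sA: "FO (Shift S) A \<in> Obj S" "FO (Shift S) A' \<in> Obj S" using A by auto
  have o: "?GS A \<in> Obj T" "?GS A' \<in> Obj T" "?SG A \<in> Obj T" "?SG A' \<in> Obj T"
    using A by auto
  have sa: "FM (Shift S) A A' a \<in> homs S (FO (Shift S) A) (FO (Shift S) A')"
      by (rule S.shift_D(3)[OF A a])
  note GSa = G_D(3)[OF sA sa] and Phi = adj_in[OF X sA(1) y] and psi = A[THEN shift_iso_in]
  have SGa: "FM (Shift T) (FO G A) (FO G A') (FM G A A' a) \<in> homs T (?SG A) (?SG A')"
    by (rule T.shift_D(3)[OF A[THEN G_D(1)] G_D(3)[OF A a]])
  show ?thesis
    unfolding shifted_adj_def adj_nat_right[OF X sA sa y] T.comp_assoc[OF X o(1,2,4) Phi GSa psi(2)]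
      shift_iso_nat[OF A a] T.comp_assoc[OF X o(1,3,4) Phi psi(1) SGa] ..
qed

lemma shifted_adj_nat_left:
  assumes X: "X \<in> Obj T" "X' \<in> Obj T" and A: "A \<in> Obj S" and f: "f \<in> homs T X' X"
    and y: "y \<in> homs S (FO F X) (FO (Shift S) A)"
  shows "shifted_adj X' A (Comp S (FO F X') (FO F X) (FO (Shift S) A) y (FM F X' X f)) =
    Comp T X' X (FO (Shift T) (FO G A)) (shifted_adj X A y) f"
  unfolding shifted_adj_def adj_nat_left[OF X S.shift_D(1)[OF A] f y]
  by (rule T.comp_assoc[OF X(2,1) G_D(1)[OF S.shift_D(1)[OF A]] T.shift_D(1)[OF G_D(1)[OF A]] f
        adj_in[OF X(1) S.shift_D(1)[OF A] y] shift_iso_in[OF A]])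

text \<open>The mate of \<open>\<psi>\<close>: there are bijections
  \<open>S(\<Sigma>\<^sup>-\<^sup>1 F X, A) \<cong> S(F X, \<Sigma> A) \<cong> T(X, \<Sigma> G A) \<cong> T(\<Sigma>\<^sup>-\<^sup>1 X, G A) \<cong> S(F \<Sigma>\<^sup>-\<^sup>1 X, A)\<close>, natural in \<open>A\<close>,
  the second one being \<open>shifted_adj\<close>. They are induced by an isomorphism \<open>F \<Sigma>\<^sup>-\<^sup>1 X \<rightarrow> \<Sigma>\<^sup>-\<^sup>1 F X\<close>, which
  is the image of the identity of \<open>\<Sigma>\<^sup>-\<^sup>1 F X\<close>.\<close>

definition mate :: "'o \<Rightarrow> 'n" where
  "mate X = (SOME k. k \<in> homs S (FO F (FO (Unshift T) X)) (FO (Unshift S) (FO F X)) \<and>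
    FM (Shift T) (FO (Unshift T) X) (FO G (FO (Unshift S) (FO F X)))
      (\<Phi> (FO (Unshift T) X) (FO (Unshift S) (FO F X)) k) =
    shifted_adj X (FO (Unshift S) (FO F X)) (Ident S (FO F X)))"

lemma mate:
  assumes X: "X \<in> Obj T"
  shows mate_in [simp]: "mate X \<in> homs S (FO F (FO (Unshift T) X)) (FO (Unshift S) (FO F X))"
    and shift_adj_mate: "FM (Shift T) (FO (Unshift T) X) (FO G (FO (Unshift S) (FO F X)))
      (\<Phi> (FO (Unshift T) X) (FO (Unshift S) (FO F X)) (mate X)) =
    shifted_adj X (FO (Unshift S) (FO F X)) (Ident S (FO F X))"
proof -
  let ?A = "FO (Unshift S) (FO F X)"
  have FX: "FO F X \<in> Obj S" and A: "?A \<in> Obj S" and SA: "FO (Shift S) ?A = FO F X"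
    and UX: "FO (Unshift T) X \<in> Obj T" and GA: "FO G ?A \<in> Obj T"
    using X by simp_all
  let ?y = "shifted_adj X ?A (Ident S (FO F X))"
  have y: "?y \<in> homs T X (FO (Shift T) (FO G ?A))"
    using X A SA S.ident_in[OF FX] by simp
  obtain k where "k \<in> homs S (FO F (FO (Unshift T) X)) ?A"
    "\<Phi> (FO (Unshift T) X) ?A k = FM (Unshift T) X (FO (Shift T) (FO G ?A)) ?y"
    using adj_surj[OF UX A T.unshift_in_shift[OF X GA y]] .
  then have "\<exists>k. k \<in> homs S (FO F (FO (Unshift T) X)) ?A \<and>
    FM (Shift T) (FO (Unshift T) X) (FO G ?A) (\<Phi> (FO (Unshift T) X) ?A k) = ?y"
    using T.shift_unshift_transpose[OF X GA y] by auto
  from someI_ex[OF this]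
  show "mate X \<in> homs S (FO F (FO (Unshift T) X)) ?A"
    and "FM (Shift T) (FO (Unshift T) X) (FO G ?A) (\<Phi> (FO (Unshift T) X) ?A (mate X)) = ?y"
    unfolding mate_def by auto
qed

text \<open>The equation that defines the mate is the case where \<open>x\<close> is an identity; naturality in \<open>A\<close>
  extends it to all \<open>x\<close>. So \<open>x \<mapsto> x \<circ> mate X\<close> is the chain of bijections above.\<close>

lemma shift_adj_comp_mate:
  assumes X: "X \<in> Obj T" and A: "A \<in> Obj S" and x: "x \<in> homs S (FO (Unshift S) (FO F X)) A"
  shows "FM (Shift T) (FO (Unshift T) X) (FO G A) (\<Phi> (FO (Unshift T) X) A
      (Comp S (FO F (FO (Unshift T) X)) (FO (Unshift S) (FO F X)) A x (mate X))) =
    shifted_adj X A (FM (Shift S) (FO (Unshift S) (FO F X)) A x)"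
proof -
  let ?U = "FO (Unshift T) X" and ?V = "FO (Unshift S) (FO F X)"
  have FX: "FO F X \<in> Obj S" and V: "?V \<in> Obj S" and SV: "FO (Shift S) ?V = FO F X"
    and U: "?U \<in> Obj T" and SU: "FO (Shift T) ?U = X" and GV: "FO G ?V \<in> Obj T"
        and GA: "FO G A \<in> Obj T"
    using X A by simp_all
  have sx: "FM (Shift S) ?V A x \<in> homs S (FO F X) (FO (Shift S) A)"
    using S.shift_in_unshift[OF FX A x] .
  have "FM (Shift T) ?U (FO G A) (\<Phi> ?U A (Comp S (FO F ?U) ?V A x (mate X))) =
      FM (Shift T) ?U (FO G A) (Comp T ?U (FO G ?V) (FO G A) (FM G ?V A x) (\<Phi> ?U ?V (mate X)))"
    using adj_nat_right[OF U V A x mate_in[OF X]] by simp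
  also have "\<dots> = Comp T X (FO (Shift T) (FO G ?V)) (FO (Shift T) (FO G A))
      (FM (Shift T) (FO G ?V) (FO G A) (FM G ?V A x)) (shifted_adj X ?V (Ident S (FO F X)))"
    using T.shift_D(6)[OF U GV GA adj_in[OF U V mate_in[OF X]] G_D(3)[OF V A x]]
    by (simp add: SU shift_adj_mate[OF X])
  also have "\<dots> = shifted_adj X A (Comp S (FO F X) (FO F X) (FO (Shift S) A) (FM (Shift S) ?V A x)
      (Ident S (FO F X)))"
    using shifted_adj_nat_right[OF X V A x, of "Ident S (FO F X)"] S.ident_in[OF FX]
        by (simp add: SV)
  also have "\<dots> = shifted_adj X A (FM (Shift S) ?V A x)"
    using FX S.shift_D(1)[OF A] sx by (simp add: S.comp_ident_right)
  finally show ?thesis .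
qed

lemma shift_adj_inj:
  assumes X: "X \<in> Obj T" and A: "A \<in> Obj S"
    and k: "k \<in> homs S (FO F (FO (Unshift T) X)) A" "k' \<in> homs S (FO F (FO (Unshift T) X)) A"
    and eq: "FM (Shift T) (FO (Unshift T) X) (FO G A) (\<Phi> (FO (Unshift T) X) A k) =
      FM (Shift T) (FO (Unshift T) X) (FO G A) (\<Phi> (FO (Unshift T) X) A k')"
  shows "k = k'"
proof -
  have U: "FO (Unshift T) X \<in> Obj T" using X by (rule T.unshift_D(1))
  show ?thesis
    using adj_inj[OF U A k] T.shift_inj[OF U G_D(1)[OF A] adj_in[OF U A k(1)] adj_in[OF U A k(2)]
        eq] by simp
qed

text \<open>Precomposition with \<open>mate X\<close> is bijective by \<open>shift_adj_comp_mate\<close>, and then \<open>mate X\<close> is an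
  isomorphism by the argument of the Yoneda lemma. Naturality is tested after applying the
  bijection \<open>k \<mapsto> \<Sigma> (\<Phi> k)\<close>.\<close>

lemma mate_nat_iso:
  "nat_iso T S (comp_functor F (Unshift T)) (comp_functor (Unshift S) F) mate"
  unfolding nat_iso_def
proof (intro conjI ballI)
  fix X assume X: "X \<in> Obj T"
  let ?U = "FO (Unshift T) X" and ?V = "FO (Unshift S) (FO F X)" and ?W = "FO F (FO (Unshift T) X)"
  have FX: "FO F X \<in> Obj S" and V: "?V \<in> Obj S" and SV: "FO (Shift S) ?V = FO F X"
    and U: "?U \<in> Obj T" and SU: "FO (Shift T) ?U = X" and W: "?W \<in> Obj S" and GW: "FO G ?W \<in> Obj T"
    using X by simp_all
  have m: "mate X \<in> homs S ?W ?V" by (rule mate_in[OF X])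
  have inj: "x = x'" if A: "A \<in> Obj S" and x: "x \<in> homs S ?V A" "x' \<in> homs S ?V A"
    and eq: "Comp S ?W ?V A x (mate X) = Comp S ?W ?V A x' (mate X)" for A x x'
  proof -
    have "shifted_adj X A (FM (Shift S) ?V A x) = shifted_adj X A (FM (Shift S) ?V A x')"
      using shift_adj_comp_mate[OF X A x(1)] shift_adj_comp_mate[OF X A x(2)] eq by simp
    then have "FM (Shift S) ?V A x = FM (Shift S) ?V A x'"
      by (rule inj_onD[OF bij_betw_imp_inj_on[OF shifted_adj_bij[OF X A]]])
        (use S.shift_in_unshift[OF FX A] x in simp_all)
    then show ?thesis by (rule S.shift_inj[OF V A x])
  qed
  have i: "Ident S ?W \<in> homs S ?W ?W" using W by (rule S.ident_in)
  have "FM (Shift T) ?U (FO G ?W) (\<Phi> ?U ?W (Ident S ?W)) \<in> homs T X (FO (Shift T) (FO G ?W))"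
    using T.shift_in_unshift[OF X GW] adj_in[OF U W i] by simp
  then obtain y where y: "y \<in> homs S (FO F X) (FO (Shift S) ?W)"
    "shifted_adj X ?W y = FM (Shift T) ?U (FO G ?W) (\<Phi> ?U ?W (Ident S ?W))"
    unfolding bij_betw_imp_surj_on[OF shifted_adj_bij[OF X W], symmetric] by auto
  let ?x = "FM (Unshift S) (FO F X) (FO (Shift S) ?W) y"
  have x: "?x \<in> homs S ?V ?W" by (rule S.unshift_in_shift[OF FX W y(1)])
  have xm: "Comp S ?W ?V ?W ?x (mate X) = Ident S ?W"
    by (rule shift_adj_inj[OF X W])
      (use shift_adj_comp_mate[OF X W x] y S.shift_unshift_transpose[OF FX W y(1)] W V x m i
          in simp_all)
  have "Comp S ?W ?V ?V (Comp S ?V ?W ?V (mate X) ?x) (mate X) = Comp S ?W ?V ?V (Ident S ?V)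
      (mate X)"
    using S.comp_assoc[OF W V W V m x m] xm W V m
        by (simp add: S.comp_ident_left S.comp_ident_right)
  then have "Comp S ?V ?W ?V (mate X) ?x = Ident S ?V"
    by (rule inj[OF V, rotated 2]) (use V W m x S.ident_in in simp_all)
  then show "is_iso S (FO (comp_functor F (Unshift T)) X) (FO (comp_functor (Unshift S) F) X)
      (mate X)"
    using m x xm by (auto simp: is_iso_def comp_functor_def)
next
  fix X Y f assume X: "X \<in> Obj T" and Y: "Y \<in> Obj T" and f: "f \<in> homs T X Y"
  let ?U = "FO (Unshift T)" and ?V = "\<lambda>X. FO (Unshift S) (FO F X)"
  have o: "FO F X \<in> Obj S" "?V X \<in> Obj S" "?U X \<in> Obj T" "FO (Shift T) (?U X) = X"
    "FO F Y \<in> Obj S" "?V Y \<in> Obj S" "FO (Shift S) (?V Y) = FO F Y" "?U Y \<in> Obj T"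
        "FO (Shift T) (?U Y) = Y"
    "FO G (?V Y) \<in> Obj T" "FO F (?U X) \<in> Obj S" "FO F (?U Y) \<in> Obj S"
    using X Y by simp_all
  let ?Uf = "FM (Unshift T) X Y f" and ?VFf = "FM (Unshift S) (FO F X) (FO F Y) (FM F X Y f)"
  have Ff: "FM F X Y f \<in> homs S (FO F X) (FO F Y)" by (rule F_D(3)[OF X Y f])
  have Uf: "?Uf \<in> homs T (?U X) (?U Y)" by (rule T.unshift_D(3)[OF X Y f])
  have FUf: "FM F (?U X) (?U Y) ?Uf \<in> homs S (FO F (?U X)) (FO F (?U Y))"
      by (rule F_D(3)[OF o(3,8) Uf])
  have VFf: "?VFf \<in> homs S (?V X) (?V Y)" by (rule S.unshift_D(3)[OF o(1,5) Ff])
  note m = mate_in[OF X] mate_in[OF Y]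
  have "FM (Shift T) (?U X) (FO G (?V Y)) (\<Phi> (?U X) (?V Y)
      (Comp S (FO F (?U X)) (FO F (?U Y)) (?V Y) (mate Y) (FM F (?U X) (?U Y) ?Uf))) =
    FM (Shift T) (?U X) (FO G (?V Y)) (Comp T (?U X) (?U Y) (FO G (?V Y))
        (\<Phi> (?U Y) (?V Y) (mate Y)) ?Uf)"
    using adj_nat_left[OF o(8,3,6) Uf m(2)] by simp
  also have "\<dots> = Comp T X Y (FO (Shift T) (FO G (?V Y)))
      (shifted_adj Y (?V Y) (Ident S (FO F Y))) f"
    using T.shift_D(6)[OF o(3,8,10) Uf adj_in[OF o(8,6) m(2)]] T.shift_unshift_mor[OF X Y f]
    by (simp add: o shift_adj_mate[OF Y])
  also have "\<dots> = shifted_adj X (?V Y) (Comp S (FO F X) (FO F Y) (FO F Y) (Ident S (FO F Y))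
      (FM F X Y f))"
    using shifted_adj_nat_left[OF Y X o(6) f, of "Ident S (FO F Y)"] S.ident_in[OF o(5)]
        by (simp add: o)
  also have "\<dots> = shifted_adj X (?V Y) (FM (Shift S) (?V X) (?V Y) ?VFf)"
    using S.shift_unshift_mor[OF o(1,5) Ff] S.comp_ident_left[OF o(1,5) Ff] by simp
  also have "\<dots> = FM (Shift T) (?U X) (FO G (?V Y)) (\<Phi> (?U X) (?V Y)
      (Comp S (FO F (?U X)) (?V X) (?V Y) ?VFf (mate X)))"
    using shift_adj_comp_mate[OF X o(6) VFf] by simp
  finally have "Comp S (FO F (?U X)) (FO F (?U Y)) (?V Y) (mate Y) (FM F (?U X) (?U Y) ?Uf) =
      Comp S (FO F (?U X)) (?V X) (?V Y) ?VFf (mate X)"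
    by (rule shift_adj_inj[OF X o(6), rotated 2]) (use o m FUf VFf in simp_all)
  then show "Comp S (FO (comp_functor F (Unshift T)) X) (FO (comp_functor F (Unshift T)) Y)
      (FO (comp_functor (Unshift S) F) Y) (mate Y) (FM (comp_functor F (Unshift T)) X Y f) =
    Comp S (FO (comp_functor F (Unshift T)) X) (FO (comp_functor (Unshift S) F) X)
      (FO (comp_functor (Unshift S) F) Y) (FM (comp_functor (Unshift S) F) X Y f) (mate X)"
    by (simp add: comp_functor_def)
qed

section \<open>Precomposition and colimits of representables\<close>

lemma adj_stage_maps:
  assumes E: "is_seq S E e" and X: "X \<in> Obj T"
  shows "stage_maps S E e (FO F X) T (image_seq_obj G E) (image_seq_map G E e) X (\<lambda>n. \<Phi> X (E n))"
  using assms adj_nat_right[OF X] by (simp add: stage_maps_def is_seq_def)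

lemma shifted_adj_stage_maps:
  assumes E: "is_seq S E e" and X: "X \<in> Obj T"
  shows "stage_maps S (shift_seq_obj S E) (shift_seq_map S E e) (FO F X)
    T (shift_seq_obj T (image_seq_obj G E)) (shift_seq_map T (image_seq_obj G E)
        (image_seq_map G E e)) X
    (\<lambda>n. shifted_adj X (E n))"
  using assms shifted_adj_nat_right[OF X] by (simp add: stage_maps_def is_seq_def)

text \<open>The map \<open>M \<circ> F \<rightarrow> colim Y(G E)\<close> that arises from \<open>q : M \<rightarrow> colim Y(E)\<close> by means of \<open>S(F X, E
  n) \<cong> T(X, G (E n))\<close>.\<close>

definition adj_transpose ::
  "('p, 'n, 'a) module_data \<Rightarrow> (nat \<Rightarrow> 'p) \<Rightarrow> (nat \<Rightarrow> 'n) \<Rightarrow> ('p \<Rightarrow> 'a \<Rightarrow> (nat \<times> 'n) set) \<Rightarrow>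
    'o \<Rightarrow> 'a \<Rightarrow> (nat \<times> 'm) set" where
  "adj_transpose M E e q = (\<lambda>X\<in>Obj T. \<lambda>x\<in>carrier (FO M (FO F X)).
    stage_colim T (image_seq_obj G E) (image_seq_map G E e) X (\<lambda>n. \<Phi> X (E n)) (q (FO F X) x))"

lemma adj_transpose_class:
  assumes E: "is_seq S E e" and X: "X \<in> Obj T" and x: "x \<in> carrier (FO M (FO F X))"
    and k: "k \<in> homs S (FO F X) (E n)" and q: "q (FO F X) x = colim_class S E e (FO F X) n k"
  shows "adj_transpose M E e q X x = colim_class T (image_seq_obj G E) (image_seq_map G E e) X n
      (\<Phi> X (E n) k)"
  using stage_colim_class[OF S.preadditive_category_axioms E F_D(1)[OF X]
      T.preadditive_category_axioms
      is_seq_image[OF G_functor E] X adj_stage_maps[OF E X] k] X x q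
  by (simp add: adj_transpose_def)

lemma adj_transpose_iso:
  assumes E: "is_seq S E e" and M: "M \<in> Obj (Mod S)" and q: "mod_iso S M (yoneda_colim S E e) q"
  shows "mod_iso T (FO (precomp T F) M) (yoneda_colim T (image_seq_obj G E) (image_seq_map G E e))
      (adj_transpose M E e q)"
proof -
  have q': "q \<in> carrier (mod_hom S M (yoneda_colim S E e))"
    and q_bij: "\<And>Y. Y \<in> Obj S \<Longrightarrow> bij_betw (q Y) (carrier (FO M Y))
        (carrier (FO (yoneda_colim S E e) Y))"
    using q by (auto simp: mod_iso_iff_bij[OF M])
  have En: "E n \<in> Obj S" for n using E by (simp add: is_seq_def)
  let ?t = "\<lambda>X. stage_colim T (image_seq_obj G E) (image_seq_map G E e) X (\<lambda>n. \<Phi> X (E n))"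
  note seqs = S.preadditive_category_axioms E _ T.preadditive_category_axioms
      is_seq_image[OF G_functor E]
  have hom: "?t X \<in> hom (FO (yoneda_colim S E e) (FO F X)) (FO (yoneda_colim T (image_seq_obj G E)
      (image_seq_map G E e)) X)"
    if X: "X \<in> Obj T" for X
    by (rule stage_colim_hom[OF seqs(1,2) F_D(1)[OF X] seqs(4,5) X adj_stage_maps[OF E X]
        adj_hom[OF X En]])
  have bij: "bij_betw (?t X) (carrier (FO (yoneda_colim S E e) (FO F X)))
      (carrier (FO (yoneda_colim T (image_seq_obj G E) (image_seq_map G E e)) X))"
    if X: "X \<in> Obj T" for X
    by (rule stage_colim_bij[OF seqs(1,2) F_D(1)[OF X] seqs(4,5) X adj_stage_maps[OF E X]
        adj_bij[OF X En]])
  have "adj_transpose M E e q \<in> carrier (mod_hom T (FO (precomp T F) M)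
      (yoneda_colim T (image_seq_obj G E) (image_seq_map G E e)))"
    unfolding mod_hom_iff
  proof (intro conjI ballI)
    fix X assume X: "X \<in> Obj T"
    have "?t X \<circ> q (FO F X) \<in> hom (FO M (FO F X)) (FO (yoneda_colim T (image_seq_obj G E)
        (image_seq_map G E e)) X)"
      using hom_compose[OF mod_hom_hom[OF q' F_D(1)[OF X]] hom[OF X]] .
    then show "adj_transpose M E e q X \<in> hom (FO (FO (precomp T F) M) X)
        (FO (yoneda_colim T (image_seq_obj G E) (image_seq_map G E e)) X)"
      using X module_mult_in[OF M F_D(1)[OF X]] by (auto simp: adj_transpose_def hom_def Pi_iff)
    show "adj_transpose M E e q X \<in> extensional (carrier (FO (FO (precomp T F) M) X))"
      using X by (simp add: adj_transpose_def)
  next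
    fix X Y f x assume X: "X \<in> Obj T" and Y: "Y \<in> Obj T" and f: "f \<in> homs T Y X"
      and "x \<in> carrier (FO (FO (precomp T F) M) X)"
    then have x: "x \<in> carrier (FO M (FO F X))" by simp
    note o = F_D(1)[OF X] F_D(1)[OF Y] and Ff = F_D(3)[OF Y X f]
    obtain n k where k: "k \<in> homs S (FO F X) (E n)" "q (FO F X) x = colim_class S E e (FO F X) n k"
      using S.colim_class_cases[OF o(1) mod_hom_in[OF q' o(1) x]] .
    have "q (FO F Y) (FM M (FO F X) (FO F Y) (FM F Y X f) x) =
      colim_class S E e (FO F Y) n (Comp S (FO F Y) (FO F X) (E n) k (FM F Y X f))"
      using mod_hom_nat[OF q' o Ff x] S.yoneda_colim_FM_class[where n = n, OF E o Ff k(1)] k(2)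
          by simp
    then show "adj_transpose M E e q Y (FM (FO (precomp T F) M) X Y f x) =
      FM (yoneda_colim T (image_seq_obj G E) (image_seq_map G E e)) X Y f (adj_transpose M E e q X
          x)"
      using adj_transpose_class[where n = n and E = E and q = q, OF E Y module_in[OF M o Ff x]
          S.comp_in[OF o(2,1) En Ff k(1)]]
        adj_transpose_class[where n = n and E = E and q = q, OF E X x k] adj_nat_left[OF X Y En f
            k(1)] X Y f
        T.yoneda_colim_FM_class[where n = n, OF is_seq_image[OF G_functor E] X Y f
            adj_in[OF X En k(1)]]
      by simp
  qed (simp add: adj_transpose_def)
  moreover have "bij_betw (adj_transpose M E e q X) (carrier (FO (FO (precomp T F) M) X))
    (carrier (FO (yoneda_colim T (image_seq_obj G E) (image_seq_map G E e)) X))" if X: "X \<in> Obj T"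
        for X
    using bij_betw_trans[OF q_bij[OF F_D(1)[OF X]] bij[OF X]] X
    by (subst bij_betw_cong[of _ _ "?t X \<circ> q (FO F X)"]) (auto simp: adj_transpose_def)
  ultimately show ?thesis
    by (simp add: mod_iso_iff_bij[OF precomp_module[OF T.preadditive_category_axioms F_functor M]])
qed

text \<open>Naturality of the adjunction bijection in its second variable, in the colimit.\<close>

lemma adj_transpose_square:
  assumes a: "is_seq S a \<alpha>" and b: "is_seq S b \<beta>"
    and u: "\<And>n. u n \<in> homs S (a n) (b n)"
    and nat: "\<And>n. Comp S (a n) (a (Suc n)) (b (Suc n)) (u (Suc n)) (\<alpha> n) =
      Comp S (a n) (b n) (b (Suc n)) (\<beta> n) (u n)"
    and p: "p \<in> carrier (mod_hom S L (yoneda_colim S a \<alpha>))"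
    and f: "f \<in> carrier (mod_hom S L M)"
    and square: "mod_comp S L q f = mod_comp S L (yoneda_colim_map S a \<alpha> b \<beta> u) p"
  shows "mod_comp T (FO (precomp T F) L) (adj_transpose M b \<beta> q) (FM (precomp T F) L M f) =
    mod_comp T (FO (precomp T F) L)
      (yoneda_colim_map T (image_seq_obj G a) (image_seq_map G a \<alpha>) (image_seq_obj G b)
          (image_seq_map G b \<beta>)
        (\<lambda>n. FM G (a n) (b n) (u n)))
      (adj_transpose L a \<alpha> p)"
  unfolding mod_comp_eq_iff
proof (intro ballI)
  fix X x assume X: "X \<in> Obj T" and "x \<in> carrier (FO (FO (precomp T F) L) X)"
  then have x: "x \<in> carrier (FO L (FO F X))" by simp
  note FX = F_D(1)[OF X]
  have o: "a n \<in> Obj S" "b n \<in> Obj S" "\<alpha> n \<in> homs S (a n) (a (Suc n))" "\<beta> n \<in> homs S (b n)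
      (b (Suc n))" for n
    using a b by (auto simp: is_seq_def)
  obtain n k where k: "k \<in> homs S (FO F X) (a n)" "p (FO F X) x = colim_class S a \<alpha> (FO F X) n k"
    using S.colim_class_cases[OF FX mod_hom_in[OF p FX x]] .
  have "q (FO F X) (f (FO F X) x) = yoneda_colim_map S a \<alpha> b \<beta> u (FO F X) (p (FO F X) x)"
    using square FX x by (auto simp: mod_comp_eq_iff)
  also have "\<dots> = colim_class S b \<beta> (FO F X) n (Comp S (FO F X) (a n) (b n) (u n) k)"
    using S.yoneda_colim_map_class[where n = n, OF a b FX u nat k(1)] k(2) by simp
  finally have "adj_transpose M b \<beta> q X (f (FO F X) x) = colim_class T (image_seq_obj G b)
      (image_seq_map G b \<beta>) X n
      (\<Phi> X (b n) (Comp S (FO F X) (a n) (b n) (u n) k))"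
    by (intro adj_transpose_class[OF b X mod_hom_in[OF f FX x]]) (use FX o u k in simp_all)
  also have "\<dots> = yoneda_colim_map T (image_seq_obj G a) (image_seq_map G a \<alpha>) (image_seq_obj G b)
      (image_seq_map G b \<beta>)
        (\<lambda>n. FM G (a n) (b n) (u n)) X (colim_class T (image_seq_obj G a) (image_seq_map G a \<alpha>) X
            n (\<Phi> X (a n) k))"
  proof (subst T.yoneda_colim_map_class[where n = n, OF is_seq_image[OF G_functor a]
      is_seq_image[OF G_functor b] X])
    show "FM G (a n) (b n) (u n) \<in> homs T (FO G (a n)) (FO G (b n))" for n
      using G_D(3)[OF o(1,2) u] .
    show "Comp T (FO G (a n)) (FO G (a (Suc n))) (FO G (b (Suc n))) (FM G (a (Suc n)) (b (Suc n))
        (u (Suc n)))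
        (FM G (a n) (a (Suc n)) (\<alpha> n)) =
      Comp T (FO G (a n)) (FO G (b n)) (FO G (b (Suc n))) (FM G (b n) (b (Suc n)) (\<beta> n))
          (FM G (a n) (b n) (u n))" for n
      using G_D(6)[OF o(1) o(1) o(2) o(3) u] G_D(6)[OF o(1) o(2) o(2) u o(4)] nat by metis
  qed (use X o k adj_nat_right[OF X o(1,2) u k(1)] in simp_all)
  also have "colim_class T (image_seq_obj G a) (image_seq_map G a \<alpha>) X n (\<Phi> X (a n) k) =
      adj_transpose L a \<alpha> p X x"
    using adj_transpose_class[where n = n and E = a and q = p, OF a X x k] by simp
  finally show "adj_transpose M b \<beta> q X (FM (precomp T F) L M f X x) =
    yoneda_colim_map T (image_seq_obj G a) (image_seq_map G a \<alpha>) (image_seq_obj G b)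
        (image_seq_map G b \<beta>)
      (\<lambda>n. FM G (a n) (b n) (u n)) X (adj_transpose L a \<alpha> p X x)"
    using X by simp
qed

end

section \<open>The image of a distinguished triangle\<close>

lemma colim_triangleI:
  assumes "good_cauchy T B a \<alpha>" "good_cauchy T B b \<beta>" "good_cauchy T B c \<gamma>"
    and "good_cauchy T B (shift_seq_obj T a) (shift_seq_map T a \<alpha>)"
    and "\<And>n. Tri T (a n) (b n) (c n) (u n) (v n) (w n)"
    and "\<And>n. triangle_mor T (a n) (b n) (c n) (u n) (v n) (w n)
                (a (Suc n)) (b (Suc n)) (c (Suc n)) (u (Suc n)) (v (Suc n)) (w (Suc n))
                (\<alpha> n) (\<beta> n) (\<gamma> n)"
    and "mod_iso T L (yoneda_colim T a \<alpha>) p" "mod_iso T M (yoneda_colim T b \<beta>) q"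
      "mod_iso T N (yoneda_colim T c \<gamma>) r"
    and "mod_comp T L q f = mod_comp T L (yoneda_colim_map T a \<alpha> b \<beta> u) p"
    and "mod_comp T M r g = mod_comp T M (yoneda_colim_map T b \<beta> c \<gamma> v) q"
    and "mod_comp T N
          (mod_comp T (FO (mod_shift T) L) (shift_colim T a \<alpha>)
            (\<lambda>X\<in>Obj T. p (FO (Unshift T) X))) h =
        mod_comp T N
          (yoneda_colim_map T c \<gamma> (shift_seq_obj T a) (shift_seq_map T a \<alpha>) w) r"
  shows "colim_triangle T B L M N f g h"
  using assms unfolding colim_triangle_def by blast

context exact_right_adjoint
begin

text \<open>The isomorphism \<open>(\<Sigma> M) \<circ> F \<cong> \<Sigma> (M \<circ> F)\<close> given by the mate of \<open>\<psi>\<close>.\<close>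

definition precomp_shift_iso :: "('p, 'n, 'a) module_data \<Rightarrow> 'o \<Rightarrow> 'a \<Rightarrow> 'a" where
  "precomp_shift_iso = whisker T (comp_functor F (Unshift T)) (comp_functor (Unshift S) F) mate"

lemma precomp_shift_iso:
  assumes M: "M \<in> Obj (Mod S)"
  shows "mod_iso T (FO (precomp T F) (FO (mod_shift S) M)) (FO (mod_shift T) (FO (precomp T F) M))
    (precomp_shift_iso M)"
  unfolding precomp_shift_iso_def precomp_comp_functor[OF F_functor]
      precomp_comp_functor[OF T.unshift_functor]
  by (rule whisker_iso[OF T.preadditive_category_axioms comp_functor_additive[OF T.unshift_functor
      F_functor]
        comp_functor_additive[OF F_functor S.unshift_functor] mate_nat_iso M])

lemma precomp_shift_iso_apply:
  "\<lbrakk>X \<in> Obj T; x \<in> carrier (FO M (FO (Unshift S) (FO F X)))\<rbrakk> \<Longrightarrow>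
    precomp_shift_iso M X x = FM M (FO (Unshift S) (FO F X)) (FO F (FO (Unshift T) X)) (mate X) x"
  by (simp add: precomp_shift_iso_def whisker_def comp_functor_def)

lemma precomp_shift_iso_nat:
  assumes \<eta>: "\<eta> \<in> carrier (mod_hom S M N)"
  shows "mod_comp T (FO (precomp T F) (FO (mod_shift S) M)) (precomp_shift_iso N)
      (FM (precomp T F) M' N' (FM (mod_shift S) M N \<eta>)) =
    mod_comp T (FO (precomp T F) (FO (mod_shift S) M))
      (FM (mod_shift T) M'' N'' (FM (precomp T F) M N \<eta>)) (precomp_shift_iso M)"
  unfolding mod_comp_eq_iff
  using mod_hom_in[OF \<eta>] mod_hom_nat[OF \<eta>] by (simp add: precomp_shift_iso_apply)

text \<open>The third map of the triangle that \<open>G\<close> makes out of a triangle with third map \<open>w : A'' \<rightarrow> \<Sigma>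
  A\<close>.\<close>

definition image_third :: "'p \<Rightarrow> 'p \<Rightarrow> 'n \<Rightarrow> 'm" where
  "image_third A A'' w =
    Comp T (FO G A'') (FO G (FO (Shift S) A)) (FO (Shift T) (FO G A)) (\<psi> A)
        (FM G A'' (FO (Shift S) A) w)"

lemma image_third_in [simp]:
  assumes "A \<in> Obj S" "A'' \<in> Obj S" "w \<in> homs S A'' (FO (Shift S) A)"
  shows "image_third A A'' w \<in> homs T (FO G A'') (FO (Shift T) (FO G A))"
  unfolding image_third_def using assms G_D(3)[OF assms(2) S.shift_D(1)[OF assms(1)] assms(3)]
      by simp

lemma image_third_nat:
  assumes A: "A \<in> Obj S" "A' \<in> Obj S" and D: "D \<in> Obj S" "D' \<in> Obj S"
    and a: "a \<in> homs S A A'" and d: "d \<in> homs S D D'"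
    and w: "w \<in> homs S D (FO (Shift S) A)" and w': "w' \<in> homs S D' (FO (Shift S) A')"
    and nat: "Comp S D (FO (Shift S) A) (FO (Shift S) A') (FM (Shift S) A A' a) w =
      Comp S D D' (FO (Shift S) A') w' d"
  shows "Comp T (FO G D) (FO (Shift T) (FO G A)) (FO (Shift T) (FO G A'))
      (FM (Shift T) (FO G A) (FO G A') (FM G A A' a)) (image_third A D w) =
    Comp T (FO G D) (FO G D') (FO (Shift T) (FO G A')) (image_third A' D' w') (FM G D D' d)"
proof -
  have s: "FO (Shift S) A \<in> Obj S" "FO (Shift S) A' \<in> Obj S" using A by auto
  note o = D[THEN G_D(1)] s[THEN G_D(1)] A[THEN G_D(1), THEN T.shift_D(1)]
  note psi = A[THEN shift_iso_in]
  have sa: "FM (Shift S) A A' a \<in> homs S (FO (Shift S) A) (FO (Shift S) A')"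
      by (rule S.shift_D(3)[OF A a])
  note Gsa = G_D(3)[OF s sa] and Gw = G_D(3)[OF D(1) s(1) w] and Gw' = G_D(3)[OF D(2) s(2) w']
    and Gd = G_D(3)[OF D d]
  have SGa: "FM (Shift T) (FO G A) (FO G A') (FM G A A' a) \<in> homs T (FO (Shift T) (FO G A))
      (FO (Shift T) (FO G A'))"
    by (rule T.shift_D(3)[OF A[THEN G_D(1)] G_D(3)[OF A a]])
  show ?thesis
    unfolding image_third_def T.comp_assoc[OF o(1,3,5,6) Gw psi(1) SGa] shift_iso_nat[OF A a,
        symmetric]
      T.comp_assoc[OF o(1,3,4,6) Gw Gsa psi(2), symmetric] G_D(6)[OF D(1) s w sa, symmetric] nat
      G_D(6)[OF D s(2) d w'] T.comp_assoc[OF o(1,2,4,6) Gd Gw' psi(2)] ..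
qed

text \<open>In this square \<open>\<psi>\<close> occurs both in the third map of the image of a triangle and, through its
  mate, in the isomorphism \<open>(\<Sigma> L) \<circ> F \<cong> \<Sigma> (L \<circ> F)\<close>; both sides are the image of the given square
  under \<open>colim S(F X, \<Sigma> a) \<rightarrow> colim T(X, \<Sigma> G a)\<close>.\<close>

lemma adj_transpose_shift_square:
  assumes a: "is_seq S a \<alpha>" and c: "is_seq S c \<gamma>"
    and w: "\<And>n. w n \<in> homs S (c n) (FO (Shift S) (a n))"
    and nat: "\<And>n. Comp S (c n) (FO (Shift S) (a n)) (FO (Shift S) (a (Suc n)))
        (FM (Shift S) (a n) (a (Suc n)) (\<alpha> n)) (w n) =
      Comp S (c n) (c (Suc n)) (FO (Shift S) (a (Suc n))) (w (Suc n)) (\<gamma> n)"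
    and L: "L \<in> Obj (Mod S)"
    and p: "p \<in> carrier (mod_hom S L (yoneda_colim S a \<alpha>))"
    and r: "r \<in> carrier (mod_hom S N (yoneda_colim S c \<gamma>))"
    and h: "h \<in> carrier (mod_hom S N (FO (mod_shift S) L))"
    and square: "mod_comp S N (mod_comp S (FO (mod_shift S) L) (shift_colim S a \<alpha>)
          (\<lambda>Y\<in>Obj S. p (FO (Unshift S) Y))) h =
      mod_comp S N (yoneda_colim_map S c \<gamma> (shift_seq_obj S a) (shift_seq_map S a \<alpha>) w) r"
  shows "mod_comp T (FO (precomp T F) N)
      (mod_comp T (FO (mod_shift T) (FO (precomp T F) L)) (shift_colim T (image_seq_obj G a)
          (image_seq_map G a \<alpha>))
        (\<lambda>X\<in>Obj T. adj_transpose L a \<alpha> p (FO (Unshift T) X)))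
      (mod_comp T (FO (precomp T F) N) (precomp_shift_iso L) (FM (precomp T F) N (FO (mod_shift S)
          L) h)) =
    mod_comp T (FO (precomp T F) N)
      (yoneda_colim_map T (image_seq_obj G c) (image_seq_map G c \<gamma>)
        (shift_seq_obj T (image_seq_obj G a)) (shift_seq_map T (image_seq_obj G a)
            (image_seq_map G a \<alpha>))
        (\<lambda>n. image_third (a n) (c n) (w n)))
      (adj_transpose N c \<gamma> r)"
  unfolding mod_comp_eq_iff
proof (intro ballI)
  fix X x assume X: "X \<in> Obj T" and "x \<in> carrier (FO (FO (precomp T F) N) X)"
  then have x: "x \<in> carrier (FO N (FO F X))" by simp
  let ?U = "FO (Unshift T) X" and ?V = "FO (Unshift S) (FO F X)" and ?W = "FO F (FO (Unshift T) X)"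
  let ?Ga = "image_seq_obj G a" and ?G\<alpha> = "image_seq_map G a \<alpha>"
  let ?SGa = "shift_seq_obj T ?Ga" and ?SG\<alpha> = "shift_seq_map T ?Ga ?G\<alpha>"
  have FX: "FO F X \<in> Obj S" and V: "?V \<in> Obj S" and W: "?W \<in> Obj S" and U: "?U \<in> Obj T" using X
      by simp_all
  have o: "a n \<in> Obj S" "c n \<in> Obj S" "FO (Shift S) (a n) \<in> Obj S"
    "\<alpha> n \<in> homs S (a n) (a (Suc n))" "\<gamma> n \<in> homs S (c n) (c (Suc n))" for n
    using a c by (auto simp: is_seq_def)
  note Sa = S.is_seq_shift[OF a] and Ga = is_seq_image[OF G_functor a] and Gc =
      is_seq_image[OF G_functor c]
  note SGa = T.is_seq_shift[OF Ga]
  note m = mate_in[OF X]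
  obtain n k where k: "k \<in> homs S (FO F X) (c n)" "r (FO F X) x = colim_class S c \<gamma> (FO F X) n k"
    using S.colim_class_cases[OF FX mod_hom_in[OF r FX x]] .
  let ?z = "h (FO F X) x"
  have z: "?z \<in> carrier (FO L ?V)" using mod_hom_in[OF h FX x] FX by simp
  obtain i l where l: "l \<in> homs S ?V (a i)" "p ?V ?z = colim_class S a \<alpha> ?V i l"
    using S.colim_class_cases[OF V mod_hom_in[OF p V z]] .
  have wk: "Comp S (FO F X) (c n) (FO (Shift S) (a n)) (w n) k \<in> homs S (FO F X)
      (FO (Shift S) (a n))"
    using FX o w k(1) by simp
  have sl: "FM (Shift S) ?V (a i) l \<in> homs S (FO F X) (FO (Shift S) (a i))"
    by (rule S.shift_in_unshift[OF FX o(1) l(1)])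
  have "shift_colim S a \<alpha> (FO F X) (p ?V ?z) =
      yoneda_colim_map S c \<gamma> (shift_seq_obj S a) (shift_seq_map S a \<alpha>) w (FO F X) (r (FO F X) x)"
    using iffD1[OF mod_comp_eq_iff square, rule_format, OF FX x] FX z by simp
  then have "colim_class S (shift_seq_obj S a) (shift_seq_map S a \<alpha>) (FO F X) i
      (FM (Shift S) ?V (a i) l) =
      colim_class S (shift_seq_obj S a) (shift_seq_map S a \<alpha>) (FO F X) n
        (Comp S (FO F X) (c n) (FO (Shift S) (a n)) (w n) k)"
    using S.shift_colim_class[where n = i, OF a FX l(1)]
      S.yoneda_colim_map_class[where n = n, OF c Sa FX w nat[symmetric] k(1)] l(2) k(2) by simp
  from stage_maps_class_cong[OF S.preadditive_category_axioms Sa FX T.preadditive_category_axioms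
      SGa X
      shifted_adj_stage_maps[OF a X] sl wk this]
  have key: "colim_class T ?SGa ?SG\<alpha> X i (shifted_adj X (a i) (FM (Shift S) ?V (a i) l)) =
      colim_class T ?SGa ?SG\<alpha> X n (shifted_adj X (a n) (Comp S (FO F X) (c n) (FO (Shift S) (a n))
          (w n) k))" .
  \<comment> \<open>The left hand side becomes the left hand side of \<open>key\<close> by \<open>shift_adj_comp_mate\<close>.\<close>
  let ?y = "FM L ?V ?W (mate X) ?z"
  have y: "?y \<in> carrier (FO L ?W)" by (rule module_in[OF L V W m z])
  have lm: "Comp S ?W ?V (a i) l (mate X) \<in> homs S ?W (a i)" using W V o m l by simp
  have "p ?W ?y = colim_class S a \<alpha> ?W i (Comp S ?W ?V (a i) l (mate X))"
    using mod_hom_nat[OF p V W m z] S.yoneda_colim_FM_class[where n = i, OF a V W m l(1)] l(2)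
        by simp
  then have "adj_transpose L a \<alpha> p ?U ?y =
      colim_class T ?Ga ?G\<alpha> ?U i (\<Phi> ?U (a i) (Comp S ?W ?V (a i) l (mate X)))"
    by (rule adj_transpose_class[where n = i and E = a and q = p, OF a U y lm])
  then have "shift_colim T ?Ga ?G\<alpha> X (adj_transpose L a \<alpha> p ?U ?y) =
      colim_class T ?SGa ?SG\<alpha> X i (shifted_adj X (a i) (FM (Shift S) ?V (a i) l))"
    using T.shift_colim_class[where n = i, OF Ga X adj_in[OF U o(1) lm]] shift_adj_comp_mate[OF X
        o(1) l(1)] by simp
  moreover have "mod_comp T (FO (mod_shift T) (FO (precomp T F) L)) (shift_colim T ?Ga ?G\<alpha>)
        (\<lambda>X\<in>Obj T. adj_transpose L a \<alpha> p (FO (Unshift T) X)) X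
      (mod_comp T (FO (precomp T F) N) (precomp_shift_iso L) (FM (precomp T F) N (FO (mod_shift S)
          L) h) X x) =
    shift_colim T ?Ga ?G\<alpha> X (adj_transpose L a \<alpha> p ?U ?y)"
    using X x y z by (simp add: precomp_shift_iso_apply)
  \<comment> \<open>The right hand side becomes that of \<open>key\<close> because \<open>\<Phi>\<close> is natural.\<close>
  moreover have "adj_transpose N c \<gamma> r X x = colim_class T (image_seq_obj G c) (image_seq_map G c
      \<gamma>) X n (\<Phi> X (c n) k)"
    by (rule adj_transpose_class[where n = n and E = c and q = r, OF c X x k])
  moreover have "yoneda_colim_map T (image_seq_obj G c) (image_seq_map G c \<gamma>) ?SGa ?SG\<alpha>
        (\<lambda>n. image_third (a n) (c n) (w n)) X
        (colim_class T (image_seq_obj G c) (image_seq_map G c \<gamma>) X n (\<Phi> X (c n) k)) =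
      colim_class T ?SGa ?SG\<alpha> X n
        (Comp T X (FO G (c n)) (FO (Shift T) (FO G (a n))) (image_third (a n) (c n) (w n))
            (\<Phi> X (c n) k))"
    by (rule T.yoneda_colim_map_class[OF Gc SGa X])
      (use X o k(1) w image_third_nat[OF o(1,1) o(2,2) o(4,5) w w nat] in simp_all)
  moreover have "Comp T X (FO G (c n)) (FO (Shift T) (FO G (a n))) (image_third (a n) (c n) (w n))
      (\<Phi> X (c n) k) =
      shifted_adj X (a n) (Comp S (FO F X) (c n) (FO (Shift S) (a n)) (w n) k)"
    unfolding shifted_adj_def image_third_def adj_nat_right[OF X o(2,3) w k(1)]
    by (rule T.comp_assoc[symmetric]) (use X o k(1) G_D(3)[OF o(2,3) w] in simp_all)
  ultimately show "mod_comp T (FO (mod_shift T) (FO (precomp T F) L)) (shift_colim T ?Ga ?G\<alpha>)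
        (\<lambda>X\<in>Obj T. adj_transpose L a \<alpha> p (FO (Unshift T) X)) X
      (mod_comp T (FO (precomp T F) N) (precomp_shift_iso L) (FM (precomp T F) N (FO (mod_shift S)
          L) h) X x) =
    yoneda_colim_map T (image_seq_obj G c) (image_seq_map G c \<gamma>) ?SGa ?SG\<alpha>
        (\<lambda>n. image_third (a n) (c n) (w n)) X (adj_transpose N c \<gamma> r X x)"
    using key by simp
qed

text \<open>The sequence \<open>\<Sigma> G a\<close> is isomorphic to \<open>G \<Sigma> a\<close> by \<open>\<psi>\<close>, and \<open>G \<Sigma> a\<close> is the image of a good
  Cauchy sequence.\<close>

lemma shift_image_good_cauchy:
  assumes B: "metric T B" and G: "compression S C T B G"
    and Sa: "good_cauchy S C (shift_seq_obj S a) (shift_seq_map S a \<alpha>)" and a: "is_seq S a \<alpha>"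
  shows "good_cauchy T B (shift_seq_obj T (image_seq_obj G a))
      (shift_seq_map T (image_seq_obj G a) (image_seq_map G a \<alpha>))"
proof -
  have o: "a n \<in> Obj S" "\<alpha> n \<in> homs S (a n) (a (Suc n))" for n using a by (auto simp: is_seq_def)
  let ?GS = "\<lambda>n. FO G (FO (Shift S) (a n))" and ?SG = "\<lambda>n. FO (Shift T) (FO G (a n))"
  have "\<exists>\<phi>. \<phi> \<in> homs T (?SG n) (?GS n) \<and> Comp T (?GS n) (?SG n) (?GS n) \<phi> (\<psi> (a n)) =
      Ident T (?GS n) \<and>
      Comp T (?SG n) (?GS n) (?SG n) (\<psi> (a n)) \<phi> = Ident T (?SG n)" for n
    using shift_iso[OF o(1)[of n]] by (auto simp: is_iso_def)
  then obtain \<phi> where \<phi>: "\<And>n. \<phi> n \<in> homs T (?SG n) (?GS n)"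
    "\<And>n. Comp T (?GS n) (?SG n) (?GS n) (\<phi> n) (\<psi> (a n)) = Ident T (?GS n)"
    "\<And>n. Comp T (?SG n) (?GS n) (?SG n) (\<psi> (a n)) (\<phi> n) = Ident T (?SG n)"
    by metis
  have psi: "\<psi> (a n) \<in> homs T (?GS n) (?SG n)" for n using o by simp
  have ob: "?GS n \<in> Obj T" "?SG n \<in> Obj T" for n using o by simp_all
  have mor: "FM G (FO (Shift S) (a n)) (FO (Shift S) (a (Suc n))) (FM (Shift S) (a n) (a (Suc n))
      (\<alpha> n))
      \<in> homs T (?GS n) (?GS (Suc n))"
    "FM (Shift T) (FO G (a n)) (FO G (a (Suc n))) (FM G (a n) (a (Suc n)) (\<alpha> n)) \<in> homs T (?SG n)
        (?SG (Suc n))" for n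
    using is_seq_image[OF G_functor S.is_seq_shift[OF a]]
        T.is_seq_shift[OF is_seq_image[OF G_functor a]]
    by (auto simp: is_seq_def)
  show ?thesis
  proof (rule T.good_cauchy_iso[OF good_cauchy_image[OF S.triangulated_category_axioms
      T.triangulated_category_axioms G B Sa]
        T.is_seq_shift[OF is_seq_image[OF G_functor a]]])
    show "is_iso T (?SG n) (?GS n) (\<phi> n)" for n
      using \<phi> psi unfolding is_iso_def by blast
    show "Comp T (?SG n) (?SG (Suc n)) (?GS (Suc n)) (\<phi> (Suc n))
        (FM (Shift T) (FO G (a n)) (FO G (a (Suc n))) (FM G (a n) (a (Suc n)) (\<alpha> n))) =
      Comp T (?SG n) (?GS n) (?GS (Suc n))
        (FM G (FO (Shift S) (a n)) (FO (Shift S) (a (Suc n))) (FM (Shift S) (a n) (a (Suc n))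
            (\<alpha> n))) (\<phi> n)" for n
      by (rule T.iso_square_inverse[OF ob(1) ob(2) ob(1) ob(2) psi \<phi>(1) \<phi>(3) psi \<phi>(1) \<phi>(2) mor
          shift_iso_nat[OF o(1,1,2)]])
  qed
qed

lemma colim_triangle_precomp:
  assumes B: "metric T B" and G: "compression S C T B G"
    and L: "L \<in> Obj (Mod S)" and M: "M \<in> Obj (Mod S)" and N: "N \<in> Obj (Mod S)"
    and f: "f \<in> carrier (mod_hom S L M)" and g: "g \<in> carrier (mod_hom S M N)"
    and h: "h \<in> carrier (mod_hom S N (FO (mod_shift S) L))"
    and tri: "colim_triangle S C L M N f g h"
  shows "colim_triangle T B (FO (precomp T F) L) (FO (precomp T F) M) (FO (precomp T F) N)
    (FM (precomp T F) L M f) (FM (precomp T F) M N g)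
    (mod_comp T (FO (precomp T F) N) (precomp_shift_iso L) (FM (precomp T F) N (FO (mod_shift S)
        L) h))"
proof -
  obtain a \<alpha> b \<beta> c \<gamma> u v w p q r where
    cauchy: "good_cauchy S C a \<alpha>" "good_cauchy S C b \<beta>" "good_cauchy S C c \<gamma>"
      "good_cauchy S C (shift_seq_obj S a) (shift_seq_map S a \<alpha>)"
    and t: "\<And>n. Tri S (a n) (b n) (c n) (u n) (v n) (w n)"
    and mor: "\<And>n. triangle_mor S (a n) (b n) (c n) (u n) (v n) (w n)
        (a (Suc n)) (b (Suc n)) (c (Suc n)) (u (Suc n)) (v (Suc n)) (w (Suc n)) (\<alpha> n) (\<beta> n) (\<gamma> n)"
    and iso: "mod_iso S L (yoneda_colim S a \<alpha>) p" "mod_iso S M (yoneda_colim S b \<beta>) q"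
      "mod_iso S N (yoneda_colim S c \<gamma>) r"
    and squares: "mod_comp S L q f = mod_comp S L (yoneda_colim_map S a \<alpha> b \<beta> u) p"
      "mod_comp S M r g = mod_comp S M (yoneda_colim_map S b \<beta> c \<gamma> v) q"
      "mod_comp S N (mod_comp S (FO (mod_shift S) L) (shift_colim S a \<alpha>)
          (\<lambda>Y\<in>Obj S. p (FO (Unshift S) Y))) h =
        mod_comp S N (yoneda_colim_map S c \<gamma> (shift_seq_obj S a) (shift_seq_map S a \<alpha>) w) r"
    using tri unfolding colim_triangle_def by blast
  have seq: "is_seq S a \<alpha>" "is_seq S b \<beta>" "is_seq S c \<gamma>" using cauchy
      by (auto simp: good_cauchy_def)
  have o: "a n \<in> Obj S" "b n \<in> Obj S" "c n \<in> Obj S" "FO (Shift S) (a n) \<in> Obj S"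
    "u n \<in> homs S (a n) (b n)" "v n \<in> homs S (b n) (c n)" "w n \<in> homs S (c n) (FO (Shift S) (a n))"
    "\<alpha> n \<in> homs S (a n) (a (Suc n))" "\<beta> n \<in> homs S (b n) (b (Suc n))" "\<gamma> n \<in> homs S (c n)
        (c (Suc n))" for n
    using S.tri_typed[OF t[of n]] seq by (auto simp: is_seq_def)
  have nat: "Comp S (a n) (b n) (b (Suc n)) (\<beta> n) (u n) = Comp S (a n) (a (Suc n)) (b (Suc n))
      (u (Suc n)) (\<alpha> n)"
    "Comp S (b n) (c n) (c (Suc n)) (\<gamma> n) (v n) = Comp S (b n) (b (Suc n)) (c (Suc n)) (v (Suc n))
        (\<beta> n)"
    "Comp S (c n) (FO (Shift S) (a n)) (FO (Shift S) (a (Suc n))) (FM (Shift S) (a n) (a (Suc n))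
        (\<alpha> n)) (w n) =
      Comp S (c n) (c (Suc n)) (FO (Shift S) (a (Suc n))) (w (Suc n)) (\<gamma> n)" for n
    using mor[of n] by (auto simp: triangle_mor_def)
  let ?w = "\<lambda>n. image_third (a n) (c n) (w n)"
  note cauchy_image = good_cauchy_image[OF S.triangulated_category_axioms
      T.triangulated_category_axioms G B]
  have p: "p \<in> carrier (mod_hom S L (yoneda_colim S a \<alpha>))" and q: "q \<in> carrier
      (mod_hom S M (yoneda_colim S b \<beta>))"
    and r: "r \<in> carrier (mod_hom S N (yoneda_colim S c \<gamma>))"
    using iso by (auto simp: mod_iso_def)
  have tri_image: "Tri T (FO G (a n)) (FO G (b n)) (FO G (c n)) (FM G (a n) (b n) (u n))
      (FM G (b n) (c n) (v n)) (?w n)" for n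
    using exact[OF t[of n]] by (simp add: image_third_def)
  have mor_image: "triangle_mor T (FO G (a n)) (FO G (b n)) (FO G (c n)) (FM G (a n) (b n) (u n))
      (FM G (b n) (c n) (v n)) (?w n)
      (FO G (a (Suc n))) (FO G (b (Suc n))) (FO G (c (Suc n))) (FM G (a (Suc n)) (b (Suc n))
          (u (Suc n)))
      (FM G (b (Suc n)) (c (Suc n)) (v (Suc n))) (?w (Suc n))
      (FM G (a n) (a (Suc n)) (\<alpha> n)) (FM G (b n) (b (Suc n)) (\<beta> n)) (FM G (c n) (c (Suc n))
          (\<gamma> n))" for n
    unfolding triangle_mor_def G_D(6)[OF o(1,2,2,5,9), symmetric] G_D(6)[OF o(1,1,2,8,5), symmetric]
      G_D(6)[OF o(2,3,3,6,10), symmetric] G_D(6)[OF o(2,2,3,9,6), symmetric] nat(1,2)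
    by (intro conjI G_D(3)[OF o(1,1,8)] G_D(3)[OF o(2,2,9)] G_D(3)[OF o(3,3,10)] refl
        image_third_nat[OF o(1,1,3,3,8,10,7,7) nat(3)])
  show ?thesis
    by (rule colim_triangleI[OF cauchy_image[OF cauchy(1)] cauchy_image[OF cauchy(2)]
        cauchy_image[OF cauchy(3)]
      shift_image_good_cauchy[OF B G cauchy(4) seq(1)] tri_image mor_image
      adj_transpose_iso[OF seq(1) L iso(1)] adj_transpose_iso[OF seq(2) M iso(2)]
          adj_transpose_iso[OF seq(3) N iso(3)]
      adj_transpose_square[OF seq(1,2) o(5) nat(1)[symmetric] p f squares(1)]
      adj_transpose_square[OF seq(2,3) o(6) nat(2)[symmetric] q g squares(2)]
      adj_transpose_shift_square[OF seq(1,3) o(7) nat(3) L p r h squares(3)]])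
qed

end

section \<open>The completion\<close>

lemma mem_compact_support_iff:
  assumes T: "triangulated_category T" and B: "metric T B"
  shows "M \<in> compact_support T B \<longleftrightarrow> M \<in> Obj (Mod T) \<and>
    (\<forall>j. \<exists>i. \<forall>X\<in>B i. carrier (FO M (shift_pow T j X)) = {\<one>\<^bsub>FO M (shift_pow T j X)\<^esub>})"
proof -
  interpret T: triangulated_category T by fact
  have "B i \<subseteq> Obj T" for i using B by (simp add: metric_def)
  then have "(\<forall>X\<in>B i. carrier (mod_hom T (FO (yoneda T) (shift_pow T j X)) M) =
        {\<one>\<^bsub>mod_hom T (FO (yoneda T) (shift_pow T j X)) M\<^esub>}) \<longleftrightarrow>
      (\<forall>X\<in>B i. carrier (FO M (shift_pow T j X)) = {\<one>\<^bsub>FO M (shift_pow T j X)\<^esub>})"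
    if "M \<in> Obj (Mod T)" for i j
    by (intro ball_cong refl T.yoneda_hom_trivial_iff T.shift_pow_in that) blast
  then show ?thesis by (auto simp: compact_support_def mod_perp_def)
qed

lemma compact_support_iso:
  assumes T: "triangulated_category T" and B: "metric T B"
    and M: "M \<in> compact_support T B" and N: "N \<in> Obj (Mod T)" and iso: "mod_iso T M N \<eta>"
  shows "N \<in> compact_support T B"
proof -
  interpret T: triangulated_category T by fact
  have sub: "X \<in> Obj T" if "X \<in> B i" for X i using B that by (auto simp: metric_def)
  have M': "M \<in> Obj (Mod T)" using M by (simp add: mem_compact_support_iff[OF T B])
  have "carrier (FO N A) = {\<one>\<^bsub>FO N A\<^esub>}" if "A \<in> Obj T" "carrier (FO M A) = {\<one>\<^bsub>FO M A\<^esub>}" for A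
    using module_trivial_bij[OF M' that(1) N that(1) _ that(2)] iso that(1)
        by (auto simp: mod_iso_iff_bij[OF M'])
  then show ?thesis
    using M N sub T.shift_pow_in unfolding mem_compact_support_iff[OF T B] by meson
qed

lemma pre_completion_iso:
  assumes "M \<in> pre_completion T B" and N: "N \<in> Obj (Mod T)" and "mod_iso T M N \<eta>"
  shows "N \<in> pre_completion T B"
proof -
  obtain \<theta> where \<theta>: "mod_iso T N M \<theta>" using mod_iso_sym assms(3) by blast
  have M: "M \<in> Obj (Mod T)" using assms(1) by (simp add: pre_completion_def)
  show ?thesis using assms(1) N mod_iso_trans[OF \<theta> _ N M] unfolding pre_completion_def by blast
qed

text \<open>The group \<open>(M \<circ> F)(\<Sigma>\<^sup>j X) \<cong> M(\<Sigma>\<^sup>j (F X))\<close> vanishes if \<open>F X\<close> is in the \<open>C i\<close> that belongs to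
  \<open>M\<close> and \<open>j\<close>.\<close>

lemma compact_support_precomp:
  assumes T: "triangulated_category T" and B: "metric T B" and S: "triangulated_category S"
      and C: "metric S C"
    and F: "compression T B S C F" and M: "M \<in> compact_support S C"
  shows "FO (precomp T F) M \<in> compact_support T B"
proof -
  interpret T: triangulated_category T by fact
  interpret S: triangulated_category S by fact
  have tri: "triangulated_functor T S F" using F by (simp add: compression_def)
  note add = triangulated_functor_additive[OF tri]
  have M': "M \<in> Obj (Mod S)" using M by (simp add: mem_compact_support_iff[OF S C])
  have MF: "FO (precomp T F) M \<in> Obj (Mod T)"
      by (rule precomp_module[OF T.preadditive_category_axioms add M'])
  have "\<exists>i. \<forall>X\<in>B i. carrier (FO (FO (precomp T F) M) (shift_pow T j X)) =
      {\<one>\<^bsub>FO (FO (precomp T F) M) (shift_pow T j X)\<^esub>}" for j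
  proof -
    obtain i where i: "\<And>Y. Y \<in> C i \<Longrightarrow> carrier (FO M (shift_pow S j Y)) = {\<one>\<^bsub>FO M (shift_pow S j Y)\<^esub>}"
      using M unfolding mem_compact_support_iff[OF S C] by blast
    obtain m where m: "FO F ` B m \<subseteq> C i" using F unfolding compression_def by blast
    have "carrier (FO (FO (precomp T F) M) (shift_pow T j X)) = {\<one>\<^bsub>FO (FO (precomp T F) M)
        (shift_pow T j X)\<^esub>}"
      if "X \<in> B m" for X
    proof -
      have X: "X \<in> Obj T" using B that by (auto simp: metric_def)
      let ?P = "FO F (shift_pow T j X)" and ?Q = "shift_pow S j (FO F X)"
      have o: "?P \<in> Obj S" "?Q \<in> Obj S" using X additive_functorD(1)[OF add] by simp_all
      obtain x y where xy: "x \<in> homs S ?P ?Q" "y \<in> homs S ?Q ?P"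
        "Comp S ?P ?Q ?P y x = Ident S ?P" "Comp S ?Q ?P ?Q x y = Ident S ?Q"
        using triangulated_functor_shift_pow[OF T S tri X, of j]
            by (auto simp: isomorphic_def is_iso_def)
      have "bij_betw (FM M ?Q ?P x) (carrier (FO M ?Q)) (carrier (FO M ?P))"
        using o xy by (intro bij_betwI[of _ _ _ "FM M ?P ?Q y"])
          (auto simp: module_in[OF M'] module_id[OF M'] module_comp[OF M', symmetric])
      moreover have "carrier (FO M ?Q) = {\<one>\<^bsub>FO M ?Q\<^esub>}" using i m that by blast
      ultimately have "carrier (FO M ?P) = {\<one>\<^bsub>FO M ?P\<^esub>}"
        by (rule module_trivial_bij[OF M' o(2) M' o(1)])
      then show ?thesis using X by simp
    qed
    then show ?thesis by blast
  qed
  then show ?thesis using MF by (simp add: mem_compact_support_iff[OF T B])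
qed

context exact_right_adjoint
begin

lemma pre_completion_precomp:
  assumes B: "metric T B" and G: "compression S C T B G" and M: "M \<in> pre_completion S C"
  shows "FO (precomp T F) M \<in> pre_completion T B"
proof -
  obtain E e \<eta> where M': "M \<in> Obj (Mod S)" and E: "good_cauchy S C E e" and \<eta>: "mod_iso S M
      (yoneda_colim S E e) \<eta>"
    using M by (auto simp: pre_completion_def)
  have "is_seq S E e" using E by (simp add: good_cauchy_def)
  from adj_transpose_iso[OF this M' \<eta>]
    good_cauchy_image[OF S.triangulated_category_axioms T.triangulated_category_axioms G B E]
    precomp_module[OF T.preadditive_category_axioms F_functor M']
  show ?thesis unfolding pre_completion_def by blast
qed

end

lemma completion_simps [simp]:
  "Obj (completion T B) = compact_support T B \<inter> pre_completion T B"
  "Hom (completion T B) = mod_hom T" "Ident (completion T B) = mod_ident T"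
  "Comp (completion T B) L M N = mod_comp T L"
  "Shift (completion T B) = mod_shift T"
  by (simp_all add: completion_def)

theorem theorem1p2:
  fixes T :: "('o, 'm) tricat" and S :: "('p, 'n) tricat"
    and B :: "nat \<Rightarrow> 'o set" and C :: "nat \<Rightarrow> 'p set"
    and F :: "('o, 'm, 'p, 'n) functor_data" and G :: "('p, 'n, 'o, 'm) functor_data"
  assumes "triangulated_category T" and "metric T B"
    and "triangulated_category S" and "metric S C"
    and "triangulated_functor T S F" and "triangulated_functor S T G"
    and "left_adjoint T S F G"
    and "compression T B S C F" and "compression S C T B G"
  shows "FO (precomp T F) ` Obj (completion S C :: (('p, 'n, 'a) module_data, 'p \<Rightarrow> 'a \<Rightarrow> 'a) tricat)
           \<subseteq> Obj (completion T B :: (('o, 'm, 'a) module_data, 'o \<Rightarrow> 'a \<Rightarrow> 'a) tricat)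
    \<and> triangulated_functor
        (completion S C :: (('p, 'n, 'a) module_data, 'p \<Rightarrow> 'a \<Rightarrow> 'a) tricat)
        (completion T B :: (('o, 'm, 'a) module_data, 'o \<Rightarrow> 'a \<Rightarrow> 'a) tricat)
        (precomp T F)"
proof -
  note T = assms(1) and B = assms(2) and S = assms(3) and C = assms(4)
  interpret T: triangulated_category T by (rule T)
  interpret S: triangulated_category S by (rule S)
  note F = triangulated_functor_additive[OF assms(5)] and G =
      triangulated_functor_additive[OF assms(6)]
  obtain \<Phi> where \<Phi>:
    "\<forall>X\<in>Obj T. \<forall>Y\<in>Obj S. bij_betw (\<Phi> X Y) (homs S (FO F X) Y) (homs T X (FO G Y))"
    "\<forall>X\<in>Obj T. \<forall>X'\<in>Obj T. \<forall>Y\<in>Obj S. \<forall>f\<in>homs T X' X. \<forall>k\<in>homs S (FO F X) Y.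
      \<Phi> X' Y (Comp S (FO F X') (FO F X) Y k (FM F X' X f)) = Comp T X' X (FO G Y) (\<Phi> X Y k) f"
    "\<forall>X\<in>Obj T. \<forall>Y\<in>Obj S. \<forall>Y'\<in>Obj S. \<forall>g\<in>homs S Y Y'. \<forall>k\<in>homs S (FO F X) Y.
      \<Phi> X Y' (Comp S (FO F X) Y Y' g k) = Comp T X (FO G Y) (FO G Y') (FM G Y Y' g) (\<Phi> X Y k)"
    using assms(7) unfolding left_adjoint_def by blast
  obtain \<psi> where \<psi>: "nat_iso S T (comp_functor G (Shift S)) (comp_functor (Shift T) G) \<psi>"
    "\<forall>X Y Z f g h. Tri S X Y Z f g h \<longrightarrow>
          Tri T (FO G X) (FO G Y) (FO G Z) (FM G X Y f) (FM G Y Z g)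
            (Comp T (FO G Z) (FO G (FO (Shift S) X)) (FO (Shift T) (FO G X))
              (\<psi> X) (FM G Z (FO (Shift S) X) h))"
    using assms(6) unfolding triangulated_functor_def by blast
  interpret exact_right_adjoint T S F G \<Phi> \<psi>
    by unfold_locales (use F G \<Phi> \<psi> in simp_all)
  let ?CS = "completion S C :: (('p, 'n, 'a) module_data, 'p \<Rightarrow> 'a \<Rightarrow> 'a) tricat"
  let ?CT = "completion T B :: (('o, 'm, 'a) module_data, 'o \<Rightarrow> 'a \<Rightarrow> 'a) tricat"
  let ?P = "precomp T F :: (('p, 'n, 'a) module_data, 'p \<Rightarrow> 'a \<Rightarrow> 'a, ('o, 'm, 'a) module_data,
      'o \<Rightarrow> 'a \<Rightarrow> 'a) functor_data"
  have obj: "FO ?P M \<in> Obj ?CT" if "M \<in> Obj ?CS" for M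
    using that compact_support_precomp[OF T B S C assms(8), of M] pre_completion_precomp[OF B
        assms(9), of M] by simp
  have module: "M \<in> Obj (Mod S)" if "M \<in> Obj ?CS" for M
    using that by (simp add: pre_completion_def)
  have additive: "additive_functor ?CS ?CT ?P"
    using precomp_additive[OF T.preadditive_category_axioms F, where 'a = 'a] obj module
    unfolding additive_functor_def by simp
  have nat: "nat_iso ?CS ?CT (comp_functor ?P (Shift ?CS)) (comp_functor (Shift ?CT) ?P)
      precomp_shift_iso"
    unfolding nat_iso_def
  proof (intro conjI ballI)
    fix M assume "M \<in> Obj ?CS"
    from precomp_shift_iso[OF module[OF this]]
    show "is_iso ?CT (FO (comp_functor ?P (Shift ?CS)) M) (FO (comp_functor (Shift ?CT) ?P) M)
        (precomp_shift_iso M)"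
      by (simp add: is_iso_def mod_iso_def comp_functor_def)
  next
    fix M N \<eta> assume "\<eta> \<in> homs ?CS M N"
    then show "Comp ?CT (FO (comp_functor ?P (Shift ?CS)) M) (FO (comp_functor ?P (Shift ?CS)) N)
        (FO (comp_functor (Shift ?CT) ?P) N) (precomp_shift_iso N)
            (FM (comp_functor ?P (Shift ?CS)) M N \<eta>) =
      Comp ?CT (FO (comp_functor ?P (Shift ?CS)) M) (FO (comp_functor (Shift ?CT) ?P) M)
        (FO (comp_functor (Shift ?CT) ?P) N) (FM (comp_functor (Shift ?CT) ?P) M N \<eta>)
            (precomp_shift_iso M)"
      using precomp_shift_iso_nat by (simp add: comp_functor_def)
  qed
  have triangles: "Tri ?CT (FO ?P L) (FO ?P M) (FO ?P N) (FM ?P L M f) (FM ?P M N g)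
      (Comp ?CT (FO ?P N) (FO ?P (FO (Shift ?CS) L)) (FO (Shift ?CT) (FO ?P L))
        (precomp_shift_iso L) (FM ?P N (FO (Shift ?CS) L) h))"
    if "Tri ?CS L M N f g h" for L M N f g h
  proof -
    have ob: "L \<in> Obj ?CS" "M \<in> Obj ?CS" "N \<in> Obj ?CS" "FO (mod_shift S) L \<in> Obj ?CS"
      and mor: "f \<in> carrier (mod_hom S L M)" "g \<in> carrier (mod_hom S M N)"
        "h \<in> carrier (mod_hom S N (FO (mod_shift S) L))"
      and tri: "colim_triangle S C L M N f g h"
      using that by (simp_all add: completion_def)
    note mods = ob(1-3)[THEN module]
    note iso = precomp_shift_iso[OF mods(1)]
    \<comment> \<open>The completion is closed under isomorphism, so it contains \<open>\<Sigma> (L \<circ> F) \<cong> (\<Sigma> L) \<circ> F\<close>.\<close>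
    have "FO (mod_shift T) (FO ?P L) \<in> Obj (Mod T)"
      by (rule precomp_module[OF T.preadditive_category_axioms T.unshift_functor
            precomp_module[OF T.preadditive_category_axioms F mods(1)]])
    then have shift: "FO (mod_shift T) (FO ?P L) \<in> Obj ?CT"
      using compact_support_iso[OF T B _ _ iso] pre_completion_iso[OF _ _ iso] obj[OF ob(4)] by simp
    have "mod_comp T (FO ?P N) (precomp_shift_iso L) (FM ?P N (FO (mod_shift S) L) h)
        \<in> carrier (mod_hom T (FO ?P N) (FO (mod_shift T) (FO ?P L)))"
      using iso by (intro mod_comp_in[OF precomp_mod_hom[OF F mor(3)]]
          precomp_module[OF T.preadditive_category_axioms F mods(3)])
        (simp add: mod_iso_def)
    then show ?thesis
      using obj[OF ob(1)] obj[OF ob(2)] obj[OF ob(3)] shift precomp_mod_hom[OF F mor(1)]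
          precomp_mod_hom[OF F mor(2)]
        colim_triangle_precomp[OF B assms(9) mods mor tri]
      by (simp add: completion_def)
  qed
  show ?thesis
    using obj additive nat triangles unfolding triangulated_functor_def by blast
qed

end
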